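(* Let $Q$ be an $r\times(n+r)$ $W$-matrix and let $V=\mathcal G(Q)$ be a Gale dual of $Q$. For $i=1,\dots,n+r$ denote by $Q^i$ the matrix obtained by removing from $Q$ the $i$-th column, by $d_i$ the $\gcd$ of the entries of the $i$-th column of $V$, and by $V_{(i)}$ the matrix obtained from $V$ by dividing the $i$-th column by $d_i$. Then: 1. $Q$ is $W$-reduced if and only if for every $i=1,\dots,n+r$, $\mathcal L_r(Q^i)$ has no cotorsion in $\mathbb Z^{n+r-1}$. 2. The torsion subgroup of $\mathbb Z^{n+r-1}/\mathcal L_r(Q^i)$ is a cyclic group of order $d_i$. 3. Let $\tilde Q^i$ be the Smith normal form of $Q^i$, and let $\alpha_i\in\mathrm{GL}_r(\mathbb Z)$, $\beta_i\in\mathrm{GL}_{n+r-1}(\mathbb Z)$ be such that $\alpha_iQ^i\beta_i=\tilde Q^i$. Let $Q_{(i)}$ be the matrix obtained from $\alpha_iQ$ by multiplying the $i$-th column by $d_i$ and dividing the $r$-th row by $d_i$. Then $Q_{(i)}=\mathcal G(V_{(i)})$. 4. Call the matrix $Q_{(i)}$ obtained in part 3 the $i$-reduction of $Q$. Then the $W$-reduction $Q^{W\text{-red}}$ can be obtained by iterating $i$-reductions, for $i=1,\dots,n+r$ (that is, starting from $Q$ and performing successively the $1$-reduction, then the $2$-reduction of the result, and so on up to the $(n+r)$-reduction).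
   Context: $n,r$ are positive integers. $\mathcal L_r(A)$ and $\mathcal L_c(A)$ are the lattices spanned over $\mathbb Z$ by the rows, resp. columns, of $A$. A subgroup $\mathcal L\subseteq\mathbb Z^m$ has no cotorsion if $\mathbb Z^m/\mathcal L$ is torsion free. For an integer matrix $A$ of size $a\times(a+b)$ and rank $a$, a Gale dual $\mathcal G(A)$ is a $b\times(a+b)$ integer matrix whose rows form a $\mathbb Z$-basis of $\ker(A)\subseteq\mathbb Z^{a+b}$; it is well defined up to left multiplication by $\mathrm{GL}_b(\mathbb Z)$, and equalities involving $\mathcal G$ are meant up to this ambiguity (i.e. $Q_{(i)}=\mathcal G(V_{(i)})$ means $Q_{(i)}$ is a Gale dual of $V_{(i)}$). A vector is positive if all entries are $\ge0$. An integer matrix $A$ is $W$-positive if $\mathcal L_r(A)$ has a $\mathbb Z$-basis of positive vectors, and a $d\times m$ integer matrix is $F$-complete if the cone generated by its columns is $\mathbb R^d$. A $W$-matrix is an $r\times(n+r)$ integer matrix $Q$ such that: (a) $\mathrm{rk}(Q)=r$; (b) $\mathcal L_r(Q)$ has no cotorsion in $\mathbb Z^{n+r}$; (c) $Q$ is $W$-positive; (d) every column of $Q$ is non-zero; (e) $\mathcal L_r(Q)$ contains no vector of the form $(0,\dots,0,1,0,\dots,0)$; (f) $\mathcal L_r(Q)$ contains no vector having exactly two non-zero entries $a,b$ with $ab<0$. An $F$-matrix is an $n\times(n+r)$ integer matrix $V$ such that: (a) $\mathrm{rk}(V)=n$; (b) $V$ is $F$-complete; (c) all columns of $V$ are non-zero;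 (d) if $\mathbf v$ is a column of $V$, then $V$ has no other column of the form $\lambda\mathbf v$ with $\lambda>0$ real. (The Gale dual of a $W$-matrix is an $F$-matrix, and conversely.) An $F$-matrix is $F$-reduced if the gcd of the entries of each column is $1$; its $F$-reduction is $V^{F\text{-red}}=V\cdot\mathrm{diag}(d_1,\dots,d_{n+r})^{-1}$, $d_i$ being the gcd of the entries of the $i$-th column. A $W$-matrix $Q$ is $W$-reduced if $\mathcal G(Q)$ is $F$-reduced; its $W$-reduction is $Q^{W\text{-red}}=\mathcal G(\mathcal G(Q)^{F\text{-red}})$. A $p\times q$ integer matrix $(a_{ij})$ is in Smith normal form if there are $k\le p$ and positive integers $c_1,\dots,c_k$ with $c_i\mid c_{i+1}$ such that $a_{ii}=c_i$ for $i\le k$ and $a_{ij}=0$ if $i\ne j$ or $i>k$; the Smith normal form of $A$ is the matrix of this form equal to $\alpha A\beta$ for some unimodular integer matrices $\alpha,\beta$. *)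

theory Defs
  imports "Jordan_Normal_Form.DL_Rank" "Jordan_Normal_Form.Matrix_Kernel"
    "Jordan_Normal_Form.Column_Operations" "HOL-Algebra.Elementary_Groups"
begin

text \<open>Rows and columns are indexed from 0 throughout.\<close>

section \<open>Lattices\<close>

abbreviation int_span :: "nat \<Rightarrow> int vec set \<Rightarrow> int vec set" where
  "int_span m \<equiv> LinearCombinations.module.span (class_ring :: int ring) (module_vec TYPE(int) m)"

abbreviation int_lin_dep :: "nat \<Rightarrow> int vec set \<Rightarrow> bool" where
  "int_lin_dep m \<equiv> LinearCombinations.module.lin_dep (class_ring :: int ring) (module_vec TYPE(int) m)"

definition lattice_basis :: "nat \<Rightarrow> int vec set \<Rightarrow> int vec set \<Rightarrow> bool" where
  "lattice_basis m L B \<longleftrightarrow> B \<subseteq> carrier_vec m \<and> \<not> int_lin_dep m B \<and> int_span m B = L"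

definition row_lattice :: "int mat \<Rightarrow> int vec set" where
  "row_lattice A = int_span (dim_col A) (set (rows A))"

definition int_rank :: "int mat \<Rightarrow> nat" where
  "int_rank A = vec_space.rank (dim_row A) (map_mat rat_of_int A)"

definition torsion_group :: "('a, 'b) monoid_scheme \<Rightarrow> ('a, 'b) monoid_scheme" where
  "torsion_group G = G\<lparr>carrier := {x \<in> carrier G. \<exists>k::nat. k > 0 \<and> x [^]\<^bsub>G\<^esub> k = \<one>\<^bsub>G\<^esub>}\<rparr>"

abbreviation lattice_quotient :: "nat \<Rightarrow> int vec set \<Rightarrow> int vec set monoid" where
  "lattice_quotient m L \<equiv> monoid_vec TYPE(int) m Mod L"

definition no_cotorsion :: "nat \<Rightarrow> int vec set \<Rightarrow> bool" where
  "no_cotorsion m L \<longleftrightarrow>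
     carrier (torsion_group (lattice_quotient m L)) = {\<one>\<^bsub>lattice_quotient m L\<^esub>}"

section \<open>Gale duality\<close>

text \<open>Gale duals are unique only up to left multiplication by unimodular matrices, so
  \<open>is_gale_dual a b A G\<close> is a relation, read ``\<open>G\<close> is a Gale dual of the
  \<open>a \<times> (a+b)\<close> matrix \<open>A\<close>''.\<close>

definition is_gale_dual :: "nat \<Rightarrow> nat \<Rightarrow> int mat \<Rightarrow> int mat \<Rightarrow> bool" where
  "is_gale_dual a b A G \<longleftrightarrow>
     A \<in> carrier_mat a (a + b) \<and> int_rank A = a \<and>
     G \<in> carrier_mat b (a + b) \<and>
     distinct (rows G) \<and> lattice_basis (a + b) (mat_kernel A) (set (rows G))"

section \<open>W-matrices and F-matrices\<close>

text \<open>A vector is called positive when all its entries are nonnegative.\<close>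

definition W_positive :: "int mat \<Rightarrow> bool" where
  "W_positive A \<longleftrightarrow>
     (\<exists>B. lattice_basis (dim_col A) (row_lattice A) B \<and> (\<forall>v\<in>B. \<forall>i<dim_col A. v $ i \<ge> 0))"

definition F_complete :: "int mat \<Rightarrow> bool" where
  "F_complete A \<longleftrightarrow>
     {map_mat real_of_int A *\<^sub>v c | c. c \<in> carrier_vec (dim_col A) \<and> (\<forall>i<dim_col A. c $ i \<ge> 0)}
       = carrier_vec (dim_row A)"

definition W_matrix :: "nat \<Rightarrow> nat \<Rightarrow> int mat \<Rightarrow> bool" where
  "W_matrix n r Q \<longleftrightarrow>
     Q \<in> carrier_mat r (n + r) \<and>
     int_rank Q = r \<and>
     no_cotorsion (n + r) (row_lattice Q) \<and>
     W_positive Q \<and>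
     (\<forall>i<n + r. col Q i \<noteq> 0\<^sub>v r) \<and>
     (\<forall>i<n + r. unit_vec (n + r) i \<notin> row_lattice Q) \<and>
     \<not> (\<exists>v\<in>row_lattice Q. \<exists>i<n + r. \<exists>j<n + r.
          v $ i * v $ j < 0 \<and> (\<forall>k<n + r. k \<noteq> i \<and> k \<noteq> j \<longrightarrow> v $ k = 0))"

definition F_matrix :: "nat \<Rightarrow> nat \<Rightarrow> int mat \<Rightarrow> bool" where
  "F_matrix n r V \<longleftrightarrow>
     V \<in> carrier_mat n (n + r) \<and>
     int_rank V = n \<and>
     F_complete V \<and>
     (\<forall>i<n + r. col V i \<noteq> 0\<^sub>v n) \<and>
     (\<forall>i<n + r. \<forall>j<n + r. i \<noteq> j \<longrightarrow>
        \<not> (\<exists>l::real. l > 0 \<and>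
            col (map_mat real_of_int V) j = l \<cdot>\<^sub>v col (map_mat real_of_int V) i))"

section \<open>Reductions\<close>

definition col_gcd :: "int mat \<Rightarrow> nat \<Rightarrow> int" where
  "col_gcd A i = Gcd (set\<^sub>v (col A i))"

definition F_reduced :: "nat \<Rightarrow> nat \<Rightarrow> int mat \<Rightarrow> bool" where
  "F_reduced n r V \<longleftrightarrow> F_matrix n r V \<and> (\<forall>i<n + r. col_gcd V i = 1)"

definition F_reduction :: "int mat \<Rightarrow> int mat" where
  "F_reduction V = mat (dim_row V) (dim_col V) (\<lambda>(k, j). V $$ (k, j) div col_gcd V j)"

text \<open>The next two notions do not depend on the Gale duals chosen, up to left multiplication of
  \<open>Q'\<close> by a unimodular matrix: \<open>is_W_reduction n r Q Q'\<close> says that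
  \<open>Q'\<close> is a representative of the W-reduction of \<open>Q\<close>.\<close>

definition W_reduced :: "nat \<Rightarrow> nat \<Rightarrow> int mat \<Rightarrow> bool" where
  "W_reduced n r Q \<longleftrightarrow> W_matrix n r Q \<and> (\<exists>V. is_gale_dual r n Q V \<and> F_reduced n r V)"

definition is_W_reduction :: "nat \<Rightarrow> nat \<Rightarrow> int mat \<Rightarrow> int mat \<Rightarrow> bool" where
  "is_W_reduction n r Q Q' \<longleftrightarrow>
     (\<exists>V. is_gale_dual r n Q V \<and> is_gale_dual n r (F_reduction V) Q')"

definition delete_col :: "nat \<Rightarrow> int mat \<Rightarrow> int mat" where
  "delete_col i A =
     mat (dim_row A) (dim_col A - 1) (\<lambda>(k, j). A $$ (k, if j < i then j else Suc j))"

definition div_col :: "nat \<Rightarrow> int \<Rightarrow> int mat \<Rightarrow> int mat" where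
  "div_col i d A =
     mat (dim_row A) (dim_col A) (\<lambda>(k, j). if j = i then A $$ (k, j) div d else A $$ (k, j))"

definition div_row :: "nat \<Rightarrow> int \<Rightarrow> int mat \<Rightarrow> int mat" where
  "div_row i d A =
     mat (dim_row A) (dim_col A) (\<lambda>(k, j). if k = i then A $$ (k, j) div d else A $$ (k, j))"

definition smith_normal_form :: "nat \<Rightarrow> nat \<Rightarrow> int mat \<Rightarrow> bool" where
  "smith_normal_form p q S \<longleftrightarrow>
     S \<in> carrier_mat p q \<and>
     (\<exists>k c. k \<le> p \<and> k \<le> q \<and>
        (\<forall>i<k. (c i :: int) > 0) \<and> (\<forall>i. Suc i < k \<longrightarrow> c i dvd c (Suc i)) \<and>
        (\<forall>i<p. \<forall>j<q. S $$ (i, j) = (if i = j \<and> i < k then c i else 0)))"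

definition unimodular :: "nat \<Rightarrow> int mat \<Rightarrow> bool" where
  "unimodular k A \<longleftrightarrow> A \<in> carrier_mat k k \<and> invertible_mat A"

definition smith_transformation ::
  "nat \<Rightarrow> nat \<Rightarrow> int mat \<Rightarrow> int mat \<Rightarrow> int mat \<Rightarrow> int mat \<Rightarrow> bool" where
  "smith_transformation p q A \<alpha> \<beta> S \<longleftrightarrow>
     A \<in> carrier_mat p q \<and> unimodular p \<alpha> \<and> unimodular q \<beta> \<and>
     smith_normal_form p q S \<and> \<alpha> * A * \<beta> = S"

text \<open>\<open>is_i_reduction n r i Q Q'\<close>: the matrix \<open>Q'\<close> is an \<open>i\<close>-reduction of the
  W-matrix \<open>Q\<close>. It depends on the choice of the transformation \<open>\<alpha>\<close>, \<open>\<beta>\<close>; the gcd of the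
  \<open>i\<close>-th column does not depend on the choice of the Gale dual \<open>V\<close>. For a W-matrix \<open>Q\<close>
  the integer division of the last row is exact.\<close>

definition is_i_reduction :: "nat \<Rightarrow> nat \<Rightarrow> nat \<Rightarrow> int mat \<Rightarrow> int mat \<Rightarrow> bool" where
  "is_i_reduction n r i Q Q' \<longleftrightarrow>
     (\<exists>V \<alpha> \<beta> S. is_gale_dual r n Q V \<and>
        smith_transformation r (n + r - 1) (delete_col i Q) \<alpha> \<beta> S \<and>
        Q' = div_row (r - 1) (col_gcd V i) (multcol i (col_gcd V i) (\<alpha> * Q)))"

text \<open>\<open>R k\<close> is the matrix reached after the first \<open>k\<close> reductions.\<close>

definition iterated_reduction :: "nat \<Rightarrow> nat \<Rightarrow> int mat \<Rightarrow> (nat \<Rightarrow> int mat) \<Rightarrow> bool" where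
  "iterated_reduction n r Q R \<longleftrightarrow>
     R 0 = Q \<and> (\<forall>k<n + r. is_i_reduction n r k (R k) (R (Suc k)))"

end

theory Submission
  imports Defs
begin

text \<open>
  Let \<open>L\<close> be the row lattice of the W-matrix \<open>Q\<close> and let \<open>v\<^sub>1,
  \<dots>\<close> be the columns of its Gale dual \<open>V\<close>. Full rank and absence of cotorsion
  together mean that \<open>Q\<close> has an integral right inverse (\<open>right_inverse_iff\<close>). This
  makes Gale duality symmetric: \<open>L\<close> is the kernel of \<open>V\<close>, and \<open>V\<close> has
  an integral right inverse too (\<open>gale_dual_symmetric\<close>, \<open>gale_dual_right_inverse\<close>).

  To find the cotorsion after deleting column \<open>i\<close>, write \<open>v\<^sub>i = d u\<close> with
  \<open>d\<close> the gcd of the entries, and let \<open>F w\<close> be the combination of the other columns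
  with coefficients \<open>w\<close>. A vector \<open>w\<close> lies in the row lattice of
  \<open>Q\<^sup>i\<close> iff \<open>F w\<close> is a multiple of \<open>d u\<close>, and it represents a
  torsion class iff \<open>F w\<close> is a multiple of \<open>u\<close>. So the torsion embeds into
  \<open>\<int> / d\<close>, and it is everything because the columns of \<open>V\<close> generate
  \<open>\<int>\<^sup>n\<close> (\<open>delete_col_torsion_generator\<close>). In particular \<open>d\<close>
  depends on \<open>Q\<close> only, and it is \<open>1\<close> iff there is no cotorsion. That
  \<open>V\<close> is an F-matrix follows from the conditions on \<open>Q\<close>
  (\<open>F_matrix_if_gale_dual\<close>).

  For the explicit reduction, note that cyclic torsion of order \<open>d\<close> forces the Smith form of
  \<open>Q\<^sup>i\<close> to have the diagonal \<open>1, \<dots>, 1, d\<close>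
  (\<open>smith_form_of_cyclic_torsion\<close>). The last diagonal entry makes the division of the last row
  possible, and the entries \<open>1\<close> ensure that the rows of \<open>Q\<^bsub>(i)\<^esub>\<close>
  generate the whole kernel of \<open>V\<^bsub>(i)\<^esub>\<close> (\<open>gale_dual_i_reduction\<close>).

  Reductions can be iterated: they exist because Smith normal forms do
  (\<open>smith_transformation_exists\<close>). The lattices of \<open>Q\<close> and
  \<open>Q\<^bsub>(i)\<^esub>\<close> differ by rescaling coordinates with positive factors, which keeps all
  conditions on a W-matrix; for positive bases this uses that a lattice with a strictly positive vector has a
  basis of positive vectors (\<open>W_matrix_i_reduction\<close>,
  \<open>W_positive_if_strictly_positive\<close>). By induction the matrix after \<open>k\<close> reductions
  is Gale dual to \<open>V\<close> with its first \<open>k\<close> columns divided by their gcds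
  (\<open>iterated_reduction_invariant\<close>), and for \<open>k = n + r\<close> this is the F-reduction of
  \<open>V\<close>.
\<close>

section \<open>Unimodular equivalence and the Smith normal form\<close>
lemma unimodular_iff:
  "unimodular k A \<longleftrightarrow>
     A \<in> carrier_mat k k \<and> (\<exists>B\<in>carrier_mat k k. A * B = 1\<^sub>m k \<and> B * A = 1\<^sub>m k)"
proof
  assume "unimodular k A"
  then have A: "A \<in> carrier_mat k k" and "invertible_mat A" by (auto simp: unimodular_def)
  then obtain B where B: "A * B = 1\<^sub>m k" "B * A = 1\<^sub>m (dim_row B)"
    unfolding invertible_mat_def inverts_mat_def by auto
  have "dim_col B = k" using arg_cong[OF B(1), of dim_col] by simp
  moreover have "dim_row B = k" using arg_cong[OF B(2), of dim_col] A by simp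
  ultimately have "B \<in> carrier_mat k k" by auto
  with A B show "A \<in> carrier_mat k k \<and> (\<exists>B\<in>carrier_mat k k. A * B = 1\<^sub>m k \<and> B * A = 1\<^sub>m k)" by auto
next
  assume "A \<in> carrier_mat k k \<and> (\<exists>B\<in>carrier_mat k k. A * B = 1\<^sub>m k \<and> B * A = 1\<^sub>m k)"
  then show "unimodular k A"
    unfolding unimodular_def invertible_mat_def inverts_mat_def by (auto simp: square_mat.simps)
qed

lemma unimodularE:
  assumes "unimodular k A"
  obtains B where "A \<in> carrier_mat k k" "B \<in> carrier_mat k k" "A * B = 1\<^sub>m k" "B * A = 1\<^sub>m k"
    "unimodular k B"
  using assms unfolding unimodular_iff by blast

lemma unimodular_carrier: "unimodular k A \<Longrightarrow> A \<in> carrier_mat k k"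
  by (simp add: unimodular_def)

lemma unimodular_one: "unimodular k (1\<^sub>m k)"
  unfolding unimodular_iff by (auto intro: bexI[of _ "1\<^sub>m k"])

lemma unimodular_mult:
  assumes "unimodular k A" "unimodular k B"
  shows "unimodular k (A * B)"
proof -
  obtain A' where A: "A \<in> carrier_mat k k" "A' \<in> carrier_mat k k" "A * A' = 1\<^sub>m k" "A' * A = 1\<^sub>m k"
    using assms(1) by (rule unimodularE)
  obtain B' where B: "B \<in> carrier_mat k k" "B' \<in> carrier_mat k k" "B * B' = 1\<^sub>m k" "B' * B = 1\<^sub>m k"
    using assms(2) by (rule unimodularE)
  have "(A * B) * (B' * A') = A * (B * B') * A'" 
    using A(1,2) B(1,2) by (simp add: assoc_mult_mat[of _ k k _ k _ k])
  then have 1: "(A * B) * (B' * A') = 1\<^sub>m k" using A B by simp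
  have "(B' * A') * (A * B) = B' * (A' * A) * B" 
    using A(1,2) B(1,2) by (simp add: assoc_mult_mat[of _ k k _ k _ k])
  then have 2: "(B' * A') * (A * B) = 1\<^sub>m k" using A B by simp
  from 1 2 A(1,2) B(1,2) show ?thesis
    unfolding unimodular_iff by (intro conjI bexI[of _ "B' * A'"]) auto
qed

definition int_equivalent :: "nat \<Rightarrow> nat \<Rightarrow> int mat \<Rightarrow> int mat \<Rightarrow> bool" where
  "int_equivalent p q A B \<longleftrightarrow>
     A \<in> carrier_mat p q \<and> (\<exists>P Q. unimodular p P \<and> unimodular q Q \<and> P * A * Q = B)"

lemma int_equivalentI:
  "A \<in> carrier_mat p q \<Longrightarrow> unimodular p P \<Longrightarrow> unimodular q Q \<Longrightarrow> P * A * Q = B \<Longrightarrow>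
   int_equivalent p q A B"
  unfolding int_equivalent_def by blast

lemma int_equivalent_carrier:
  assumes "int_equivalent p q A B"
  shows "A \<in> carrier_mat p q" "B \<in> carrier_mat p q"
  using assms unfolding int_equivalent_def by (auto dest!: unimodular_carrier)

lemma int_equivalent_row_op:
  assumes "A \<in> carrier_mat p q" "unimodular p P"
  shows "int_equivalent p q A (P * A)"
  using assms unimodular_carrier[OF assms(2)]
  by (intro int_equivalentI[OF _ _ unimodular_one]) (auto simp: right_mult_one_mat[of _ p q])

lemma int_equivalent_col_op:
  assumes "A \<in> carrier_mat p q" "unimodular q Q"
  shows "int_equivalent p q A (A * Q)"
  using assms unimodular_carrier[OF assms(2)]
  by (intro int_equivalentI[OF _ unimodular_one]) auto

lemma int_equivalent_refl: "A \<in> carrier_mat p q \<Longrightarrow> int_equivalent p q A A"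
  using int_equivalent_row_op[OF _ unimodular_one] by fastforce

lemma int_equivalent_trans:
  assumes "int_equivalent p q A B" "int_equivalent p q B C"
  shows "int_equivalent p q A C"
proof -
  obtain P Q where 1: "A \<in> carrier_mat p q" "unimodular p P" "unimodular q Q" "P * A * Q = B"
    using assms(1) unfolding int_equivalent_def by blast
  obtain P' Q' where 2: "unimodular p P'" "unimodular q Q'" "P' * B * Q' = C"
    using assms(2) unfolding int_equivalent_def by blast
  have c: "P \<in> carrier_mat p p" "P' \<in> carrier_mat p p" "Q \<in> carrier_mat q q" "Q' \<in> carrier_mat q q"
    using 1 2 by (auto dest: unimodular_carrier)
  have "C = P' * (P * A * Q) * Q'" using 1 2 by simp
  also have "\<dots> = (P' * P) * A * (Q * Q')"
  proof -
    have "P' * (P * A * Q) = P' * P * A * Q"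
      using c 1(1) by (simp add: assoc_mult_mat[of _ p p _ p _ q] assoc_mult_mat[of _ p p _ q _ q] )
    then show ?thesis using c 1(1) by (simp add: assoc_mult_mat[of _ p q _ q _ q])
  qed
  finally show ?thesis
    using 1 2 by (intro int_equivalentI[of _ _ _ "P' * P" "Q * Q'"]) (auto intro: unimodular_mult)
qed

lemma int_equivalent_smult:
  assumes "int_equivalent p q A B"
  shows "int_equivalent p q (d \<cdot>\<^sub>m A) (d \<cdot>\<^sub>m B)"
proof -
  obtain P Q where 1: "A \<in> carrier_mat p q" "unimodular p P" "unimodular q Q" "P * A * Q = B"
    using assms(1) unfolding int_equivalent_def by blast
  have c: "P \<in> carrier_mat p p" "Q \<in> carrier_mat q q"
    using 1 by (auto dest: unimodular_carrier)
  have "P * (d \<cdot>\<^sub>m A) * Q = d \<cdot>\<^sub>m B"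
    using 1 c by (simp add: mult_smult_distrib[of _ p p _ q] mult_smult_assoc_mat[of _ p q _ q])
  then show ?thesis using 1 by (intro int_equivalentI[of _ _ _ P Q]) auto
qed

lemma unimodular_sign:
  assumes "s * s = 1"
  shows "unimodular p (s \<cdot>\<^sub>m 1\<^sub>m p)"
proof -
  have "(s \<cdot>\<^sub>m 1\<^sub>m p) * (s \<cdot>\<^sub>m 1\<^sub>m p) = 1\<^sub>m p"
    using assms by (intro eq_matI) (auto simp: mult_smult_distrib[of _ p p _ p]
        mult_smult_assoc_mat[of _ p p _ p])
  then show ?thesis unfolding unimodular_iff by (auto intro!: bexI[of _ "s \<cdot>\<^sub>m 1\<^sub>m p"])
qed

lemma int_equivalent_sign:
  assumes "A \<in> carrier_mat p q" "s * s = 1"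
  shows "int_equivalent p q A (s \<cdot>\<^sub>m A)"
  using int_equivalent_row_op[OF assms(1) unimodular_sign[OF assms(2)]] assms(1)
  by (simp add: mult_smult_assoc_mat[of _ p p _ q])

lemma unimodular_addrow_mat: "k < p \<Longrightarrow> l < p \<Longrightarrow> k \<noteq> l \<Longrightarrow> unimodular p (addrow_mat p a k l)"
  unfolding unimodular_iff using addrow_mat_inv[of k p l a] addrow_mat_inv[of k p l "-a"]
  by (auto intro!: bexI[of _ "addrow_mat p (- a) k l"])

lemma unimodular_swaprows_mat: "k < p \<Longrightarrow> l < p \<Longrightarrow> unimodular p (swaprows_mat p k l)"
  unfolding unimodular_iff using swaprows_mat_inv[of k p l]
  by (auto intro!: bexI[of _ "swaprows_mat p k l"])

lemma int_equivalent_elementary: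
  assumes "A \<in> carrier_mat p q"
  shows "k < p \<Longrightarrow> l < p \<Longrightarrow> k \<noteq> l \<Longrightarrow> int_equivalent p q A (addrow a k l A)"
    and "k < q \<Longrightarrow> l < q \<Longrightarrow> k \<noteq> l \<Longrightarrow> int_equivalent p q A (addcol a k l A)"
    and "k < p \<Longrightarrow> l < p \<Longrightarrow> int_equivalent p q A (swaprows k l A)"
    and "k < q \<Longrightarrow> l < q \<Longrightarrow> int_equivalent p q A (swapcols k l A)"
  using assms int_equivalent_row_op[OF assms unimodular_addrow_mat, of k l a]
    int_equivalent_col_op[OF assms unimodular_addrow_mat, of l k a]
    int_equivalent_row_op[OF assms unimodular_swaprows_mat, of k l]
    int_equivalent_col_op[OF assms unimodular_swaprows_mat, of k l]
  by (auto simp: addrow_mat[OF assms] addcol_mat[OF assms, of l a k] swaprows_mat[OF assms] swapcols_mat[OF assms])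

lemma int_equivalent_block:
  assumes "int_equivalent p q A B"
  shows "int_equivalent (Suc p) (Suc q) (four_block_mat (1\<^sub>m 1) (0\<^sub>m 1 q) (0\<^sub>m p 1) A)
     (four_block_mat (1\<^sub>m 1) (0\<^sub>m 1 q) (0\<^sub>m p 1) B)"
proof -
  define D :: "nat \<Rightarrow> nat \<Rightarrow> int mat \<Rightarrow> int mat"
    where "D = (\<lambda>p q A. four_block_mat (1\<^sub>m 1) (0\<^sub>m 1 q) (0\<^sub>m p 1) A)"
  have D_mult: "D p q A * D q r B = D p r (A * B)"
    if "A \<in> carrier_mat p q" "B \<in> carrier_mat q r" for p q r and A B
    unfolding D_def using that
    by (subst mult_four_block_mat[of _ 1 1 _ q _ p _ _ 1 _ r]) auto
  have D_one: "D p p (1\<^sub>m p) = 1\<^sub>m (Suc p)" for p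
    unfolding D_def using four_block_one_mat[of 1 p] by simp
  have D_carrier: "A \<in> carrier_mat p q \<Longrightarrow> D p q A \<in> carrier_mat (Suc p) (Suc q)" for p q A
    unfolding D_def using four_block_carrier_mat[of "1\<^sub>m 1" 1 1 A p q] by simp
  have D_uni: "unimodular (Suc p) (D p p P)" if uP: "unimodular p P" for p P
  proof -
    obtain P' where P': "P \<in> carrier_mat p p" "P' \<in> carrier_mat p p" "P * P' = 1\<^sub>m p" "P' * P = 1\<^sub>m p"
      using uP by (rule unimodularE)
    then show ?thesis unfolding unimodular_iff
      by (auto intro!: bexI[of _ "D p p P'"] simp: D_carrier D_mult D_one)
  qed
  obtain P Q where 1: "A \<in> carrier_mat p q" "unimodular p P" "unimodular q Q" "P * A * Q = B"
    using assms(1) unfolding int_equivalent_def by blast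
  have c: "P \<in> carrier_mat p p" "Q \<in> carrier_mat q q"
    using 1 by (auto dest: unimodular_carrier)
  have "D p p P * D p q A * D q q Q = D p q B"
    using 1 c by (simp add: D_mult[of _ p p _ q] D_mult[of _ p q _ q])
  then show ?thesis
    using 1 D_carrier D_uni unfolding D_def
    by (intro int_equivalentI) auto
qed

text \<open>Among all nonzero entries of all matrices equivalent to \<open>A\<close>, take one of least absolute value.
Division with remainder by an elementary operation would produce a smaller one unless the entry
divides its row and its column. The same minimality, applied after one more row operation, shows
that it divides every entry.\<close>

lemma int_equivalent_divisible_corner:
  assumes A: "A \<in> carrier_mat p q" and nz: "A \<noteq> 0\<^sub>m p q"
  shows "\<exists>B. int_equivalent p q A B \<and> 0 < p \<and> 0 < q \<and> B $$ (0, 0) \<noteq> 0 \<and>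
    (\<forall>i<p. \<forall>j<q. B $$ (0, 0) dvd B $$ (i, j))"
proof -
  define W where "W = (\<lambda>n. \<exists>B i j. int_equivalent p q A B \<and> i < p \<and> j < q \<and>
     B $$ (i, j) \<noteq> 0 \<and> nat \<bar>B $$ (i, j)\<bar> = n)"
  have "\<exists>i j. i < p \<and> j < q \<and> A $$ (i, j) \<noteq> 0"
    using A nz by (metis carrier_matD eq_matI index_zero_mat)
  then have ex: "\<exists>n. W n" unfolding W_def using int_equivalent_refl[OF A] by blast
  define n where "n = (LEAST n. W n)"
  have Wn: "W n" unfolding n_def using ex by (rule LeastI_ex)
  have least: "B $$ (i, j) = 0"
    if "int_equivalent p q A B" "i < p" "j < q" "nat \<bar>B $$ (i, j)\<bar> < n" for B i j
  proof (rule ccontr)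
    assume "B $$ (i, j) \<noteq> 0"
    then have "W (nat \<bar>B $$ (i, j)\<bar>)" unfolding W_def using that by blast
    then show False using not_less_Least that(4) unfolding n_def by blast
  qed
  have row: "B $$ (i, j) dvd B $$ (i, l)"
    if B: "int_equivalent p q A B" and ij: "i < p" "j < q" "l < q" and m: "nat \<bar>B $$ (i, j)\<bar> = n" and
      nz: "B $$ (i, j) \<noteq> 0" for B i j l
  proof (cases "l = j")
    case False
    have Bc: "B \<in> carrier_mat p q" using int_equivalent_carrier[OF B] by simp
    let ?C = "addcol (- (B $$ (i, l) div B $$ (i, j))) l j B"
    have e: "int_equivalent p q A ?C"
      using int_equivalent_trans[OF B int_equivalent_elementary(2)[OF Bc]] ij False by blast
    have C: "?C $$ (i, l) = B $$ (i, l) mod B $$ (i, j)"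
      using Bc ij False by (simp add: minus_mult_div_eq_mod[symmetric] algebra_simps)
    have "?C $$ (i, l) = 0"
      using least[OF e ij(1,3)] abs_mod_less[OF nz, of "B $$ (i, l)"] m unfolding C by linarith
    then show ?thesis unfolding C by (simp add: dvd_eq_mod_eq_0)
  qed simp
  have col: "B $$ (i, j) dvd B $$ (l, j)"
    if B: "int_equivalent p q A B" and ij: "i < p" "j < q" "l < p" and m: "nat \<bar>B $$ (i, j)\<bar> = n" and
      nz: "B $$ (i, j) \<noteq> 0" for B i j l
  proof (cases "l = i")
    case False
    have Bc: "B \<in> carrier_mat p q" using int_equivalent_carrier[OF B] by simp
    let ?C = "addrow (- (B $$ (l, j) div B $$ (i, j))) l i B"
    have e: "int_equivalent p q A ?C"
      using int_equivalent_trans[OF B int_equivalent_elementary(1)[OF Bc]] ij False by blast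
    have C: "?C $$ (l, j) = B $$ (l, j) mod B $$ (i, j)"
      using Bc ij False by (simp add: minus_mult_div_eq_mod[symmetric] algebra_simps)
    have "?C $$ (l, j) = 0"
      using least[OF e ij(3,2)] abs_mod_less[OF nz, of "B $$ (l, j)"] m unfolding C by linarith
    then show ?thesis unfolding C by (simp add: dvd_eq_mod_eq_0)
  qed simp
  obtain B0 i0 j0 where B0: "int_equivalent p q A B0" "i0 < p" "j0 < q" "B0 $$ (i0, j0) \<noteq> 0"
    "nat \<bar>B0 $$ (i0, j0)\<bar> = n" using Wn unfolding W_def by blast
  have pq: "0 < p" "0 < q" using B0 by auto
  have B0c: "B0 \<in> carrier_mat p q" using int_equivalent_carrier[OF B0(1)] by simp
  define B where "B = swapcols 0 j0 (swaprows 0 i0 B0)"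
  have Bc: "B \<in> carrier_mat p q" unfolding B_def using B0c by auto
  have eB: "int_equivalent p q A B"
    unfolding B_def
    by (rule int_equivalent_trans[OF int_equivalent_trans[OF B0(1) int_equivalent_elementary(3)[OF B0c]]
          int_equivalent_elementary(4)]) (use B0c B0 pq in auto)
  have B00: "B $$ (0, 0) = B0 $$ (i0, j0)" unfolding B_def using B0 B0c pq by auto
  have m: "nat \<bar>B $$ (0, 0)\<bar> = n" and nz': "B $$ (0, 0) \<noteq> 0" using B0 B00 by auto
  have "B $$ (0, 0) dvd B $$ (i, j)" if ij: "i < p" "j < q" for i j
  proof (cases "i = 0")
    case True
    then show ?thesis using row[OF eB pq(1,2) ij(2) m nz'] by simp
  next
    case False
    obtain t where t: "B $$ (i, 0) = B $$ (0, 0) * t"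
      using col[OF eB pq(1,2) ij(1) m nz'] by blast
    \<comment> \<open>After this row operation the corner entry reappears in row \<open>i\<close>, so it divides that row.\<close>
    let ?C = "addrow (1 - t) i 0 B"
    have e: "int_equivalent p q A ?C"
      using int_equivalent_trans[OF eB int_equivalent_elementary(1)[OF Bc]] ij pq False by blast
    have C: "?C $$ (i, l) = (1 - t) * B $$ (0, l) + B $$ (i, l)" if "l < q" for l
      using Bc ij pq False that by simp
    have C0: "?C $$ (i, 0) = B $$ (0, 0)" using C[OF pq(2)] t by (simp add: algebra_simps)
    have "?C $$ (i, 0) dvd ?C $$ (i, j)"
      by (rule row[OF e ij(1) pq(2) ij(2)]) (use C0 m nz' in auto)
    then have "B $$ (0, 0) dvd (1 - t) * B $$ (0, j) + B $$ (i, j)" using C0 C[OF ij(2)] by simp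
    moreover have "B $$ (0, 0) dvd B $$ (0, j)" using row[OF eB pq(1,2) ij(2) m nz'] .
    ultimately show ?thesis by (metis dvd_add_right_iff dvd_mult)
  qed
  then show ?thesis using eB pq nz' by blast
qed

text \<open>The block matrix with rows \<open>(1, Y)\<close> and \<open>(X, C')\<close> becomes the diagonal block matrix of \<open>1\<close> and
\<open>C' - X Y\<close> after one left and one right multiplication by a unimodular block matrix.\<close>

lemma int_equivalent_clear_corner:
  assumes C: "C \<in> carrier_mat (Suc p) (Suc q)" and C00: "C $$ (0, 0) = 1"
  shows "\<exists>D\<in>carrier_mat p q. int_equivalent (Suc p) (Suc q) C
    (four_block_mat (1\<^sub>m 1) (0\<^sub>m 1 q) (0\<^sub>m p 1) D)"
proof -
  define X where "X = mat p 1 (\<lambda>(i, j). C $$ (Suc i, 0))"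
  define Y where "Y = mat 1 q (\<lambda>(i, j). C $$ (0, Suc j))"
  define C' where "C' = mat p q (\<lambda>(i, j). C $$ (Suc i, Suc j))"
  note defs = X_def Y_def C'_def
  have c: "X \<in> carrier_mat p 1" "Y \<in> carrier_mat 1 q" "C' \<in> carrier_mat p q" unfolding defs by auto
  have Ceq: "C = four_block_mat (1\<^sub>m 1) Y X C'"
    using C C00 unfolding defs by (intro eq_matI) (auto simp: less_Suc_eq_0_disj)
  define L where "L = (\<lambda>X::int mat. four_block_mat (1\<^sub>m 1) (0\<^sub>m 1 p) X (1\<^sub>m p))"
  define R where "R = (\<lambda>Y::int mat. four_block_mat (1\<^sub>m 1) Y (0\<^sub>m q 1) (1\<^sub>m q))"
  have Lc: "L Z \<in> carrier_mat (Suc p) (Suc p)" if "Z \<in> carrier_mat p 1" for Z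
    unfolding L_def using four_block_carrier_mat[of "1\<^sub>m 1" 1 1 "1\<^sub>m p" p p] that by simp
  have Rc: "R Z \<in> carrier_mat (Suc q) (Suc q)" if "Z \<in> carrier_mat 1 q" for Z
    unfolding R_def using four_block_carrier_mat[of "1\<^sub>m 1" 1 1 "1\<^sub>m q" q q] that by simp
  have LL: "L Z * L Z' = 1\<^sub>m (Suc p)"
    if "Z \<in> carrier_mat p 1" "Z' \<in> carrier_mat p 1" "Z + Z' = 0\<^sub>m p 1" for Z Z'
    unfolding L_def using that four_block_one_mat[of 1 p]
    by (subst mult_four_block_mat[of _ 1 1 _ p _ p _ _ 1 _ p]) auto
  have RR: "R Z * R Z' = 1\<^sub>m (Suc q)"
    if "Z \<in> carrier_mat 1 q" "Z' \<in> carrier_mat 1 q" "Z' + Z = 0\<^sub>m 1 q" for Z Z'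
    unfolding R_def using that four_block_one_mat[of 1 q]
    by (subst mult_four_block_mat[of _ 1 1 _ q _ q _ _ 1 _ q]) auto
  have uL: "unimodular (Suc p) (L (- X))"
    unfolding unimodular_iff using c
    by (auto intro!: bexI[of _ "L X"] Lc LL simp: uminus_l_inv_mat)
  have uR: "unimodular (Suc q) (R (- Y))"
    unfolding unimodular_iff using c
    by (auto intro!: bexI[of _ "R Y"] Rc RR simp: uminus_l_inv_mat)
  define D where "D = - X * Y + C'"
  have Dc: "D \<in> carrier_mat p q" unfolding D_def using c by auto
  have "L (- X) * C = four_block_mat (1\<^sub>m 1) Y (0\<^sub>m p 1) D"
    unfolding Ceq L_def D_def using c
    by (subst mult_four_block_mat[of _ 1 1 _ p _ p _ _ 1 _ q]) (auto simp: uminus_l_inv_mat)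
  then have "L (- X) * C * R (- Y) = four_block_mat (1\<^sub>m 1) (0\<^sub>m 1 q) (0\<^sub>m p 1) D"
    unfolding R_def using c Dc
    by (simp, subst mult_four_block_mat[of _ 1 1 _ q _ p _ _ 1 _ q]) (auto simp: uminus_l_inv_mat)
  then show ?thesis using int_equivalentI[OF C uL uR] Dc by blast
qed

text \<open>Since the factor \<open>d\<close> is pulled out of the whole matrix, the new diagonal is \<open>d\<close> followed by \<open>d\<close> times
the old one, and the divisibility chain needs no further argument.\<close>

lemma smith_normal_form_block:
  assumes S: "smith_normal_form p q S" and d: "0 < d"
  shows "smith_normal_form (Suc p) (Suc q)
    (d \<cdot>\<^sub>m four_block_mat (1\<^sub>m 1) (0\<^sub>m 1 q) (0\<^sub>m p 1) S)"
proof -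
  obtain k c where Sc: "S \<in> carrier_mat p q" and kc: "k \<le> p" "k \<le> q" "\<forall>i<k. (c i :: int) > 0"
    "\<forall>i. Suc i < k \<longrightarrow> c i dvd c (Suc i)"
    "\<forall>i<p. \<forall>j<q. S $$ (i, j) = (if i = j \<and> i < k then c i else 0)"
    using S unfolding smith_normal_form_def by blast
  have S_entry: "S $$ (i, j) = (if i = j \<and> i < k then c i else 0)" if "i < p" "j < q" for i j
    using kc(5) that by blast
  define c' where "c' i = (case i of 0 \<Rightarrow> d | Suc i \<Rightarrow> d * c i)" for i
  have "\<forall>i<Suc k. c' i > 0" using kc(3) d by (auto simp: c'_def split: nat.splits)
  moreover have "\<forall>i. Suc i < Suc k \<longrightarrow> c' i dvd c' (Suc i)"
    using kc(4) by (auto simp: c'_def split: nat.splits)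
  moreover have "\<forall>i<Suc p. \<forall>j<Suc q.
    (d \<cdot>\<^sub>m four_block_mat (1\<^sub>m 1) (0\<^sub>m 1 q) (0\<^sub>m p 1) S) $$ (i, j) = (if i = j \<and> i < Suc k then c' i else 0)"
    using Sc S_entry by (auto simp: c'_def less_Suc_eq_0_disj split: if_splits)
  ultimately show ?thesis
    unfolding smith_normal_form_def using kc(1,2) Sc
    by (intro conjI exI[of _ "Suc k"] exI[of _ c']) auto
qed

text \<open>The corner entry \<open>d\<close> of a suitable equivalent matrix divides all entries. After dividing by \<open>d\<close> the
corner is \<open>1\<close> and can be cleared, the remaining block is treated by induction, and multiplying by
\<open>\<bar>d\<bar>\<close> returns a matrix equivalent to the original one.\<close>

lemma int_equivalent_smith_normal_form:
  assumes "A \<in> carrier_mat p q"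
  shows "\<exists>S. int_equivalent p q A S \<and> smith_normal_form p q S"
  using assms
proof (induction p arbitrary: q A)
  case 0
  then have "smith_normal_form 0 q A" unfolding smith_normal_form_def by auto
  then show ?case using int_equivalent_refl[OF 0] by blast
next
  case (Suc p)
  show ?case
  proof (cases "A = 0\<^sub>m (Suc p) q")
    case True
    then have "smith_normal_form (Suc p) q A"
      unfolding smith_normal_form_def by (intro conjI exI[of _ 0]) auto
    then show ?thesis using int_equivalent_refl[OF Suc.prems] by blast
  next
    case False
    obtain B where B: "int_equivalent (Suc p) q A B" "0 < q" "B $$ (0, 0) \<noteq> 0"
      "\<forall>i<Suc p. \<forall>j<q. B $$ (0, 0) dvd B $$ (i, j)"
      using int_equivalent_divisible_corner[OF Suc.prems False] by blast
    obtain q' where q: "q = Suc q'" using B(2) by (cases q) auto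
    define d where "d = B $$ (0, 0)"
    define C where "C = map_mat (\<lambda>x. x div d) B"
    have Bc: "B \<in> carrier_mat (Suc p) (Suc q')" using int_equivalent_carrier[OF B(1)] q by simp
    have Cc: "C \<in> carrier_mat (Suc p) (Suc q')" and C00: "C $$ (0, 0) = 1"
      unfolding C_def using Bc B(3) by (auto simp: d_def)
    have BC: "B = d \<cdot>\<^sub>m C" unfolding C_def using Bc B(4) q by (intro eq_matI) (auto simp: d_def)
    define \<Delta> where "\<Delta> = (\<lambda>E :: int mat. four_block_mat (1\<^sub>m 1) (0\<^sub>m 1 q') (0\<^sub>m p 1) E)"
    obtain D where D: "D \<in> carrier_mat p q'" "int_equivalent (Suc p) (Suc q') C (\<Delta> D)"
      using int_equivalent_clear_corner[OF Cc C00] unfolding \<Delta>_def by blast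
    obtain S where S: "int_equivalent p q' D S" "smith_normal_form p q' S"
      using Suc.IH[OF D(1)] by blast
    have "int_equivalent (Suc p) (Suc q') C (\<Delta> S)"
      using int_equivalent_trans[OF D(2)] int_equivalent_block[OF S(1)] unfolding \<Delta>_def by blast
    then have "int_equivalent (Suc p) (Suc q') A (d \<cdot>\<^sub>m \<Delta> S)"
      using int_equivalent_trans[OF B(1)[unfolded q]] int_equivalent_smult unfolding BC by blast
    moreover have "\<bar>d\<bar> \<cdot>\<^sub>m \<Delta> S = sgn d \<cdot>\<^sub>m (d \<cdot>\<^sub>m \<Delta> S)"
      by (intro eq_matI) (simp_all add: abs_sgn mult.assoc mult.left_commute)
    moreover have "int_equivalent (Suc p) (Suc q') (d \<cdot>\<^sub>m \<Delta> S) (sgn d \<cdot>\<^sub>m (d \<cdot>\<^sub>m \<Delta> S))"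
      using int_equivalent_carrier(2)[OF calculation(1)] B(3)
      by (intro int_equivalent_sign) (auto simp: d_def sgn_if)
    ultimately have "int_equivalent (Suc p) (Suc q') A (\<bar>d\<bar> \<cdot>\<^sub>m \<Delta> S)"
      using int_equivalent_trans by metis
    moreover have "smith_normal_form (Suc p) (Suc q') (\<bar>d\<bar> \<cdot>\<^sub>m \<Delta> S)"
      unfolding \<Delta>_def by (rule smith_normal_form_block[OF S(2)]) (use B(3) in \<open>auto simp: d_def\<close>)
    ultimately show ?thesis unfolding q by blast
  qed
qed

lemma smith_transformation_exists:
  assumes "A \<in> carrier_mat p q"
  shows "\<exists>\<alpha> \<beta> S. smith_transformation p q A \<alpha> \<beta> S"
  using int_equivalent_smith_normal_form[OF assms] assms
  unfolding smith_transformation_def int_equivalent_def by blast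

section \<open>Row lattices and full row rank\<close>
lemma mult_mat_unit_vec: "i < dim_col A \<Longrightarrow> A *\<^sub>v unit_vec (dim_col A) i = col (A :: 'a :: semiring_1 mat) i"
  by (intro eq_vecI) auto

lemma mult_mat_smult_vec:
  fixes A :: "'a :: comm_ring_1 mat"
  shows "v \<in> carrier_vec (dim_col A) \<Longrightarrow> A *\<^sub>v (k \<cdot>\<^sub>v v) = k \<cdot>\<^sub>v (A *\<^sub>v v)"
  by (intro eq_vecI) auto

lemma smult_one_mult_vec:
  fixes v :: "'a :: comm_ring_1 vec"
  shows "v \<in> carrier_vec n \<Longrightarrow> (k \<cdot>\<^sub>m 1\<^sub>m n) *\<^sub>v v = k \<cdot>\<^sub>v v"
  by (intro eq_vecI) auto

lemma row_lattice_eq: "row_lattice A = {A\<^sup>T *\<^sub>v c | c. c \<in> carrier_vec (dim_row A)}"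
proof -
  interpret V: idom_vec "dim_col A" "TYPE(int)" .
  have rows: "set (rows A) \<subseteq> carrier_vec (dim_col A)" by (rule rows_carrier)
  have rows_dim: "\<forall>w\<in>set (rows A). dim_vec w = dim_col A" using rows carrier_vecD by blast
  have "V.lincomb_list c (rows A) = A\<^sup>T *\<^sub>v vec (dim_row A) c" for c
    using V.lincomb_list_as_mat_mult[OF rows_dim, of c] mat_of_cols_cols[of "A\<^sup>T"] by simp
  then have "V.span_list (rows A) = {A\<^sup>T *\<^sub>v vec (dim_row A) c | c. True}"
    unfolding V.span_list_def by auto
  also have "\<dots> = {A\<^sup>T *\<^sub>v c | c. c \<in> carrier_vec (dim_row A)}"
  proof (intro equalityI subsetI)
    fix v assume "v \<in> {A\<^sup>T *\<^sub>v c | c. c \<in> carrier_vec (dim_row A)}"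
    then obtain c where c: "c \<in> carrier_vec (dim_row A)" "v = A\<^sup>T *\<^sub>v c" by blast
    have "v = A\<^sup>T *\<^sub>v vec (dim_row A) (($) c)"
      unfolding c(2) using c(1) by (intro arg_cong[of _ _ "(*\<^sub>v) A\<^sup>T"]) auto
    then show "v \<in> {A\<^sup>T *\<^sub>v vec (dim_row A) c | c. True}" by blast
  qed auto
  finally show ?thesis unfolding row_lattice_def using V.span_list_as_span[OF rows] by simp
qed

text \<open>Linear independence of the rows as a family: a repeated row is excluded, which independence of the
set of rows does not do.\<close>

definition row_independent :: "int mat \<Rightarrow> bool" where
  "row_independent A \<longleftrightarrow>
     (\<forall>c\<in>carrier_vec (dim_row A). A\<^sup>T *\<^sub>v c = 0\<^sub>v (dim_col A) \<longrightarrow> c = 0\<^sub>v (dim_row A))"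

lemma row_independent_iff:
  "row_independent A \<longleftrightarrow> distinct (rows A) \<and> \<not> int_lin_dep (dim_col A) (set (rows A))"
proof -
  interpret V: idom_vec "dim_col A" "TYPE(int)" .
  have rows: "set (rows A) \<subseteq> carrier_vec (dim_col A)" by (rule rows_carrier)
  have rows_dim: "\<forall>w\<in>set (rows A). dim_vec w = dim_col A" using rows carrier_vecD by blast
  have comb: "V.lincomb f (set (rows A)) = A\<^sup>T *\<^sub>v vec (dim_row A) (\<lambda>i. f (row A i))"
    if "distinct (rows A)" for f
  proof -
    have "V.lincomb f (set (rows A)) = V.lincomb_list (\<lambda>i. f (rows A ! i)) (rows A)"
      using V.lincomb_as_lincomb_list_distinct[OF rows that] .
    also have "\<dots> = A\<^sup>T *\<^sub>v vec (dim_row A) (\<lambda>i. f (rows A ! i))"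
      using V.lincomb_list_as_mat_mult[OF rows_dim] mat_of_cols_cols[of "A\<^sup>T"] by simp
    also have "vec (dim_row A) (\<lambda>i. f (rows A ! i)) = vec (dim_row A) (\<lambda>i. f (row A i))" by auto
    finally show ?thesis .
  qed
  show ?thesis
  proof
    assume ind: "row_independent A"
    have "row A i \<noteq> row A j" if "i < dim_row A" "j < dim_row A" "i \<noteq> j" for i j
    proof
      assume eq: "row A i = row A j"
      define c :: "int vec" where "c = unit_vec (dim_row A) i - unit_vec (dim_row A) j"
      have "A\<^sup>T *\<^sub>v c = A\<^sup>T *\<^sub>v unit_vec (dim_row A) i - A\<^sup>T *\<^sub>v unit_vec (dim_row A) j"
        unfolding c_def by (rule mult_minus_distrib_mat_vec) auto
      also have "\<dots> = 0\<^sub>v (dim_col A)"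
        using that eq mult_mat_unit_vec[of i "A\<^sup>T"] mult_mat_unit_vec[of j "A\<^sup>T"] by simp
      finally have "c = 0\<^sub>v (dim_row A)" using ind unfolding row_independent_def c_def by auto
      then have "c $ i = 0" using that by simp
      then show False using that by (simp add: c_def)
    qed
    then have dist: "distinct (rows A)" unfolding distinct_conv_nth by auto
    have "\<not> V.lin_dep (set (rows A))"
    proof
      assume "V.lin_dep (set (rows A))"
      then obtain f v where f: "V.lincomb f (set (rows A)) = 0\<^sub>v (dim_col A)" "v \<in> set (rows A)" "f v \<noteq> 0"
        using V.finite_lin_dep[OF _ _ rows] by auto
      have z: "vec (dim_row A) (\<lambda>i. f (row A i)) = 0\<^sub>v (dim_row A)"
        using ind f(1) comb[OF dist] unfolding row_independent_def by auto
      obtain i where "i < dim_row A" "v = row A i" using f(2) unfolding rows_def by auto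
      then show False using arg_cong[OF z, of "\<lambda>v. v $ i"] f(3) by simp
    qed
    with dist show "distinct (rows A) \<and> \<not> V.lin_dep (set (rows A))" by simp
  next
    assume D: "distinct (rows A) \<and> \<not> V.lin_dep (set (rows A))"
    show "row_independent A" unfolding row_independent_def
    proof (intro ballI impI)
      fix c assume c: "c \<in> carrier_vec (dim_row A)" and z: "A\<^sup>T *\<^sub>v c = 0\<^sub>v (dim_col A)"
      define f where "f = (\<lambda>v. c $ find_first v (rows A))"
      have fi: "f (row A i) = c $ i" if "i < dim_row A" for i
        using find_first_unique[of "rows A" i] D that unfolding f_def by simp
      have "vec (dim_row A) (\<lambda>i. f (row A i)) = c" using fi c by auto
      then have "V.lincomb f (set (rows A)) = 0\<^sub>v (dim_col A)" using comb D z by simp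
      then have "f v = 0" if "v \<in> set (rows A)" for v
        using V.lin_dep_crit[of "set (rows A)" "set (rows A)" v f] D that by auto
      then have "c $ i = 0" if "i < dim_row A" for i using fi[OF that] that by (auto simp: rows_def)
      then show "c = 0\<^sub>v (dim_row A)" using c by auto
    qed
  qed
qed

lemma lattice_basis_rows_iff:
  assumes "G \<in> carrier_mat b m"
  shows "distinct (rows G) \<and> lattice_basis m L (set (rows G)) \<longleftrightarrow>
    row_independent G \<and> row_lattice G = L"
  using assms rows_carrier[of G] unfolding row_independent_iff lattice_basis_def row_lattice_def
  by auto

text \<open>If fewer than \<open>p\<close> diagonal entries were nonzero, \<open>S\<close> would have a zero row, and \<open>\<alpha>\<close> would turn it into
a relation between the rows of \<open>A\<close>.\<close>

lemma smith_form_of_row_independent: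
  assumes ind: "row_independent A" and sm: "smith_transformation p q A \<alpha> \<beta> S"
  shows "\<exists>c. p \<le> q \<and> (\<forall>i<p. 0 < c i) \<and> (\<forall>i. Suc i < p \<longrightarrow> c i dvd c (Suc i)) \<and>
    S = mat p q (\<lambda>(i, j). if i = j then c i else 0)"
proof -
  have A: "A \<in> carrier_mat p q" and u: "unimodular p \<alpha>" "unimodular q \<beta>" and S: "\<alpha> * A * \<beta> = S"
    using sm unfolding smith_transformation_def by auto
  obtain k c where Sc: "S \<in> carrier_mat p q" and kc: "k \<le> p" "k \<le> q" "\<forall>i<k. (c i :: int) > 0"
    "\<forall>i. Suc i < k \<longrightarrow> c i dvd c (Suc i)"
    "\<forall>i<p. \<forall>j<q. S $$ (i, j) = (if i = j \<and> i < k then c i else 0)"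
    using sm unfolding smith_transformation_def smith_normal_form_def by blast
  obtain \<alpha>' where al: "\<alpha> \<in> carrier_mat p p" "\<alpha>' \<in> carrier_mat p p" "\<alpha> * \<alpha>' = 1\<^sub>m p"
    using u(1) by (rule unimodularE)
  obtain \<beta>' where be: "\<beta> \<in> carrier_mat q q" "\<beta>' \<in> carrier_mat q q" "\<beta> * \<beta>' = 1\<^sub>m q"
    using u(2) by (rule unimodularE)
  have "k = p"
  proof (rule ccontr)
    assume "k \<noteq> p"
    then have kp: "k < p" using kc by simp
    define y where "y = \<alpha>\<^sup>T *\<^sub>v unit_vec p k"
    have y: "y \<in> carrier_vec p" unfolding y_def using al by auto
    have aA: "\<alpha> * A = S * \<beta>'"
      unfolding S[symmetric] using A al(1) be
      by (simp add: assoc_mult_mat[of _ p p _ q _ q] assoc_mult_mat[of _ p q _ q _ q])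
    have "A\<^sup>T *\<^sub>v y = (\<alpha> * A)\<^sup>T *\<^sub>v unit_vec p k"
      unfolding y_def using A al by (simp add: transpose_mult[of _ p p _ q])
    also have "\<dots> = \<beta>'\<^sup>T *\<^sub>v (S\<^sup>T *\<^sub>v unit_vec p k)"
      unfolding aA using Sc be by (simp add: transpose_mult[of _ p q _ q])
    also have "S\<^sup>T *\<^sub>v unit_vec p k = 0\<^sub>v q"
      using Sc kc(5) kp by (intro eq_vecI) auto
    also have "\<beta>'\<^sup>T *\<^sub>v 0\<^sub>v q = 0\<^sub>v q" using be by auto
    finally have "y = 0\<^sub>v p" using ind A y unfolding row_independent_def by auto
    then have "\<alpha>'\<^sup>T *\<^sub>v y = 0\<^sub>v p" using al by auto
    moreover have "\<alpha>'\<^sup>T *\<^sub>v y = (\<alpha> * \<alpha>')\<^sup>T *\<^sub>v unit_vec p k"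
      unfolding y_def using al(1,2) by (simp add: transpose_mult[of _ p p _ p])
    ultimately have "unit_vec p k = (0\<^sub>v p :: int vec)" using al by simp
    then have "(unit_vec p k :: int vec) $ k = 0" using kp by simp
    then show False using kp by simp
  qed
  then have "S = mat p q (\<lambda>(i, j). if i = j then c i else 0)"
    using kc(5) Sc by (intro eq_matI) auto
  then show ?thesis using kc \<open>k = p\<close> by blast
qed

text \<open>Let \<open>S\<close> be the diagonal matrix \<open>\<alpha> A \<beta>\<close> and \<open>E\<close> the one with diagonal entries \<open>C / c i\<close>. Then
\<open>S E\<close> is \<open>C\<close> times the identity, and so is \<open>A (\<beta> E \<alpha>)\<close>. For \<open>C\<close> the product of the \<open>c i\<close> this yields
a right inverse over the rationals, for \<open>C = 1\<close> one over the integers.\<close>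

lemma diagonal_right_inverse:
  assumes sm: "smith_transformation p q A \<alpha> \<beta> (mat p q (\<lambda>(i, j). if i = j then c i else 0))"
    and pq: "p \<le> q" and dvd: "\<And>i. i < p \<Longrightarrow> c i dvd C"
  shows "\<exists>W\<in>carrier_mat q p. A * W = C \<cdot>\<^sub>m 1\<^sub>m p"
proof -
  define S where "S = mat p q (\<lambda>(i, j). if i = j then c i else 0)"
  have A: "A \<in> carrier_mat p q" and u: "unimodular p \<alpha>" "unimodular q \<beta>" and S: "\<alpha> * A * \<beta> = S"
    using sm unfolding smith_transformation_def S_def by auto
  obtain \<alpha>' where al: "\<alpha> \<in> carrier_mat p p" "\<alpha>' \<in> carrier_mat p p" "\<alpha>' * \<alpha> = 1\<^sub>m p"
    using u(1) by (rule unimodularE)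
  have be: "\<beta> \<in> carrier_mat q q" using unimodular_carrier[OF u(2)] .
  define E where "E = mat q p (\<lambda>(i, j). if i = j then C div c j else 0)"
  have E: "E \<in> carrier_mat q p" unfolding E_def by auto
  have SE: "S * E = C \<cdot>\<^sub>m 1\<^sub>m p"
  proof (intro eq_matI)
    fix i j assume ij: "i < dim_row (C \<cdot>\<^sub>m 1\<^sub>m p)" "j < dim_col (C \<cdot>\<^sub>m 1\<^sub>m p)"
    then have "(S * E) $$ (i, j) =
      (\<Sum>l<q. (if i = l then c i else 0) * (if l = j then C div c j else 0))"
      unfolding S_def E_def by (simp add: scalar_prod_def atLeast0LessThan)
    also have "\<dots> = (\<Sum>l<q. (if l = i then c i * (if i = j then C div c j else 0) else 0))"
      by (intro sum.cong) auto
    also have "\<dots> = c i * (if i = j then C div c j else 0)" using ij pq by simp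
    also have "\<dots> = (C \<cdot>\<^sub>m 1\<^sub>m p) $$ (i, j)" using ij dvd[of i] by auto
    finally show "(S * E) $$ (i, j) = (C \<cdot>\<^sub>m 1\<^sub>m p) $$ (i, j)" .
  qed (auto simp: S_def E_def)
  have Ab: "A * \<beta> = \<alpha>' * S"
    unfolding S[symmetric] using A al be
    by (simp add: assoc_mult_mat[of _ p p _ q _ q] assoc_mult_mat[of \<alpha>' p p \<alpha> p "A * \<beta>" q, symmetric])
  have Sc: "S \<in> carrier_mat p q" unfolding S_def by auto
  have "A * (\<beta> * E * \<alpha>) = A * \<beta> * E * \<alpha>"
    using A be E al by (simp add: assoc_mult_mat[of _ p q _ q _ p] assoc_mult_mat[of _ p q _ p _ p]
       assoc_mult_mat[of _ q q _ p _ p])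
  also have "\<dots> = \<alpha>' * (S * E) * \<alpha>" unfolding Ab using Sc E al by (simp add: assoc_mult_mat[of _ p p _ q _ p])
  also have "\<dots> = C \<cdot>\<^sub>m 1\<^sub>m p" unfolding SE using al
    by (simp add: mult_smult_distrib[of _ p p _ p] mult_smult_assoc_mat[of _ p p _ p])
  finally show ?thesis using be E al by (intro bexI[of _ "\<beta> * E * \<alpha>"]) auto
qed

lemma row_independent_right_inverse:
  assumes A: "A \<in> carrier_mat p q" and ind: "row_independent A"
  obtains W C where "W \<in> carrier_mat q p" "(0::int) < C" "A * W = C \<cdot>\<^sub>m 1\<^sub>m p"
proof -
  obtain \<alpha> \<beta> S where sm: "smith_transformation p q A \<alpha> \<beta> S"
    using smith_transformation_exists[OF A] by blast
  obtain c where c: "p \<le> q" "\<forall>i<p. 0 < c i" "\<forall>i. Suc i < p \<longrightarrow> c i dvd c (Suc i)"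
    "S = mat p q (\<lambda>(i, j). if i = j then c i else 0)"
    using smith_form_of_row_independent[OF ind sm] by blast
  have "c i dvd prod c {..<p}" if "i < p" for i using that by (intro dvd_prodI) auto
  then obtain W where "W \<in> carrier_mat q p" "A * W = prod c {..<p} \<cdot>\<^sub>m 1\<^sub>m p"
    using diagonal_right_inverse[OF sm[unfolded c(4)] c(1), of "prod c {..<p}"] by blast
  moreover have "0 < prod c {..<p}" using c(2) by (intro prod_pos) auto
  ultimately show ?thesis using that by blast
qed

text \<open>The rank is defined by the span of the columns over the rationals. A right inverse up to a scalar
shows that the columns span everything; conversely, a nontrivial relation between the rows puts all
columns into a proper subspace.\<close>

lemma int_rank_full_iff:
  assumes A: "A \<in> carrier_mat p q"
  shows "int_rank A = p \<longleftrightarrow> row_independent A"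
proof -
  interpret V: vec_space "TYPE(rat)" p .
  define R where "R = map_mat rat_of_int A"
  have R: "R \<in> carrier_mat p q" unfolding R_def using A by auto
  have cols: "set (cols R) \<subseteq> carrier_vec p" using R cols_dim by blast
  have rank: "int_rank A = V.rank R" unfolding int_rank_def R_def using A by auto
  show ?thesis
  proof
    assume full: "int_rank A = p"
    obtain B where B: "finite B" "maximal B (\<lambda>T. T \<subseteq> set (cols R) \<and> V.lin_indpt T)"
      using maximal_exists_superset[of "set (cols R)" "\<lambda>T. T \<subseteq> set (cols R) \<and> V.lin_indpt T" "{}"]
        V.lin_dep_def by auto
    then have B': "B \<subseteq> set (cols R)" "V.lin_indpt B" unfolding maximal_def by auto
    have "card B = p" using V.rank_card_indpt[OF R B(2)] full rank by simp
    then have "V.basis B" using B B' cols V.dim_li_is_basis[OF V.fin_dim, of B] V.dim_is_n by auto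
    then have spanB: "V.span B = carrier_vec p" unfolding V.basis_def by simp
    show "row_independent A" unfolding row_independent_def
    proof (intro ballI impI)
      fix y assume y: "y \<in> carrier_vec (dim_row A)" and z: "A\<^sup>T *\<^sub>v y = 0\<^sub>v (dim_col A)"
      define y' where "y' = map_vec rat_of_int y"
      have y': "y' \<in> carrier_vec p" unfolding y'_def using y A by auto
      have mod: "module (class_ring :: rat ring) V.V" using vec_vs unfolding vectorspace_def by blast
      have "submodule class_ring {x \<in> carrier_vec p. y' \<bullet> x = 0} V.V"
        using y' mod by (auto simp: submodule_def module_vec_simps
          scalar_prod_add_distrib[of _ p])
      moreover have "B \<subseteq> {x \<in> carrier_vec p. y' \<bullet> x = 0}"
      proof
        fix x assume "x \<in> B"
        then have "x \<in> set (cols R)" using B' by auto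
        then obtain j where j: "j < q" "x = col R j" using R unfolding cols_def by auto
        have "y' \<bullet> x = rat_of_int (col A j \<bullet> y)"
          using A j y unfolding y'_def R_def by (auto simp: scalar_prod_def mult.commute)
        also have "col A j \<bullet> y = (A\<^sup>T *\<^sub>v y) $ j" using A j by simp
        finally show "x \<in> {x \<in> carrier_vec p. y' \<bullet> x = 0}"
          using z j A R by auto
      qed
      ultimately have "V.span B \<subseteq> {x \<in> carrier_vec p. y' \<bullet> x = 0}"
        by (intro V.span_is_subset)
      then have "y' \<bullet> x = 0" if "x \<in> carrier_vec p" for x using spanB that by blast
      then have "y' $ i = 0" if "i < p" for i
        using scalar_prod_right_unit[of i p y'] y' that by (metis unit_vec_carrier)
      then show "y = 0\<^sub>v (dim_row A)" unfolding y'_def using y A by auto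
    qed
  next
    assume ind: "row_independent A"
    obtain W C where W: "W \<in> carrier_mat q p" "(0::int) < C" "A * W = C \<cdot>\<^sub>m 1\<^sub>m p"
      by (rule row_independent_right_inverse[OF A ind])
    define W' where "W' = map_mat rat_of_int W"
    have W': "W' \<in> carrier_mat q p" unfolding W'_def using W by auto
    have "R * W' = map_mat rat_of_int (A * W)"
      unfolding R_def W'_def by (rule of_int_hom.mat_hom_mult[OF A W(1), symmetric])
    also have "\<dots> = rat_of_int C \<cdot>\<^sub>m 1\<^sub>m p" unfolding W(3) by (intro eq_matI) auto
    finally have RW: "R * W' = rat_of_int C \<cdot>\<^sub>m 1\<^sub>m p" .
    have "V.span (set (cols R)) = carrier_vec p"
    proof
      show "carrier_vec p \<subseteq> V.span (set (cols R))"
      proof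
        fix y :: "rat vec" assume y: "y \<in> carrier_vec p"
        define x where "x = W' *\<^sub>v ((1 / rat_of_int C) \<cdot>\<^sub>v y)"
        have "R *\<^sub>v x = (R * W') *\<^sub>v ((1 / rat_of_int C) \<cdot>\<^sub>v y)"
          unfolding x_def using R W' y by simp
        also have "\<dots> = y" unfolding RW using W(2) y
          by (simp add: smult_one_mult_vec smult_smult_assoc)
        finally have "R *\<^sub>v x = y" .
        moreover have "x \<in> carrier_vec q" unfolding x_def using y W' by (intro mult_mat_vec_carrier[of _ q p]) (auto simp: y)
        ultimately show "y \<in> V.span (set (cols R))"
          using V.col_space_eq[OF R] R y unfolding V.col_space_def by auto
      qed
    qed (use V.span_closed cols in auto)
    then have "V.vs (V.span (set (cols R))) = V.V" by (simp add: module_vec_def)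
    then show "int_rank A = p" unfolding rank V.rank_def using V.dim_is_n by metis
  qed
qed

section \<open>Torsion of a lattice quotient\<close>
abbreviation vec_group :: "nat \<Rightarrow> int vec monoid" where
  "vec_group m \<equiv> monoid_vec TYPE(int) m"

lemma vec_group_inv: "x \<in> carrier_vec m \<Longrightarrow> inv\<^bsub>vec_group m\<^esub> x = - x"
proof -
  interpret comm_group "vec_group m" by (rule comm_group_vec)
  show "x \<in> carrier_vec m \<Longrightarrow> inv\<^bsub>vec_group m\<^esub> x = - x"
    by (rule inv_equality) (auto simp: monoid_vec_simps)
qed

lemma vec_group_pow:
  assumes x: "x \<in> carrier_vec m"
  shows "x [^]\<^bsub>vec_group m\<^esub> (k :: nat) = int k \<cdot>\<^sub>v x"
proof (induction k)
  interpret comm_group "vec_group m" by (rule comm_group_vec)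
  case 0
  have "x [^]\<^bsub>vec_group m\<^esub> (0 :: nat) = 0\<^sub>v m" unfolding nat_pow_0 monoid_vec_simps ..
  also have "\<dots> = int 0 \<cdot>\<^sub>v x" using x by (intro eq_vecI) auto
  finally show ?case .
next
  interpret comm_group "vec_group m" by (rule comm_group_vec)
  case (Suc k)
  have "x [^]\<^bsub>vec_group m\<^esub> Suc k = int k \<cdot>\<^sub>v x + x"
    unfolding nat_pow_Suc Suc.IH monoid_vec_simps ..
  also have "\<dots> = int (Suc k) \<cdot>\<^sub>v x"
    using x by (intro eq_vecI) (auto simp: algebra_simps)
  finally show ?case .
qed

lemma vec_group_int_pow:
  assumes x: "x \<in> carrier_vec m"
  shows "x [^]\<^bsub>vec_group m\<^esub> (k :: int) = k \<cdot>\<^sub>v x"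
proof (cases "k < 0")
  case True
  have "x [^]\<^bsub>vec_group m\<^esub> k = - (int (nat (- k)) \<cdot>\<^sub>v x)"
    unfolding int_pow_def2 vec_group_pow[OF x] using True vec_group_inv[of "int (nat (- k)) \<cdot>\<^sub>v x" m] x
    by simp
  also have "\<dots> = k \<cdot>\<^sub>v x" using True x by (intro eq_vecI) auto
  finally show ?thesis .
qed (simp add: int_pow_def2 vec_group_pow[OF x])

lemma subgroup_vec_groupD:
  assumes "subgroup L (vec_group m)"
  shows "v \<in> L \<Longrightarrow> v \<in> carrier_vec m" "0\<^sub>v m \<in> L" "v \<in> L \<Longrightarrow> w \<in> L \<Longrightarrow> v + w \<in> L"
    "v \<in> L \<Longrightarrow> - v \<in> L" "v \<in> L \<Longrightarrow> w \<in> L \<Longrightarrow> v - w \<in> L" "v \<in> L \<Longrightarrow> k \<cdot>\<^sub>v v \<in> L"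
proof -
  interpret G: comm_group "vec_group m" by (rule comm_group_vec)
  interpret L: subgroup L "vec_group m" by fact
  show carr: "v \<in> carrier_vec m" if "v \<in> L" for v using that L.subset by (auto simp: monoid_vec_simps)
  show "0\<^sub>v m \<in> L" using L.one_closed by (simp add: monoid_vec_simps)
  show add: "v \<in> L \<Longrightarrow> w \<in> L \<Longrightarrow> v + w \<in> L" for v w using L.m_closed by (simp add: monoid_vec_simps)
  show neg: "v \<in> L \<Longrightarrow> - v \<in> L" for v using L.m_inv_closed[of v] carr[of v] by (simp add: vec_group_inv)
  show "v - w \<in> L" if "v \<in> L" "w \<in> L"
    using add[OF that(1) neg[OF that(2)]] carr[OF that(1)] carr[OF that(2)]
    by (simp add: minus_add_uminus_vec[of v m w])
  show "k \<cdot>\<^sub>v v \<in> L" if "v \<in> L"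
    using G.subgroup_int_pow_closed[OF assms that, of k] carr[OF that] by (simp add: vec_group_int_pow)
qed

lemma subgroup_row_lattice:
  assumes "A \<in> carrier_mat p q"
  shows "subgroup (row_lattice A) (vec_group q)"
proof -
  interpret G: comm_group "vec_group q" by (rule comm_group_vec)
  show ?thesis
  proof (rule G.subgroupI)
    show "row_lattice A \<subseteq> carrier (vec_group q)" using assms by (auto simp: row_lattice_eq monoid_vec_simps)
    have "A\<^sup>T *\<^sub>v 0\<^sub>v p \<in> row_lattice A" using assms by (auto simp: row_lattice_eq)
    then show "row_lattice A \<noteq> {}" by blast
  next
    fix v assume "v \<in> row_lattice A"
    then obtain c where c: "c \<in> carrier_vec p" "v = A\<^sup>T *\<^sub>v c" using assms by (auto simp: row_lattice_eq)
    then have "- v = A\<^sup>T *\<^sub>v (- c)" using assms by (intro eq_vecI) auto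
    moreover have "inv\<^bsub>vec_group q\<^esub> v = - v" by (rule vec_group_inv) (use c assms in auto)
    ultimately show "inv\<^bsub>vec_group q\<^esub> v \<in> row_lattice A" using c assms by (auto simp: row_lattice_eq)
  next
    fix v w assume "v \<in> row_lattice A" "w \<in> row_lattice A"
    then obtain c e where c: "c \<in> carrier_vec p" "v = A\<^sup>T *\<^sub>v c" "e \<in> carrier_vec p" "w = A\<^sup>T *\<^sub>v e"
      using assms by (auto simp: row_lattice_eq)
    then have "v + w = A\<^sup>T *\<^sub>v (c + e)"
      using assms by (simp add: mult_add_distrib_mat_vec[of _ q p])
    then show "v \<otimes>\<^bsub>vec_group q\<^esub> w \<in> row_lattice A"
      using c assms by (auto simp: row_lattice_eq monoid_vec_simps)
  qed
qed

text \<open>The preimage in \<open>\<int>\<^sup>m\<close> of the torsion subgroup of \<open>\<int>\<^sup>m / L\<close>.\<close>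

definition saturation :: "nat \<Rightarrow> int vec set \<Rightarrow> int vec set" where
  "saturation m L = {w \<in> carrier_vec m. \<exists>k>0. k \<cdot>\<^sub>v w \<in> L}"

lemma lattice_coset_eq_iff:
  assumes L: "subgroup L (vec_group m)" and w: "w \<in> carrier_vec m" "w' \<in> carrier_vec m"
  shows "L #>\<^bsub>vec_group m\<^esub> w = L #>\<^bsub>vec_group m\<^esub> w' \<longleftrightarrow> w - w' \<in> L"
proof -
  interpret G: comm_group "vec_group m" by (rule comm_group_vec)
  show ?thesis
  proof
    assume "L #>\<^bsub>vec_group m\<^esub> w = L #>\<^bsub>vec_group m\<^esub> w'"
    then have "w \<in> L #>\<^bsub>vec_group m\<^esub> w'" using G.rcos_self[OF _ L, of w] w by (simp add: monoid_vec_simps)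
    then obtain l where l: "l \<in> L" "w = l + w'" unfolding r_coset_def by (auto simp: monoid_vec_simps)
    then have "w - w' = l" using w subgroup_vec_groupD(1)[OF L l(1)] by (intro eq_vecI) auto
    then show "w - w' \<in> L" using l by simp
  next
    assume "w - w' \<in> L"
    moreover have "w = (w - w') + w'" using w by (intro eq_vecI) auto
    ultimately have "w \<in> L #>\<^bsub>vec_group m\<^esub> w'" unfolding r_coset_def by (auto simp: monoid_vec_simps)
    then show "L #>\<^bsub>vec_group m\<^esub> w = L #>\<^bsub>vec_group m\<^esub> w'"
      using G.repr_independence[OF _ _ L, of w w'] w by (simp add: monoid_vec_simps)
  qed
qed

lemma carrier_torsion_group:
  assumes L: "subgroup L (vec_group m)"
  shows "carrier (torsion_group (lattice_quotient m L)) =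
    (\<lambda>w. L #>\<^bsub>vec_group m\<^esub> w) ` saturation m L"
proof -
  interpret G: comm_group "vec_group m" by (rule comm_group_vec)
  interpret L: normal L "vec_group m" using L by (rule G.subgroup_imp_normal)
  have "(L #>\<^bsub>vec_group m\<^esub> w) [^]\<^bsub>lattice_quotient m L\<^esub> k = \<one>\<^bsub>lattice_quotient m L\<^esub> \<longleftrightarrow> int k \<cdot>\<^sub>v w \<in> L"
    if w: "w \<in> carrier_vec m" for w and k :: nat
  proof -
    have w': "w \<in> carrier (vec_group m)" using w by (simp add: monoid_vec_simps)
    have "(L #>\<^bsub>vec_group m\<^esub> w) [^]\<^bsub>lattice_quotient m L\<^esub> k = L #>\<^bsub>vec_group m\<^esub> (int k \<cdot>\<^sub>v w)"
      using L.FactGroup_pow[OF w', of k] unfolding vec_group_pow[OF w] .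
    moreover have "\<one>\<^bsub>lattice_quotient m L\<^esub> = L #>\<^bsub>vec_group m\<^esub> 0\<^sub>v m"
      using G.coset_join2[OF _ L, of "0\<^sub>v m"] subgroup_vec_groupD(2)[OF L] by (simp add: monoid_vec_simps)
    ultimately show ?thesis using lattice_coset_eq_iff[OF L, of "int k \<cdot>\<^sub>v w" "0\<^sub>v m"] w by simp
  qed
  then have "carrier (torsion_group (lattice_quotient m L)) =
    (\<lambda>w. L #>\<^bsub>vec_group m\<^esub> w) ` {w \<in> carrier_vec m. \<exists>k::nat. k > 0 \<and> int k \<cdot>\<^sub>v w \<in> L}"
    unfolding torsion_group_def by (auto simp: carrier_FactGroup monoid_vec_simps)
  also have "{w \<in> carrier_vec m. \<exists>k::nat. k > 0 \<and> int k \<cdot>\<^sub>v w \<in> L} = saturation m L"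
    unfolding saturation_def
  proof (intro Collect_cong conj_cong refl iffI)
    fix w assume "\<exists>k>0. k \<cdot>\<^sub>v w \<in> L"
    then obtain k where "k > 0" "k \<cdot>\<^sub>v w \<in> L" by blast
    then show "\<exists>k::nat. k > 0 \<and> int k \<cdot>\<^sub>v w \<in> L" by (intro exI[of _ "nat k"]) auto
  qed (meson of_nat_0_less_iff)
  finally show ?thesis .
qed

lemma no_cotorsion_iff:
  assumes L: "subgroup L (vec_group m)"
  shows "no_cotorsion m L \<longleftrightarrow> saturation m L \<subseteq> L"
proof -
  interpret G: comm_group "vec_group m" by (rule comm_group_vec)
  have one: "\<one>\<^bsub>lattice_quotient m L\<^esub> = L #>\<^bsub>vec_group m\<^esub> 0\<^sub>v m"
    using G.coset_join2[OF _ L, of "0\<^sub>v m"] subgroup_vec_groupD(2)[OF L] by (simp add: monoid_vec_simps)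
  have coset: "L #>\<^bsub>vec_group m\<^esub> w = L #>\<^bsub>vec_group m\<^esub> 0\<^sub>v m \<longleftrightarrow> w \<in> L" if "w \<in> saturation m L" for w
    using lattice_coset_eq_iff[OF L, of w "0\<^sub>v m"] that by (auto simp: saturation_def)
  have "0\<^sub>v m \<in> saturation m L"
    using subgroup_vec_groupD(2)[OF L] by (auto simp: saturation_def intro!: exI[of _ 1])
  then have "no_cotorsion m L \<longleftrightarrow>
    (\<forall>w\<in>saturation m L. L #>\<^bsub>vec_group m\<^esub> w = L #>\<^bsub>vec_group m\<^esub> 0\<^sub>v m)"
    unfolding no_cotorsion_def carrier_torsion_group[OF L] one by auto
  then show ?thesis using coset by auto
qed

text \<open>The hypotheses say that \<open>a \<mapsto> a x\<close> induces a surjection from \<open>\<int>\<close> onto the torsion subgroup, with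
kernel \<open>d \<int>\<close>.\<close>

lemma cyclic_torsion_group:
  assumes L: "subgroup L (vec_group m)" and d: "0 < d" and x: "x \<in> carrier_vec m"
    and order: "\<And>a. a \<cdot>\<^sub>v x \<in> L \<longleftrightarrow> d dvd a"
    and gen: "\<And>w. w \<in> saturation m L \<Longrightarrow> \<exists>a. w - a \<cdot>\<^sub>v x \<in> L"
  defines "T \<equiv> torsion_group (lattice_quotient m L)"
  shows "cyclic_group T" "finite (carrier T)" "int (card (carrier T)) = d"
proof -
  interpret G: comm_group "vec_group m" by (rule comm_group_vec)
  interpret L: normal L "vec_group m" using L by (rule G.subgroup_imp_normal)
  interpret Q: group "lattice_quotient m L" by (rule L.factorgroup_is_group)
  note sub = subgroup_vec_groupD[OF L]
  define cls where "cls = (\<lambda>w. L #>\<^bsub>vec_group m\<^esub> w)"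
  have carrT: "carrier T = cls ` saturation m L" unfolding T_def cls_def by (rule carrier_torsion_group[OF L])
  have sat_mult: "a \<cdot>\<^sub>v x \<in> saturation m L" for a
    unfolding saturation_def using x d order[of "d * a"] by (auto intro!: exI[of _ d] simp: smult_smult_assoc)
  have cls_eq: "cls (a \<cdot>\<^sub>v x) = cls (b \<cdot>\<^sub>v x) \<longleftrightarrow> d dvd a - b" for a b
  proof -
    have "a \<cdot>\<^sub>v x - b \<cdot>\<^sub>v x = (a - b) \<cdot>\<^sub>v x" using x by (intro eq_vecI) (auto simp: algebra_simps)
    then show ?thesis
      unfolding cls_def order[symmetric] using x lattice_coset_eq_iff[OF L, of "a \<cdot>\<^sub>v x" "b \<cdot>\<^sub>v x"] by simp
  qed
  have carrT': "carrier T = range (\<lambda>a. cls (a \<cdot>\<^sub>v x))"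
  proof
    show "carrier T \<subseteq> range (\<lambda>a. cls (a \<cdot>\<^sub>v x))"
    proof
      fix y assume "y \<in> carrier T"
      then obtain w where w: "w \<in> saturation m L" "y = cls w" unfolding carrT by blast
      obtain a where "w - a \<cdot>\<^sub>v x \<in> L" using gen[OF w(1)] by blast
      then have "y = cls (a \<cdot>\<^sub>v x)"
        using lattice_coset_eq_iff[OF L, of w "a \<cdot>\<^sub>v x"] w x unfolding cls_def by (auto simp: saturation_def)
      then show "y \<in> range (\<lambda>a. cls (a \<cdot>\<^sub>v x))" by blast
    qed
  qed (use sat_mult carrT in auto)
  have "range (\<lambda>a. cls (a \<cdot>\<^sub>v x)) = (\<lambda>a. cls (a \<cdot>\<^sub>v x)) ` {0..<d}"
  proof (intro equalityI subsetI)
    fix y assume "y \<in> range (\<lambda>a. cls (a \<cdot>\<^sub>v x))"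
    then obtain a where "y = cls (a \<cdot>\<^sub>v x)" by blast
    then have "y = cls ((a mod d) \<cdot>\<^sub>v x)" using cls_eq[of a "a mod d"] by (simp add: minus_mod_eq_mult_div)
    then show "y \<in> (\<lambda>a. cls (a \<cdot>\<^sub>v x)) ` {0..<d}" using d by auto
  qed auto
  moreover have "inj_on (\<lambda>a. cls (a \<cdot>\<^sub>v x)) {0..<d}"
    by (auto simp: inj_on_def cls_eq mod_eq_dvd_iff[symmetric])
  ultimately show "finite (carrier T)" "int (card (carrier T)) = d"
    unfolding carrT' using d by (auto simp: card_image)
  have cls_mem: "cls w \<in> carrier (lattice_quotient m L)" if "w \<in> carrier_vec m" for w
    unfolding cls_def using that by (auto simp: carrier_FactGroup monoid_vec_simps)
  have subT: "subgroup (carrier T) (lattice_quotient m L)"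
  proof (rule Q.subgroupI)
    show "carrier T \<subseteq> carrier (lattice_quotient m L)" unfolding T_def torsion_group_def by auto
    show "carrier T \<noteq> {}" unfolding carrT' by blast
    fix y assume "y \<in> carrier T"
    then obtain a where a: "y = cls (a \<cdot>\<^sub>v x)" unfolding carrT' by blast
    have "inv\<^bsub>lattice_quotient m L\<^esub> y = cls (- (a \<cdot>\<^sub>v x))"
      using L.inv_FactGroup[of y] L.rcos_inv[of "a \<cdot>\<^sub>v x"] cls_mem[of "a \<cdot>\<^sub>v x"] a x
      unfolding cls_def by (simp add: monoid_vec_simps vec_group_inv)
    also have "- (a \<cdot>\<^sub>v x) = (- a) \<cdot>\<^sub>v x" using x by (intro eq_vecI) auto
    finally show "inv\<^bsub>lattice_quotient m L\<^esub> y \<in> carrier T" unfolding carrT' by blast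
    fix z assume "z \<in> carrier T"
    then obtain b where b: "z = cls (b \<cdot>\<^sub>v x)" unfolding carrT' by blast
    have "y \<otimes>\<^bsub>lattice_quotient m L\<^esub> z = cls (a \<cdot>\<^sub>v x + b \<cdot>\<^sub>v x)"
      unfolding a b cls_def using x L.rcos_sum[of "a \<cdot>\<^sub>v x" "b \<cdot>\<^sub>v x"] by (simp add: monoid_vec_simps)
    also have "a \<cdot>\<^sub>v x + b \<cdot>\<^sub>v x = (a + b) \<cdot>\<^sub>v x" using x by (simp add: add_smult_distrib_vec)
    finally show "y \<otimes>\<^bsub>lattice_quotient m L\<^esub> z \<in> carrier T" unfolding carrT' by blast
  qed
  have T: "T = (lattice_quotient m L)\<lparr>carrier := carrier T\<rparr>" unfolding T_def torsion_group_def by simp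
  interpret T: group T using Q.subgroup_imp_group[OF subT] T by simp
  have x1: "cls x \<in> carrier T" unfolding carrT' using x by (auto intro!: image_eqI[of _ _ 1])
  have "cls x [^]\<^bsub>T\<^esub> (a :: int) = cls (a \<cdot>\<^sub>v x)" for a
  proof -
    have "cls x [^]\<^bsub>T\<^esub> a = cls x [^]\<^bsub>lattice_quotient m L\<^esub> a"
      using Q.int_pow_consistent[OF subT x1, of a] T by simp
    also have "\<dots> = cls (a \<cdot>\<^sub>v x)"
      using L.FactGroup_int_pow[of x a] x unfolding cls_def by (simp add: monoid_vec_simps vec_group_int_pow)
    finally show ?thesis .
  qed
  then have "carrier T = range (\<lambda>a::int. cls x [^]\<^bsub>T\<^esub> a)" unfolding carrT' by simp
  then show "cyclic_group T" unfolding T.cyclic_group using x1 by blast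
qed

section \<open>Gale duality\<close>
lemma vec_eq_if_scalar_prod_eq:
  fixes v w :: "'a :: comm_ring_1 vec"
  assumes "v \<in> carrier_vec n" "w \<in> carrier_vec n" "\<And>z. z \<in> carrier_vec n \<Longrightarrow> v \<bullet> z = w \<bullet> z"
  shows "v = w"
proof (rule eq_vecI)
  fix i assume "i < dim_vec w"
  then show "v $ i = w $ i" using assms(3)[of "unit_vec n i"] assms(1,2) by simp
qed (use assms in auto)

lemma smult_vec_cancel:
  fixes v w :: "int vec"
  assumes "k \<cdot>\<^sub>v v = k \<cdot>\<^sub>v w" "k \<noteq> 0" "v \<in> carrier_vec n" "w \<in> carrier_vec n"
  shows "v = w"
proof (rule eq_vecI)
  fix i assume "i < dim_vec w"
  then have "k * v $ i = k * w $ i" using assms by (metis index_smult_vec(1) carrier_vecD)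
  then show "v $ i = w $ i" using assms(2) by simp
qed (use assms in auto)

lemma smult_vec_zero: "k \<cdot>\<^sub>v 0\<^sub>v n = (0\<^sub>v n :: 'a :: semiring_0 vec)"
  by (intro eq_vecI) auto

lemma mult_mat_zero_vec: "A *\<^sub>v 0\<^sub>v (dim_col A) = (0\<^sub>v (dim_row A) :: 'a :: semiring_0 vec)"
  by (intro eq_vecI) auto

lemma row_latticeE:
  assumes "v \<in> row_lattice A" "A \<in> carrier_mat p q"
  obtains c where "c \<in> carrier_vec p" "v = A\<^sup>T *\<^sub>v c"
  using assms unfolding row_lattice_eq by auto

lemma row_latticeI: "c \<in> carrier_vec (dim_row A) \<Longrightarrow> A\<^sup>T *\<^sub>v c \<in> row_lattice A"
  unfolding row_lattice_eq by blast

text \<open>If \<open>A X = 1\<close>, then \<open>w = A\<^sup>T X\<^sup>T w\<close> for every \<open>w\<close> in the lattice, hence for every \<open>w\<close> with a multiple in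
it. Conversely, let \<open>\<alpha> A \<beta>\<close> be diagonal with entries \<open>c i\<close>. The \<open>i\<close>-th row of the inverse of \<open>\<beta>\<close>
has its \<open>c i\<close>-th multiple in the row lattice, so it lies in the lattice itself, which forces
\<open>c i = 1\<close> for every \<open>i\<close>; then an integral right inverse exists.\<close>

lemma right_inverse_iff:
  assumes A: "A \<in> carrier_mat p q"
  shows "(\<exists>X\<in>carrier_mat q p. A * X = 1\<^sub>m p) \<longleftrightarrow>
    row_independent A \<and> saturation q (row_lattice A) \<subseteq> row_lattice A"
proof
  assume "\<exists>X\<in>carrier_mat q p. A * X = 1\<^sub>m p"
  then obtain X where X: "X \<in> carrier_mat q p" "A * X = 1\<^sub>m p" by blast
  have left: "X\<^sup>T *\<^sub>v (A\<^sup>T *\<^sub>v c) = c" if "c \<in> carrier_vec p" for c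
  proof -
    have "X\<^sup>T *\<^sub>v (A\<^sup>T *\<^sub>v c) = (A * X)\<^sup>T *\<^sub>v c"
      using A X(1) that by (simp add: transpose_mult[of _ p q _ p])
    then show ?thesis using X that by simp
  qed
  have "row_independent A" unfolding row_independent_def
  proof (intro ballI impI)
    fix c assume c: "c \<in> carrier_vec (dim_row A)" "A\<^sup>T *\<^sub>v c = 0\<^sub>v (dim_col A)"
    then have "c = X\<^sup>T *\<^sub>v 0\<^sub>v q" using left[of c] A by simp
    also have "\<dots> = 0\<^sub>v p" using X by auto
    finally show "c = 0\<^sub>v (dim_row A)" using A by simp
  qed
  moreover have "w \<in> row_lattice A" if w_sat: "w \<in> saturation q (row_lattice A)" for w
  proof -
    obtain k where w: "w \<in> carrier_vec q" "k > 0" "k \<cdot>\<^sub>v w \<in> row_lattice A"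
      using w_sat unfolding saturation_def by blast
    obtain c where c: "c \<in> carrier_vec p" "k \<cdot>\<^sub>v w = A\<^sup>T *\<^sub>v c"
      using w(3) A by (rule row_latticeE)
    have X': "X\<^sup>T *\<^sub>v w \<in> carrier_vec p" using X w by (intro mult_mat_vec_carrier[of _ p q]) auto
    have "k \<cdot>\<^sub>v (X\<^sup>T *\<^sub>v w) = c"
      using left[OF c(1)] X w unfolding c(2)[symmetric]
      by (simp add: mult_mat_smult_vec)
    then have "k \<cdot>\<^sub>v w = k \<cdot>\<^sub>v (A\<^sup>T *\<^sub>v (X\<^sup>T *\<^sub>v w))"
      using c A X' mult_mat_smult_vec[of "X\<^sup>T *\<^sub>v w" "A\<^sup>T" k] by simp
    then have "w = A\<^sup>T *\<^sub>v (X\<^sup>T *\<^sub>v w)"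
      by (rule smult_vec_cancel[where n = q]) (use w A X' in \<open>auto intro!: mult_mat_vec_carrier[of _ q p]\<close>)
    moreover have "A\<^sup>T *\<^sub>v (X\<^sup>T *\<^sub>v w) \<in> row_lattice A" by (rule row_latticeI) (use X' A in simp)
    ultimately show ?thesis by simp
  qed
  ultimately show "row_independent A \<and> saturation q (row_lattice A) \<subseteq> row_lattice A" by blast
next
  assume H: "row_independent A \<and> saturation q (row_lattice A) \<subseteq> row_lattice A"
  obtain \<alpha> \<beta> S where sm: "smith_transformation p q A \<alpha> \<beta> S"
    using smith_transformation_exists[OF A] by blast
  obtain c where c: "p \<le> q" "\<forall>i<p. 0 < c i" "\<forall>i. Suc i < p \<longrightarrow> c i dvd c (Suc i)"
    "S = mat p q (\<lambda>(i, j). if i = j then c i else 0)"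
    using smith_form_of_row_independent[OF _ sm] H by blast
  have u: "unimodular p \<alpha>" "unimodular q \<beta>" and S: "\<alpha> * A * \<beta> = S"
    using sm unfolding smith_transformation_def by auto
  obtain \<alpha>' where al: "\<alpha> \<in> carrier_mat p p" "\<alpha>' \<in> carrier_mat p p" "\<alpha> * \<alpha>' = 1\<^sub>m p"
    using u(1) by (rule unimodularE)
  obtain \<beta>' where be: "\<beta> \<in> carrier_mat q q" "\<beta>' \<in> carrier_mat q q" "\<beta> * \<beta>' = 1\<^sub>m q"
    using u(2) by (rule unimodularE)
  have Sc: "S \<in> carrier_mat p q" unfolding c(4) by auto
  have aA: "\<alpha> * A = S * \<beta>'"
    unfolding S[symmetric] using A al(1) be
    by (simp add: assoc_mult_mat[of _ p p _ q _ q] assoc_mult_mat[of _ p q _ q _ q])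
  have "c i dvd 1" if i: "i < p" for i
  proof -
    define g where "g = \<beta>'\<^sup>T *\<^sub>v unit_vec q i"
    define a where "a = \<alpha>\<^sup>T *\<^sub>v unit_vec p i"
    have g: "g \<in> carrier_vec q" unfolding g_def using be by (intro mult_mat_vec_carrier[of _ q q]) auto
    have a: "a \<in> carrier_vec p" unfolding a_def using al by (intro mult_mat_vec_carrier[of _ p p]) auto
    have "A\<^sup>T *\<^sub>v a = (\<alpha> * A)\<^sup>T *\<^sub>v unit_vec p i"
      unfolding a_def using A al(1) by (simp add: transpose_mult[of _ p p _ q])
    also have "\<dots> = \<beta>'\<^sup>T *\<^sub>v (S\<^sup>T *\<^sub>v unit_vec p i)"
      unfolding aA using Sc be(2) by (simp add: transpose_mult[of _ p q _ q])
    also have "S\<^sup>T *\<^sub>v unit_vec p i = c i \<cdot>\<^sub>v unit_vec q i"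
      unfolding c(4) using i c(1) by (intro eq_vecI) auto
    also have "\<beta>'\<^sup>T *\<^sub>v (c i \<cdot>\<^sub>v unit_vec q i) = c i \<cdot>\<^sub>v g"
      unfolding g_def using be by (simp add: mult_mat_smult_vec)
    finally have ag: "A\<^sup>T *\<^sub>v a = c i \<cdot>\<^sub>v g" .
    have "c i \<cdot>\<^sub>v g \<in> row_lattice A" unfolding ag[symmetric] by (rule row_latticeI) (use a A in simp)
    then have "g \<in> saturation q (row_lattice A)" using g c(2) i unfolding saturation_def by blast
    then have "g \<in> row_lattice A" using H by blast
    then obtain e where e: "e \<in> carrier_vec p" "g = A\<^sup>T *\<^sub>v e" using A by (rule row_latticeE)
    have "A\<^sup>T *\<^sub>v (a - c i \<cdot>\<^sub>v e) = A\<^sup>T *\<^sub>v a - A\<^sup>T *\<^sub>v (c i \<cdot>\<^sub>v e)"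
      using A a e by (intro mult_minus_distrib_mat_vec[of _ q p]) auto
    also have "\<dots> = 0\<^sub>v q" using A e g ag by (simp add: mult_mat_smult_vec)
    finally have "a - c i \<cdot>\<^sub>v e = 0\<^sub>v p" using H A a e unfolding row_independent_def by auto
    moreover have "a = (a - c i \<cdot>\<^sub>v e) + c i \<cdot>\<^sub>v e" using a e by (intro eq_vecI) auto
    ultimately have "a = c i \<cdot>\<^sub>v e" using e by simp
    moreover have "\<alpha>'\<^sup>T *\<^sub>v a = (\<alpha> * \<alpha>')\<^sup>T *\<^sub>v unit_vec p i"
      unfolding a_def using al(1,2) by (simp add: transpose_mult[of _ p p _ p])
    ultimately have "unit_vec p i = c i \<cdot>\<^sub>v (\<alpha>'\<^sup>T *\<^sub>v e)"
      using al e by (simp add: mult_mat_smult_vec)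
    then have "(unit_vec p i :: int vec) $ i = (c i \<cdot>\<^sub>v (\<alpha>'\<^sup>T *\<^sub>v e)) $ i" by simp
    then have "1 = c i * (\<alpha>'\<^sup>T *\<^sub>v e) $ i" using i al by simp
    then show ?thesis by (rule dvdI)
  qed
  then obtain W where "W \<in> carrier_mat q p" "A * W = 1 \<cdot>\<^sub>m 1\<^sub>m p"
    using diagonal_right_inverse[OF sm[unfolded c(4)] c(1), of 1] by blast
  moreover have "1 \<cdot>\<^sub>m 1\<^sub>m p = (1\<^sub>m p :: int mat)" by auto
  ultimately show "\<exists>X\<in>carrier_mat q p. A * X = 1\<^sub>m p" by auto
qed

lemma mat_kernel_eq: "A \<in> carrier_mat p q \<Longrightarrow> mat_kernel A = {v \<in> carrier_vec q. A *\<^sub>v v = 0\<^sub>v p}"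
  unfolding mat_kernel_def by auto

lemma is_gale_dual_iff:
  "is_gale_dual a b A G \<longleftrightarrow> A \<in> carrier_mat a (a + b) \<and> row_independent A \<and>
     G \<in> carrier_mat b (a + b) \<and> row_independent G \<and> row_lattice G = mat_kernel A"
  unfolding is_gale_dual_def using lattice_basis_rows_iff[of G b "a + b" "mat_kernel A"]
    int_rank_full_iff[of A a "a + b"] by blast

lemma saturation_mat_kernel:
  assumes A: "A \<in> carrier_mat p q"
  shows "saturation q (mat_kernel A) \<subseteq> mat_kernel A"
proof
  fix w assume "w \<in> saturation q (mat_kernel A)"
  then obtain k where w: "w \<in> carrier_vec q" "k > 0" "A *\<^sub>v (k \<cdot>\<^sub>v w) = 0\<^sub>v p"
    unfolding saturation_def mat_kernel_eq[OF A] by auto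
  have "k \<cdot>\<^sub>v (A *\<^sub>v w) = 0\<^sub>v p" using w A by (simp add: mult_mat_smult_vec)
  then have "k \<cdot>\<^sub>v (A *\<^sub>v w) = k \<cdot>\<^sub>v 0\<^sub>v p" by (simp add: smult_vec_zero)
  then have "A *\<^sub>v w = 0\<^sub>v p"
    by (rule smult_vec_cancel[where n = p]) (use w A in \<open>auto intro!: mult_mat_vec_carrier[of _ p q]\<close>)
  then show "w \<in> mat_kernel A" using w A by (simp add: mat_kernel_eq)
qed

text \<open>If \<open>\<alpha> A \<beta>\<close> is diagonal with nonzero diagonal entries, the kernel of \<open>A\<close> has the last \<open>b\<close> columns of
\<open>\<beta>\<close> as a basis.\<close>

lemma gale_dual_exists:
  assumes A: "A \<in> carrier_mat a (a + b)" and ind: "row_independent A"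
  shows "\<exists>G. is_gale_dual a b A G"
proof -
  let ?m = "a + b"
  obtain \<alpha> \<beta> S where sm: "smith_transformation a ?m A \<alpha> \<beta> S"
    using smith_transformation_exists[OF A] by blast
  obtain c where c: "\<forall>i<a. 0 < c i" "S = mat a ?m (\<lambda>(i, j). if i = j then c i else 0)"
    using smith_form_of_row_independent[OF ind sm] by blast
  have u: "unimodular a \<alpha>" "unimodular ?m \<beta>" and S: "\<alpha> * A * \<beta> = S"
    using sm unfolding smith_transformation_def by auto
  obtain \<alpha>' where al: "\<alpha> \<in> carrier_mat a a" "\<alpha>' \<in> carrier_mat a a" "\<alpha>' * \<alpha> = 1\<^sub>m a"
    using u(1) by (rule unimodularE)
  obtain \<beta>' where be: "\<beta> \<in> carrier_mat ?m ?m" "\<beta>' \<in> carrier_mat ?m ?m" "\<beta> * \<beta>' = 1\<^sub>m ?m"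
    "\<beta>' * \<beta> = 1\<^sub>m ?m"
    using u(2) by (rule unimodularE)
  have Sc: "S \<in> carrier_mat a ?m" unfolding c(2) by auto
  have Sv: "(S *\<^sub>v y) $ i = c i * y $ i" if "y \<in> carrier_vec ?m" "i < a" for y i
  proof -
    have "(S *\<^sub>v y) $ i = (\<Sum>j<?m. (if i = j then c i else 0) * y $ j)"
      using that unfolding c(2) by (simp add: scalar_prod_def atLeast0LessThan)
    also have "\<dots> = (\<Sum>j<?m. (if j = i then c i * y $ i else 0))" by (intro sum.cong) auto
    finally have "(S *\<^sub>v y) $ i = \<dots>" .
    then show ?thesis using that by simp
  qed
  have AS: "A *\<^sub>v (\<beta> *\<^sub>v y) = \<alpha>' *\<^sub>v (S *\<^sub>v y)" if y: "y \<in> carrier_vec ?m" for y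
  proof -
    have "\<alpha>' * S = A * \<beta>"
      unfolding S[symmetric] using A al be(1)
      by (simp add: assoc_mult_mat[of _ a a _ ?m _ ?m] assoc_mult_mat[of \<alpha>' a a \<alpha> a "A * \<beta>" ?m, symmetric])
    then have "\<alpha>' *\<^sub>v (S *\<^sub>v y) = (A * \<beta>) *\<^sub>v y" using al(2) Sc y by (simp flip: assoc_mult_mat_vec)
    then show ?thesis using A be(1) y by simp
  qed
  have SA: "S *\<^sub>v (\<beta>' *\<^sub>v w) = \<alpha> *\<^sub>v (A *\<^sub>v w)" if w: "w \<in> carrier_vec ?m" for w
  proof -
    have "S * \<beta>' = \<alpha> * A"
      unfolding S[symmetric] using A al(1) be
      by (simp add: assoc_mult_mat[of _ a a _ ?m _ ?m] assoc_mult_mat[of _ a ?m _ ?m _ ?m])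
    then have "S *\<^sub>v (\<beta>' *\<^sub>v w) = (\<alpha> * A) *\<^sub>v w" using be(2) Sc w by (simp flip: assoc_mult_mat_vec)
    then show ?thesis using A al(1) w by simp
  qed
  \<comment> \<open>Kernel vectors of the diagonal matrix \<open>S\<close> start with \<open>a\<close> zeros.\<close>
  define pad where "pad = (\<lambda>c :: int vec. vec ?m (\<lambda>i. if i < a then 0 else c $ (i - a)))"
  define G where "G = mat b ?m (\<lambda>(i, j). \<beta> $$ (j, a + i))"
  have G: "G \<in> carrier_mat b ?m" unfolding G_def by auto
  have pad: "pad c \<in> carrier_vec ?m" for c unfolding pad_def by auto
  have Gpad: "G\<^sup>T *\<^sub>v c = \<beta> *\<^sub>v pad c" if "c \<in> carrier_vec b" for c
  proof (rule eq_vecI)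
    fix i assume "i < dim_vec (\<beta> *\<^sub>v pad c)"
    then have i: "i < ?m" using be by simp
    have "(\<beta> *\<^sub>v pad c) $ i = (\<Sum>j<a + b. \<beta> $$ (i, j) * (if j < a then 0 else c $ (j - a)))"
      using i be unfolding pad_def by (auto simp: scalar_prod_def atLeast0LessThan intro!: sum.cong)
    also have "\<dots> = (\<Sum>j<b. \<beta> $$ (i, a + j) * c $ j)"
      unfolding lessThan_atLeast0 sum.atLeastLessThan_concat[of 0 a "a + b", symmetric, simplified]
      using sum.shift_bounds_nat_ivl[of "\<lambda>j. \<beta> $$ (i, j) * (if j < a then 0 else c $ (j - a))" 0 a b]
      by (simp add: add.commute)
    also have "\<dots> = (G\<^sup>T *\<^sub>v c) $ i"
      using i that unfolding G_def by (auto simp: scalar_prod_def atLeast0LessThan intro!: sum.cong)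
    finally show "(G\<^sup>T *\<^sub>v c) $ i = (\<beta> *\<^sub>v pad c) $ i" ..
  qed (use G be in auto)
  have bb: "\<beta>' *\<^sub>v (\<beta> *\<^sub>v y) = y" "\<beta> *\<^sub>v (\<beta>' *\<^sub>v y) = y" if "y \<in> carrier_vec ?m" for y
    using assoc_mult_mat_vec[OF be(2,1) that] assoc_mult_mat_vec[OF be(1,2) that]
    unfolding be(3,4) one_mult_mat_vec[OF that] by simp_all
  have "row_independent G" unfolding row_independent_def
  proof (intro ballI impI)
    fix e assume e: "e \<in> carrier_vec (dim_row G)" "G\<^sup>T *\<^sub>v e = 0\<^sub>v (dim_col G)"
    then have "\<beta> *\<^sub>v pad e = 0\<^sub>v ?m" using Gpad G by simp
    then have "pad e = \<beta>' *\<^sub>v 0\<^sub>v ?m" using bb(1)[OF pad, of e] by simp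
    also have "\<dots> = 0\<^sub>v ?m" using be by auto
    finally have p0: "pad e = 0\<^sub>v ?m" .
    have "e $ i = 0" if "i < b" for i
      using arg_cong[OF p0, of "\<lambda>v. v $ (a + i)"] that unfolding pad_def by simp
    then show "e = 0\<^sub>v (dim_row G)" using e G by auto
  qed
  moreover have "row_lattice G = mat_kernel A"
  proof (intro equalityI subsetI)
    fix w assume "w \<in> row_lattice G"
    then obtain e where e: "e \<in> carrier_vec b" "w = \<beta> *\<^sub>v pad e"
      using G Gpad unfolding row_lattice_eq by auto
    have "S *\<^sub>v pad e = 0\<^sub>v a"
      using Sc Sv[OF pad] by (intro eq_vecI) (auto simp: pad_def)
    then have "A *\<^sub>v w = 0\<^sub>v a" using AS[OF pad, of e] e al mult_mat_zero_vec[of \<alpha>'] by simp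
    moreover have "w \<in> carrier_vec ?m" unfolding e(2) using be pad by (intro mult_mat_vec_carrier) auto
    ultimately show "w \<in> mat_kernel A" using mat_kernel_eq[OF A] by simp
  next
    fix w assume "w \<in> mat_kernel A"
    then have w: "w \<in> carrier_vec ?m" "A *\<^sub>v w = 0\<^sub>v a" using mat_kernel_eq[OF A] by auto
    define y where "y = \<beta>' *\<^sub>v w"
    have y: "y \<in> carrier_vec ?m" unfolding y_def using be w by (intro mult_mat_vec_carrier) auto
    have S0: "S *\<^sub>v y = 0\<^sub>v a" unfolding y_def SA[OF w(1)] w(2) using al mult_mat_zero_vec[of \<alpha>] by simp
    have y0: "y $ i = 0" if "i < a" for i using Sv[OF y that] c(1) that unfolding S0 by fastforce
    define e where "e = vec b (\<lambda>i. y $ (a + i))"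
    have "y = pad e" using y y0 unfolding pad_def e_def by (intro eq_vecI) auto
    then have "w = \<beta> *\<^sub>v pad e" using bb(2)[OF w(1)] unfolding y_def by simp
    moreover have "e \<in> carrier_vec b" unfolding e_def by simp
    ultimately show "w \<in> row_lattice G" using Gpad[of e] row_latticeI[of e G] G by simp
  qed
  ultimately show ?thesis unfolding is_gale_dual_iff using A ind G by blast
qed

text \<open>A vector \<open>w\<close> killed by \<open>G\<close> is orthogonal to the kernel of \<open>A\<close>, in particular to \<open>z - X A z\<close> for
every \<open>z\<close>. Hence \<open>w \<bullet> z = (A\<^sup>T X\<^sup>T w) \<bullet> z\<close> for every \<open>z\<close>, which exhibits \<open>w\<close> as a combination of the
rows of \<open>A\<close>.\<close>

lemma gale_dual_symmetric:
  assumes dual: "is_gale_dual a b A G" and X: "X \<in> carrier_mat (a + b) a" "A * X = 1\<^sub>m a"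
  shows "is_gale_dual b a G A"
proof -
  let ?m = "a + b"
  have A: "A \<in> carrier_mat a ?m" "row_independent A" and G: "G \<in> carrier_mat b ?m" "row_independent G"
    and ker: "row_lattice G = mat_kernel A" using dual unfolding is_gale_dual_iff by auto
  have adj: "u \<bullet> (G *\<^sub>v w) = (G\<^sup>T *\<^sub>v u) \<bullet> w" if "u \<in> carrier_vec b" "w \<in> carrier_vec ?m" for u w
    using transpose_vec_mult_scalar[OF G(1), of w u] that by simp
  have adjA: "u \<bullet> (A *\<^sub>v w) = (A\<^sup>T *\<^sub>v u) \<bullet> w" if "u \<in> carrier_vec a" "w \<in> carrier_vec ?m" for u w
    using transpose_vec_mult_scalar[OF A(1), of w u] that by simp
  have "row_lattice A = mat_kernel G"
  proof (intro equalityI subsetI)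
    fix v assume "v \<in> row_lattice A"
    then obtain c where c: "c \<in> carrier_vec a" "v = A\<^sup>T *\<^sub>v c" using A unfolding row_lattice_eq by auto
    have v: "v \<in> carrier_vec ?m" using c A by (auto intro!: mult_mat_vec_carrier[of _ _ a])
    have "G *\<^sub>v v = 0\<^sub>v b"
    proof (rule vec_eq_if_scalar_prod_eq[of _ b])
      fix u :: "int vec" assume u: "u \<in> carrier_vec b"
      have Gu: "G\<^sup>T *\<^sub>v u \<in> carrier_vec ?m" using G u by (auto intro!: mult_mat_vec_carrier[of _ _ b])
      then have "A *\<^sub>v (G\<^sup>T *\<^sub>v u) = 0\<^sub>v a"
        using ker G(1) u mat_kernel_eq[OF A(1)] unfolding row_lattice_eq by auto
      then have "(G\<^sup>T *\<^sub>v u) \<bullet> v = 0"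
        using adjA[OF c(1) Gu] c Gu v comm_scalar_prod[OF v Gu] by simp
      then show "(G *\<^sub>v v) \<bullet> u = 0\<^sub>v b \<bullet> u"
        using adj[OF u v] u v G comm_scalar_prod[OF mult_mat_vec_carrier[OF G(1) v] u] by simp
    qed (use G v in \<open>auto intro!: mult_mat_vec_carrier[of _ _ ?m]\<close>)
    then show "v \<in> mat_kernel G" using v mat_kernel_eq[OF G(1)] by simp
  next
    fix w assume "w \<in> mat_kernel G"
    then have w: "w \<in> carrier_vec ?m" "G *\<^sub>v w = 0\<^sub>v b" using mat_kernel_eq[OF G(1)] by auto
    define e where "e = X\<^sup>T *\<^sub>v w"
    have e: "e \<in> carrier_vec a" unfolding e_def using X w by (intro mult_mat_vec_carrier[of _ _ ?m]) auto
    have Ae: "A\<^sup>T *\<^sub>v e \<in> carrier_vec ?m" using A e by (intro mult_mat_vec_carrier[of _ _ a]) auto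
    have "w = A\<^sup>T *\<^sub>v e"
    proof (rule vec_eq_if_scalar_prod_eq[OF w(1) Ae])
      fix z :: "int vec" assume z: "z \<in> carrier_vec ?m"
      have Az: "A *\<^sub>v z \<in> carrier_vec a" using A z by (intro mult_mat_vec_carrier[of _ _ ?m]) auto
      have XAz: "X *\<^sub>v (A *\<^sub>v z) \<in> carrier_vec ?m" by (rule mult_mat_vec_carrier[OF X(1) Az])
      define z' where "z' = z - X *\<^sub>v (A *\<^sub>v z)"
      have z': "z' \<in> carrier_vec ?m" unfolding z'_def using z XAz by auto
      have "A *\<^sub>v z' = A *\<^sub>v z - A *\<^sub>v (X *\<^sub>v (A *\<^sub>v z))"
        unfolding z'_def using A(1) z XAz by (intro mult_minus_distrib_mat_vec[of _ a ?m]) auto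
      also have "A *\<^sub>v (X *\<^sub>v (A *\<^sub>v z)) = A *\<^sub>v z"
        using assoc_mult_mat_vec[OF A(1) X(1) Az] unfolding X(2) one_mult_mat_vec[OF Az] ..
      finally have "z' \<in> row_lattice G" unfolding ker using z' Az mat_kernel_eq[OF A(1)] by simp
      then obtain u where u: "u \<in> carrier_vec b" "z' = G\<^sup>T *\<^sub>v u" using G unfolding row_lattice_eq by auto
      have "z' \<bullet> w = 0" unfolding u(2) using adj[OF u(1) w(1)] u w(2) by simp
      then have "z \<bullet> w = (X *\<^sub>v (A *\<^sub>v z)) \<bullet> w"
        unfolding z'_def using z XAz w by (simp add: minus_scalar_prod_distrib[of _ ?m])
      also have "\<dots> = w \<bullet> (X *\<^sub>v (A *\<^sub>v z))" using XAz w by (simp add: comm_scalar_prod[of _ ?m])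
      also have "\<dots> = e \<bullet> (A *\<^sub>v z)"
        unfolding e_def using transpose_vec_mult_scalar[OF X(1) Az w(1)] by simp
      also have "\<dots> = (A\<^sup>T *\<^sub>v e) \<bullet> z" by (rule adjA[OF e z])
      finally show "w \<bullet> z = (A\<^sup>T *\<^sub>v e) \<bullet> z" using w z by (simp add: comm_scalar_prod[of _ ?m])
    qed
    then show "w \<in> row_lattice A" using A e unfolding row_lattice_eq by auto
  qed
  then show ?thesis unfolding is_gale_dual_iff using A G by (simp add: add.commute)
qed

lemma gale_dual_right_inverse:
  assumes "is_gale_dual a b A G"
  shows "\<exists>Y\<in>carrier_mat (a + b) b. G * Y = 1\<^sub>m b"
  using assms saturation_mat_kernel[of A a "a + b"] right_inverse_iff[of G b "a + b"]
  unfolding is_gale_dual_iff by auto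

section \<open>Torsion after deleting a column\<close>
lemma transpose_mult_vec:
  fixes M N :: "'a :: comm_ring_1 mat"
  assumes "M \<in> carrier_mat a b" "N \<in> carrier_mat b c" "x \<in> carrier_vec a"
  shows "(M * N)\<^sup>T *\<^sub>v x = N\<^sup>T *\<^sub>v (M\<^sup>T *\<^sub>v x)"
proof -
  have "N\<^sup>T \<in> carrier_mat c b" "M\<^sup>T \<in> carrier_mat b a" using assms by auto
  then show ?thesis unfolding transpose_mult[OF assms(1,2)] using assms(3) by (rule assoc_mult_mat_vec)
qed

lemma transpose_diagonal_mult:
  assumes "z \<in> carrier_vec p" "j < q"
  shows "((mat p q (\<lambda>(i, j). if i = j then c i else 0))\<^sup>T *\<^sub>v z) $ j =
    (if j < p then c j * z $ j else (0 :: int))"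
proof -
  have "((mat p q (\<lambda>(i, j). if i = j then c i else 0))\<^sup>T *\<^sub>v z) $ j =
    (\<Sum>i<p. (if i = j then c i else 0) * z $ i)"
    using assms by (simp add: scalar_prod_def atLeast0LessThan)
  also have "\<dots> = (\<Sum>i<p. if i = j then c j * z $ j else 0)" by (intro sum.cong) auto
  finally show ?thesis by simp
qed

text \<open>In the coordinates \<open>\<beta>\<^sup>T w\<close> the row lattice is the product of the ideals \<open>c k \<int>\<close>, followed by zeros.\<close>

lemma row_lattice_smith:
  assumes sm: "smith_transformation p q A \<alpha> \<beta> (mat p q (\<lambda>(i, j). if i = j then c i else 0))"
    and pq: "p \<le> q" and w: "w \<in> carrier_vec q"
  shows "w \<in> row_lattice A \<longleftrightarrow>
    (\<forall>k<q. if k < p then c k dvd (\<beta>\<^sup>T *\<^sub>v w) $ k else (\<beta>\<^sup>T *\<^sub>v w) $ k = 0)"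
proof -
  define S where "S = mat p q (\<lambda>(i, j). if i = j then c i else 0)"
  have A: "A \<in> carrier_mat p q" and u: "unimodular p \<alpha>" "unimodular q \<beta>" and S: "\<alpha> * A * \<beta> = S"
    using sm unfolding smith_transformation_def S_def by auto
  obtain \<alpha>' where al: "\<alpha> \<in> carrier_mat p p" "\<alpha>' \<in> carrier_mat p p" "\<alpha> * \<alpha>' = 1\<^sub>m p" "\<alpha>' * \<alpha> = 1\<^sub>m p"
    using u(1) by (rule unimodularE)
  obtain \<beta>' where be: "\<beta> \<in> carrier_mat q q" "\<beta>' \<in> carrier_mat q q" "\<beta> * \<beta>' = 1\<^sub>m q"
    using u(2) by (rule unimodularE)
  have Sc: "S \<in> carrier_mat p q" unfolding S_def by auto
  have Ab: "A * \<beta> = \<alpha>' * S"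
    unfolding S[symmetric] using A al be
    by (simp add: assoc_mult_mat[of _ p p _ q _ q] assoc_mult_mat[of \<alpha>' p p \<alpha> p "A * \<beta>" q, symmetric])
  have AbT: "\<beta>\<^sup>T *\<^sub>v (A\<^sup>T *\<^sub>v e) = S\<^sup>T *\<^sub>v (\<alpha>'\<^sup>T *\<^sub>v e)" if "e \<in> carrier_vec p" for e
    using transpose_mult_vec[OF A be(1) that] transpose_mult_vec[OF al(2) Sc that] unfolding Ab by simp
  have bbT: "\<beta>'\<^sup>T *\<^sub>v (\<beta>\<^sup>T *\<^sub>v y) = y" if "y \<in> carrier_vec q" for y
    using transpose_mult_vec[OF be(1,2) that] that unfolding be(3) by simp
  show ?thesis
  proof
    assume "w \<in> row_lattice A"
    then obtain e where e: "e \<in> carrier_vec p" "w = A\<^sup>T *\<^sub>v e" using A by (rule row_latticeE)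
    have a: "\<alpha>'\<^sup>T *\<^sub>v e \<in> carrier_vec p" using al e by (intro mult_mat_vec_carrier[of _ p p]) auto
    show "\<forall>k<q. if k < p then c k dvd (\<beta>\<^sup>T *\<^sub>v w) $ k else (\<beta>\<^sup>T *\<^sub>v w) $ k = 0"
      unfolding e(2) AbT[OF e(1)] S_def using transpose_diagonal_mult[OF a] by auto
  next
    assume H: "\<forall>k<q. if k < p then c k dvd (\<beta>\<^sup>T *\<^sub>v w) $ k else (\<beta>\<^sup>T *\<^sub>v w) $ k = 0"
    define z where "z = vec p (\<lambda>k. (\<beta>\<^sup>T *\<^sub>v w) $ k div c k)"
    have z: "z \<in> carrier_vec p" unfolding z_def by simp
    have Sz: "S\<^sup>T *\<^sub>v z = \<beta>\<^sup>T *\<^sub>v w"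
    proof (rule eq_vecI)
      fix k assume "k < dim_vec (\<beta>\<^sup>T *\<^sub>v w)"
      then have k: "k < q" using be by simp
      show "(S\<^sup>T *\<^sub>v z) $ k = (\<beta>\<^sup>T *\<^sub>v w) $ k"
        unfolding S_def transpose_diagonal_mult[OF z k] using H k by (auto simp: z_def)
    qed (use Sc be in simp)
    define e where "e = \<alpha>\<^sup>T *\<^sub>v z"
    have e: "e \<in> carrier_vec p" unfolding e_def using al z by (intro mult_mat_vec_carrier[of _ p p]) auto
    have "\<alpha>'\<^sup>T *\<^sub>v e = z"
      unfolding e_def using transpose_mult_vec[OF al(1,2) z] z unfolding al(3) by simp
    then have "\<beta>\<^sup>T *\<^sub>v (A\<^sup>T *\<^sub>v e) = \<beta>\<^sup>T *\<^sub>v w" using AbT[OF e] Sz by simp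
    moreover have "A\<^sup>T *\<^sub>v e \<in> carrier_vec q" using A e by (intro mult_mat_vec_carrier[of _ q p]) auto
    ultimately have "A\<^sup>T *\<^sub>v e = w" using bbT w by metis
    then show "w \<in> row_lattice A" using row_latticeI[of e A] e A by auto
  qed
qed

text \<open>The torsion subgroup is the product of the groups \<open>\<int> / c k\<close>, generated by the classes of the rows
\<open>g k\<close> of the inverse of \<open>\<beta>\<close>. Let it be cyclic of order \<open>d\<close>, generated by the class of \<open>x\<close>. Its exponent
is \<open>c (p - 1)\<close>, because the \<open>c k\<close> form a chain of divisors; so \<open>c (p - 1) = d\<close>, and already
\<open>g (p - 1)\<close> generates. Every other \<open>g k\<close> is then a multiple of \<open>g (p - 1)\<close> modulo the lattice, and
comparing the \<open>k\<close>-th coordinates gives that \<open>c k\<close> divides \<open>1\<close>.\<close>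

lemma smith_form_of_cyclic_torsion:
  assumes sm: "smith_transformation p q A \<alpha> \<beta> (mat p q (\<lambda>(i, j). if i = j then c i else 0))"
    and pq: "p \<le> q" and p: "0 < p"
    and pos: "\<forall>i<p. 0 < c i" and chain: "\<forall>i. Suc i < p \<longrightarrow> c i dvd c (Suc i)"
    and d: "0 < d" and x: "x \<in> carrier_vec q"
    and order: "\<And>a. a \<cdot>\<^sub>v x \<in> row_lattice A \<longleftrightarrow> d dvd a"
    and gen: "\<And>w. w \<in> saturation q (row_lattice A) \<Longrightarrow> \<exists>a. w - a \<cdot>\<^sub>v x \<in> row_lattice A"
  shows "c (p - 1) = d" "\<And>k. k < p - 1 \<Longrightarrow> c k = 1"
proof -
  let ?L = "row_lattice A"
  have A: "A \<in> carrier_mat p q" and u: "unimodular q \<beta>"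
    using sm unfolding smith_transformation_def by auto
  obtain \<beta>' where be: "\<beta> \<in> carrier_mat q q" "\<beta>' \<in> carrier_mat q q" "\<beta>' * \<beta> = 1\<^sub>m q"
    using u by (rule unimodularE)
  note L = subgroup_vec_groupD[OF subgroup_row_lattice[OF A]]
  note mem = row_lattice_smith[OF sm pq]
  define g where "g = (\<lambda>k. \<beta>'\<^sup>T *\<^sub>v unit_vec q k)"
  have g: "g k \<in> carrier_vec q" for k unfolding g_def using be by (intro mult_mat_vec_carrier[of _ q q]) auto
  have bg: "\<beta>\<^sup>T *\<^sub>v g k = unit_vec q k" for k
    unfolding g_def using transpose_mult_vec[OF be(2,1), of "unit_vec q k"] unfolding be(3) by simp
  have g_mem: "a \<cdot>\<^sub>v g k \<in> ?L \<longleftrightarrow> c k dvd a" if k: "k < p" for a k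
    using mem[of "a \<cdot>\<^sub>v g k"] g[of k] be k pq bg[of k] by (auto simp: mult_mat_smult_vec)
  have sat: "g k \<in> saturation q ?L" if "k < p" for k
    using g_mem[OF that, of "c k"] g pos that unfolding saturation_def by auto
  define C where "C = c (p - 1)"
  have C: "0 < C" using pos p unfolding C_def by simp
  have chain': "c k dvd C" if "k < p" for k
  proof -
    have "c k dvd c (k + j)" if "k + j < p" for j
      using that
    proof (induction j)
      case (Suc j)
      then have "c k dvd c (k + j)" "c (k + j) dvd c (Suc (k + j))" using chain by auto
      then show ?case by (auto intro: dvd_trans)
    qed simp
    from this[of "p - 1 - k"] show ?thesis using \<open>k < p\<close> unfolding C_def by simp
  qed
  have smult: "(\<beta>\<^sup>T *\<^sub>v (a \<cdot>\<^sub>v v)) $ k = a * (\<beta>\<^sup>T *\<^sub>v v) $ k" if "v \<in> carrier_vec q" "k < q" for a v k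
    using that be(1) mult_mat_smult_vec[of v "\<beta>\<^sup>T" a] by simp
  have "d dvd C"
  proof -
    have mem_x: "a \<cdot>\<^sub>v x \<in> ?L \<longleftrightarrow>
      (\<forall>k<q. if k < p then c k dvd a * (\<beta>\<^sup>T *\<^sub>v x) $ k else a * (\<beta>\<^sup>T *\<^sub>v x) $ k = 0)" for a
      unfolding mem[OF smult_carrier_vec[THEN iffD2, OF x]]
      by (intro all_cong) (simp only: smult[OF x])
    have "d \<cdot>\<^sub>v x \<in> ?L" using order by simp
    then have "(\<beta>\<^sup>T *\<^sub>v x) $ k = 0" if "\<not> k < p" "k < q" for k
      using that d unfolding mem_x by auto
    then have "C \<cdot>\<^sub>v x \<in> ?L" unfolding mem_x using chain' by simp
    then show ?thesis using order by simp
  qed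
  obtain a where a: "g (p - 1) - a \<cdot>\<^sub>v x \<in> ?L" using gen[OF sat, of "p - 1"] p by auto
  have shift: "b \<cdot>\<^sub>v g (p - 1) \<in> ?L" if "d dvd b * a" for b
  proof -
    have "b \<cdot>\<^sub>v (g (p - 1) - a \<cdot>\<^sub>v x) + (b * a) \<cdot>\<^sub>v x \<in> ?L" using L(3,6) a order that by blast
    moreover have "b \<cdot>\<^sub>v (g (p - 1) - a \<cdot>\<^sub>v x) + (b * a) \<cdot>\<^sub>v x = b \<cdot>\<^sub>v g (p - 1)"
      using g[of "p - 1"] x by (intro eq_vecI) (auto simp: algebra_simps)
    ultimately show ?thesis by simp
  qed
  have "C dvd d" using shift[of d] g_mem[of "p - 1" d] p unfolding C_def by simp
  then have Cd: "C = d" using \<open>d dvd C\<close> C d by (simp add: zdvd_antisym_nonneg)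
  then show "c (p - 1) = d" unfolding C_def .
  \<comment> \<open>If \<open>h\<close> divides \<open>a\<close> and \<open>d\<close>, then already \<open>d / h\<close> annihilates the class of \<open>g (p - 1)\<close>, which has order \<open>d\<close>.\<close>
  have cop: "coprime a d"
  proof -
    define h where "h = gcd a d"
    have h: "h dvd a" "h dvd d" "0 < h" unfolding h_def using d by auto
    obtain a' where a': "a = h * a'" using h(1) by (rule dvdE)
    obtain d' where d': "d = h * d'" using h(2) by (rule dvdE)
    have "d dvd d' * a" unfolding a' d' by simp
    then have "c (p - 1) dvd d'" using shift[of d'] g_mem[of "p - 1" d'] p by simp
    then have "h * d' dvd d'" using Cd d' unfolding C_def by simp
    moreover have "d' \<noteq> 0" using d d' by auto
    ultimately have "h dvd 1" by (metis dvd_times_right_cancel_iff mult_1)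
    then show ?thesis using h(3) unfolding h_def coprime_iff_gcd_eq_1 by simp
  qed
  \<comment> \<open>\<open>e\<close> is an inverse of \<open>a\<close> modulo \<open>d\<close>.\<close>
  obtain e v where "e * a + v * d = gcd a d" using bezout_int by blast
  then have "e * a - 1 = d * (- v)" using cop by (simp add: algebra_simps)
  then have e: "d dvd e * a - 1" by (rule dvdI)
  fix k assume k: "k < p - 1"
  then have kp: "k < p" by simp
  obtain b where b: "g k - b \<cdot>\<^sub>v x \<in> ?L" using gen[OF sat[OF kp]] by blast
  have "(g k - b \<cdot>\<^sub>v x) - (b * e) \<cdot>\<^sub>v (g (p - 1) - a \<cdot>\<^sub>v x) - (b * (e * a - 1)) \<cdot>\<^sub>v x \<in> ?L"
    using L(5,6) a b order e by (meson dvd_mult)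
  moreover have "(g k - b \<cdot>\<^sub>v x) - (b * e) \<cdot>\<^sub>v (g (p - 1) - a \<cdot>\<^sub>v x) - (b * (e * a - 1)) \<cdot>\<^sub>v x =
    g k - (b * e) \<cdot>\<^sub>v g (p - 1)"
    using g[of k] g[of "p - 1"] x by (intro eq_vecI) (auto simp: algebra_simps)
  ultimately have z_mem: "g k - (b * e) \<cdot>\<^sub>v g (p - 1) \<in> ?L" by simp
  have bz: "\<beta>\<^sup>T *\<^sub>v (g k - (b * e) \<cdot>\<^sub>v g (p - 1)) = unit_vec q k - (b * e) \<cdot>\<^sub>v unit_vec q (p - 1)"
    using mult_minus_distrib_mat_vec[of "\<beta>\<^sup>T" q q "g k" "(b * e) \<cdot>\<^sub>v g (p - 1)"] g be bg
    by (simp add: mult_mat_smult_vec)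
  have "g k - (b * e) \<cdot>\<^sub>v g (p - 1) \<in> carrier_vec q" using g by auto
  from mem[THEN iffD1, OF this z_mem] have "c k dvd (unit_vec q k - (b * e) \<cdot>\<^sub>v unit_vec q (p - 1)) $ k"
    unfolding bz using kp pq by (metis less_le_trans)
  then have "c k dvd 1" using k pq by simp
  moreover have "0 < c k" using pos kp by blast
  ultimately show "c k = 1" by simp
qed

definition delete_entry :: "nat \<Rightarrow> 'a vec \<Rightarrow> 'a vec" where
  "delete_entry i w = vec (dim_vec w - 1) (\<lambda>j. w $ (if j < i then j else Suc j))"

definition insert_entry :: "nat \<Rightarrow> 'a \<Rightarrow> 'a vec \<Rightarrow> 'a vec" where
  "insert_entry i t w =
     vec (Suc (dim_vec w)) (\<lambda>j. if j < i then w $ j else if j = i then t else w $ (j - 1))"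

lemma delete_entry_carrier: "w \<in> carrier_vec (Suc q) \<Longrightarrow> delete_entry i w \<in> carrier_vec q"
  by (auto simp: delete_entry_def)

lemma insert_entry_carrier: "w \<in> carrier_vec q \<Longrightarrow> insert_entry i t w \<in> carrier_vec (Suc q)"
  by (auto simp: insert_entry_def)

lemma delete_insert_entry: "i \<le> dim_vec w \<Longrightarrow> delete_entry i (insert_entry i t w) = w"
  by (intro eq_vecI) (auto simp: delete_entry_def insert_entry_def)

lemma insert_delete_entry: "i < dim_vec w \<Longrightarrow> insert_entry i (w $ i) (delete_entry i w) = w"
  by (intro eq_vecI) (auto simp: delete_entry_def insert_entry_def)

lemma delete_col_mult:
  assumes "A \<in> carrier_mat p (Suc q)" "c \<in> carrier_vec p"
  shows "(delete_col i A)\<^sup>T *\<^sub>v c = delete_entry i (A\<^sup>T *\<^sub>v c)"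
proof (rule eq_vecI)
  fix j assume "j < dim_vec (delete_entry i (A\<^sup>T *\<^sub>v c))"
  then have j: "j < q" using assms by (simp add: delete_entry_def)
  then show "((delete_col i A)\<^sup>T *\<^sub>v c) $ j = delete_entry i (A\<^sup>T *\<^sub>v c) $ j"
    using assms by (simp add: delete_entry_def delete_col_def scalar_prod_def)
qed (use assms in \<open>simp add: delete_entry_def delete_col_def\<close>)

lemma delete_col_carrier: "A \<in> carrier_mat p (Suc q) \<Longrightarrow> delete_col i A \<in> carrier_mat p q"
  by (simp add: delete_col_def)

lemma row_lattice_delete_col:
  assumes A: "A \<in> carrier_mat p (Suc q)"
  shows "row_lattice (delete_col i A) = delete_entry i ` row_lattice A"
proof -
  have p: "dim_row (delete_col i A) = p" "dim_row A = p" using A by (simp_all add: delete_col_def)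
  have "row_lattice (delete_col i A) = (\<lambda>c. (delete_col i A)\<^sup>T *\<^sub>v c) ` carrier_vec p"
    unfolding row_lattice_eq p by blast
  also have "\<dots> = (\<lambda>c. delete_entry i (A\<^sup>T *\<^sub>v c)) ` carrier_vec p"
    using delete_col_mult[OF A] by (intro image_cong) auto
  also have "\<dots> = delete_entry i ` row_lattice A"
    unfolding row_lattice_eq p by blast
  finally show ?thesis .
qed

lemma col_gcd_dvd: "l < dim_row V \<Longrightarrow> i < dim_col V \<Longrightarrow> col_gcd V i dvd V $$ (l, i)"
  unfolding col_gcd_def by (rule Gcd_dvd) (auto simp: vec_set_def)

lemma dvd_mult_col_gcdI:
  assumes "\<And>l. l < dim_row V \<Longrightarrow> k dvd t * V $$ (l, i)" "i < dim_col V"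
  shows "k dvd t * col_gcd V i"
proof -
  have "k dvd Gcd ((*) t ` set\<^sub>v (col V i))"
    by (rule Gcd_greatest) (use assms in \<open>auto simp: vec_set_def\<close>)
  then show ?thesis unfolding Gcd_mult col_gcd_def by simp
qed

lemma col_gcd_pos:
  assumes "col V i \<noteq> 0\<^sub>v (dim_row V)" "i < dim_col V"
  shows "0 < col_gcd V i"
proof -
  have "col_gcd V i \<noteq> 0"
  proof
    assume "col_gcd V i = 0"
    then have "V $$ (l, i) = 0" if "l < dim_row V" for l using col_gcd_dvd[OF that assms(2)] by simp
    then have "col V i = 0\<^sub>v (dim_row V)" using assms(2) by (intro eq_vecI) auto
    then show False using assms(1) by simp
  qed
  moreover have "0 \<le> col_gcd V i" unfolding col_gcd_def by simp
  ultimately show ?thesis by simp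
qed

lemma insert_entry_mult:
  fixes V :: "int mat"
  assumes V: "V \<in> carrier_mat n (Suc q)" and w: "w \<in> carrier_vec q" and i: "i < Suc q"
  shows "V *\<^sub>v insert_entry i t w = V *\<^sub>v insert_entry i 0 w + t \<cdot>\<^sub>v col V i"
proof -
  have "insert_entry i t w = insert_entry i 0 w + t \<cdot>\<^sub>v unit_vec (Suc q) i"
    using w i by (intro eq_vecI) (auto simp: insert_entry_def)
  then have "V *\<^sub>v insert_entry i t w = V *\<^sub>v insert_entry i 0 w + V *\<^sub>v (t \<cdot>\<^sub>v unit_vec (Suc q) i)"
    using mult_add_distrib_mat_vec[OF V insert_entry_carrier[OF w]] by simp
  also have "V *\<^sub>v (t \<cdot>\<^sub>v unit_vec (Suc q) i) = t \<cdot>\<^sub>v col V i"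
    using V i mult_mat_unit_vec[of i V] by (simp add: mult_mat_smult_vec)
  finally show ?thesis .
qed

text \<open>Let \<open>v = d u\<close> be the \<open>i\<close>-th column of \<open>V\<close>, \<open>d\<close> its gcd, and let \<open>F w\<close> be the combination of the
other columns with coefficients \<open>w\<close>. As the row lattice of \<open>Q\<close> is the kernel of \<open>V\<close>, a vector \<open>w\<close>
lies in the lattice \<open>L\<close> of the remaining columns iff \<open>F w\<close> is an integral multiple of \<open>d u\<close>, and a
positive multiple of \<open>w\<close> can lie in \<open>L\<close> only if \<open>F w\<close> is an integral multiple of \<open>u\<close>, because \<open>u\<close> is
primitive. The columns of \<open>V\<close> generate \<open>\<int>\<^sup>n\<close>, so \<open>u = V y\<close> for some \<open>y\<close>; dropping its \<open>i\<close>-th entry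
gives \<open>x\<close> with \<open>F x = (1 - d y\<^sub>i) u\<close>. The coefficient is \<open>1\<close> modulo \<open>d\<close>, so that the class of \<open>x\<close>
has order \<open>d\<close> and generates the torsion.\<close>

lemma delete_col_torsion_generator:
  assumes V: "V \<in> carrier_mat n (Suc q)" and Y: "Y \<in> carrier_mat (Suc q) n" "V * Y = 1\<^sub>m n"
    and Q: "Q \<in> carrier_mat r (Suc q)" and ker: "row_lattice Q = mat_kernel V"
    and i: "i < Suc q" and nz: "col V i \<noteq> 0\<^sub>v n"
  defines "L \<equiv> row_lattice (delete_col i Q)"
  shows "\<exists>x\<in>carrier_vec q. (\<forall>a. a \<cdot>\<^sub>v x \<in> L \<longleftrightarrow> col_gcd V i dvd a) \<and>
    (\<forall>w\<in>saturation q L. \<exists>a. w - a \<cdot>\<^sub>v x \<in> L)"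
proof -
  define d where "d = col_gcd V i"
  have d: "0 < d" unfolding d_def using col_gcd_pos[of V i] nz V i by simp
  define u where "u = vec n (\<lambda>l. V $$ (l, i) div d)"
  have u: "u \<in> carrier_vec n" unfolding u_def by simp
  have vu: "col V i = d \<cdot>\<^sub>v u"
    unfolding u_def using V i col_gcd_dvd[of _ V i] by (intro eq_vecI) (auto simp: d_def)
  have u_inj: "a = b" if "a \<cdot>\<^sub>v u = b \<cdot>\<^sub>v u" for a b
  proof -
    have "u \<noteq> 0\<^sub>v n" using nz unfolding vu by (auto simp: smult_vec_zero)
    then obtain l where l: "l < n" "u $ l \<noteq> 0" using u by (metis carrier_vecD eq_vecI index_zero_vec)
    have "a * u $ l = b * u $ l" using arg_cong[OF that, of "\<lambda>v. v $ l"] l u by simp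
    then show ?thesis using l by simp
  qed
  define F where "F = (\<lambda>w. V *\<^sub>v insert_entry i 0 w)"
  have Fc: "F w \<in> carrier_vec n" if "w \<in> carrier_vec q" for w
    unfolding F_def by (rule mult_mat_vec_carrier[OF V insert_entry_carrier[OF that]])
  have F_diff: "F (w - a \<cdot>\<^sub>v x) = F w - a \<cdot>\<^sub>v F x" if "w \<in> carrier_vec q" "x \<in> carrier_vec q" for w x a
  proof -
    have "insert_entry i 0 (w - a \<cdot>\<^sub>v x) = insert_entry i 0 w - a \<cdot>\<^sub>v insert_entry i 0 x"
      using that i by (intro eq_vecI) (auto simp: insert_entry_def)
    then show ?thesis unfolding F_def
      using mult_minus_distrib_mat_vec[OF V insert_entry_carrier[OF that(1)], of "a \<cdot>\<^sub>v insert_entry i 0 x" i 0]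
        insert_entry_carrier[OF that(2)] V by (simp add: mult_mat_smult_vec)
  qed
  have F_smult: "F (a \<cdot>\<^sub>v x) = a \<cdot>\<^sub>v F x" if "x \<in> carrier_vec q" for x a
  proof -
    have "insert_entry i 0 (a \<cdot>\<^sub>v x) = a \<cdot>\<^sub>v insert_entry i 0 x"
      using that i by (intro eq_vecI) (auto simp: insert_entry_def)
    then show ?thesis unfolding F_def using insert_entry_carrier[OF that] V by (simp add: mult_mat_smult_vec)
  qed
  have L_iff: "w \<in> L \<longleftrightarrow> (\<exists>t. F w = (t * d) \<cdot>\<^sub>v u)" if w: "w \<in> carrier_vec q" for w
  proof
    assume "w \<in> L"
    then obtain z where z: "z \<in> mat_kernel V" "w = delete_entry i z"
      unfolding L_def row_lattice_delete_col[OF Q] ker by blast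
    then have zc: "z \<in> carrier_vec (Suc q)" "V *\<^sub>v z = 0\<^sub>v n" using mat_kernel_eq[OF V] by auto
    have "z = insert_entry i (z $ i) w" unfolding z(2) using insert_delete_entry[of i z] zc i by simp
    then have "F w + z $ i \<cdot>\<^sub>v (d \<cdot>\<^sub>v u) = 0\<^sub>v n"
      using insert_entry_mult[OF V w i, of "z $ i"] zc(2) unfolding F_def vu by simp
    then have *: "(F w + z $ i \<cdot>\<^sub>v (d \<cdot>\<^sub>v u)) $ l = 0" if "l < n" for l using that by simp
    have "F w = (- z $ i * d) \<cdot>\<^sub>v u"
    proof (rule eq_vecI)
      fix l assume "l < dim_vec ((- z $ i * d) \<cdot>\<^sub>v u)"
      then have "l < n" using u by simp
      then show "F w $ l = ((- z $ i * d) \<cdot>\<^sub>v u) $ l" using *[of l] Fc[OF w] u by simp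
    qed (use Fc[OF w] u in simp)
    then show "\<exists>t. F w = (t * d) \<cdot>\<^sub>v u" by blast
  next
    assume "\<exists>t. F w = (t * d) \<cdot>\<^sub>v u"
    then obtain t where t: "F w = (t * d) \<cdot>\<^sub>v u" by blast
    have "V *\<^sub>v insert_entry i (- t) w = (t * d) \<cdot>\<^sub>v u + (- t) \<cdot>\<^sub>v (d \<cdot>\<^sub>v u)"
      using insert_entry_mult[OF V w i, of "- t"] t unfolding F_def vu by simp
    also have "\<dots> = 0\<^sub>v n" using u by (intro eq_vecI) auto
    finally have "insert_entry i (- t) w \<in> row_lattice Q"
      unfolding ker mat_kernel_eq[OF V] using insert_entry_carrier[OF w] by simp
    then show "w \<in> L" unfolding L_def row_lattice_delete_col[OF Q]
      using delete_insert_entry[of i w "- t"] w i by (metis carrier_vecD imageI less_Suc_eq_le)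
  qed
  have sat: "\<exists>a. F w = a \<cdot>\<^sub>v u" if w_sat: "w \<in> saturation q L" for w
  proof -
    obtain k where w: "w \<in> carrier_vec q" and k: "0 < k" "k \<cdot>\<^sub>v w \<in> L"
      using w_sat unfolding saturation_def by blast
    have "k \<cdot>\<^sub>v w \<in> carrier_vec q" using w by simp
    then obtain t where t: "k \<cdot>\<^sub>v F w = (t * d) \<cdot>\<^sub>v u" using L_iff[of "k \<cdot>\<^sub>v w"] k(2) F_smult[OF w] by auto
    have t': "k * F w $ l = t * d * u $ l" if "l < n" for l
      using arg_cong[OF t, of "\<lambda>v. v $ l"] that u Fc[OF w] by simp
    have "k dvd t * col_gcd V i"
    proof (rule dvd_mult_col_gcdI)
      fix l assume "l < dim_row V"
      then have l: "l < n" using V by simp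
      have "V $$ (l, i) = d * u $ l" using arg_cong[OF vu, of "\<lambda>v. v $ l"] l V i u by simp
      then have "k * F w $ l = t * V $$ (l, i)" using t'[OF l] by simp
      then show "k dvd t * V $$ (l, i)" by (metis dvd_triv_left)
    qed (use V i in simp)
    then obtain a where a: "t * d = k * a" unfolding d_def by (rule dvdE)
    have "F w = a \<cdot>\<^sub>v u"
    proof (rule eq_vecI)
      fix l assume "l < dim_vec (a \<cdot>\<^sub>v u)"
      then have l: "l < n" using u by simp
      then have "k * F w $ l = k * (a * u $ l)" using t'[OF l] unfolding a by simp
      then show "F w $ l = (a \<cdot>\<^sub>v u) $ l" using k l u by simp
    qed (use Fc[OF w] u in simp)
    then show ?thesis by blast
  qed
  define y where "y = Y *\<^sub>v u"
  have y: "y \<in> carrier_vec (Suc q)" unfolding y_def by (rule mult_mat_vec_carrier[OF Y(1) u])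
  have Vy: "V *\<^sub>v y = u" unfolding y_def using assoc_mult_mat_vec[OF V Y(1) u] u unfolding Y(2) by simp
  define x where "x = delete_entry i y"
  have x: "x \<in> carrier_vec q" unfolding x_def by (rule delete_entry_carrier[OF y])
  have Fx: "F x = (1 - y $ i * d) \<cdot>\<^sub>v u"
  proof -
    have "y = insert_entry i (y $ i) x" unfolding x_def using insert_delete_entry[of i y] y i by simp
    then have "F x + y $ i \<cdot>\<^sub>v (d \<cdot>\<^sub>v u) = u"
      using insert_entry_mult[OF V x i, of "y $ i"] Vy unfolding F_def vu by simp
    then have *: "(F x + y $ i \<cdot>\<^sub>v (d \<cdot>\<^sub>v u)) $ l = u $ l" for l by simp
    show ?thesis
    proof (rule eq_vecI)
      fix l assume "l < dim_vec ((1 - y $ i * d) \<cdot>\<^sub>v u)"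
      then have "l < n" using u by simp
      then show "F x $ l = ((1 - y $ i * d) \<cdot>\<^sub>v u) $ l" using *[of l] Fc[OF x] u by (simp add: algebra_simps)
    qed (use Fc[OF x] u in simp)
  qed
  have "a \<cdot>\<^sub>v x \<in> L \<longleftrightarrow> d dvd a" for a
  proof -
    have "a \<cdot>\<^sub>v x \<in> L \<longleftrightarrow> (\<exists>t. (a * (1 - y $ i * d)) \<cdot>\<^sub>v u = (t * d) \<cdot>\<^sub>v u)"
      using L_iff[of "a \<cdot>\<^sub>v x"] x F_smult[OF x, of a] Fx by (simp add: smult_smult_assoc)
    also have "\<dots> \<longleftrightarrow> (\<exists>t. a * (1 - y $ i * d) = t * d)"
      by (intro arg_cong[where f = Ex] ext iffI) (auto dest: u_inj)
    also have "\<dots> \<longleftrightarrow> d dvd a * (1 - y $ i * d)" unfolding dvd_def by (simp only: mult.commute[of d])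
    also have "a * (1 - y $ i * d) = a - d * (a * y $ i)" by (simp add: algebra_simps)
    also have "d dvd a - d * (a * y $ i) \<longleftrightarrow> d dvd a"
      by (rule dvd_diff_left_iff) simp
    finally show ?thesis .
  qed
  moreover have "\<exists>a. w - a \<cdot>\<^sub>v x \<in> L" if w_sat: "w \<in> saturation q L" for w
  proof -
    have w: "w \<in> carrier_vec q" using w_sat unfolding saturation_def by blast
    obtain a where a: "F w = a \<cdot>\<^sub>v u" using sat[OF w_sat] by blast
    have "F (w - a \<cdot>\<^sub>v x) = ((a * y $ i) * d) \<cdot>\<^sub>v u"
      unfolding F_diff[OF w x] a Fx using u by (intro eq_vecI) (auto simp: algebra_simps)
    then have "w - a \<cdot>\<^sub>v x \<in> L" using L_iff[of "w - a \<cdot>\<^sub>v x"] w x by auto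
    then show ?thesis by blast
  qed
  ultimately show ?thesis using x unfolding d_def by blast
qed

section \<open>Dividing a column of the Gale dual\<close>
lemma mult_mat_vec_sum:
  assumes "A \<in> carrier_mat p q" "w \<in> carrier_vec q" "k < p"
  shows "(A *\<^sub>v w) $ k = (\<Sum>j<q. A $$ (k, j) * w $ j)"
  using assms by (simp add: scalar_prod_def atLeast0LessThan)

lemma transpose_mult_mat_vec_sum:
  assumes "A \<in> carrier_mat p q" "c \<in> carrier_vec p" "j < q"
  shows "(A\<^sup>T *\<^sub>v c) $ j = (\<Sum>k<p. A $$ (k, j) * c $ k)"
  using assms by (simp add: scalar_prod_def atLeast0LessThan)

lemma div_col_carrier: "V \<in> carrier_mat n m \<Longrightarrow> div_col i d V \<in> carrier_mat n m"
  by (simp add: div_col_def)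

lemma div_col_index:
  assumes "V \<in> carrier_mat n m" "l < n" "j < m" "d = col_gcd V i"
  shows "(if j = i then d else 1) * div_col i d V $$ (l, j) = V $$ (l, j)"
  using assms col_gcd_dvd[of l V i] by (auto simp: div_col_def)

text \<open>Rescaling a coordinate by \<open>d\<close> translates between \<open>V\<close> and the matrix with a divided column. Both
directions are needed over the integers: one multiplies the coordinate \<open>i\<close>, the other all
coordinates except \<open>i\<close>.\<close>

lemma div_col_mult:
  assumes V: "V \<in> carrier_mat n m" and w: "w \<in> carrier_vec m" and d: "d = col_gcd V i"
  shows "div_col i d V *\<^sub>v vec m (\<lambda>j. if j = i then d * w $ j else w $ j) = V *\<^sub>v w"
    and "d \<cdot>\<^sub>v (div_col i d V *\<^sub>v w) = V *\<^sub>v vec m (\<lambda>j. if j = i then w $ j else d * w $ j)"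
proof -
  note V' = div_col_carrier[OF V, of i d]
  show "div_col i d V *\<^sub>v vec m (\<lambda>j. if j = i then d * w $ j else w $ j) = V *\<^sub>v w"
  proof (rule eq_vecI)
    fix l assume "l < dim_vec (V *\<^sub>v w)"
    then have l: "l < n" using V by simp
    have "(div_col i d V *\<^sub>v vec m (\<lambda>j. if j = i then d * w $ j else w $ j)) $ l =
      (\<Sum>j<m. (if j = i then d else 1) * div_col i d V $$ (l, j) * w $ j)"
      by (subst mult_mat_vec_sum[OF V' _ l]) (auto intro!: sum.cong)
    also have "\<dots> = (\<Sum>j<m. V $$ (l, j) * w $ j)"
      using div_col_index[OF V l _ d] by (intro sum.cong) auto
    also have "\<dots> = (V *\<^sub>v w) $ l" using mult_mat_vec_sum[OF V w l] by simp
    finally show "(div_col i d V *\<^sub>v vec m (\<lambda>j. if j = i then d * w $ j else w $ j)) $ l = (V *\<^sub>v w) $ l" .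
  qed (use V V' in simp)
  show "d \<cdot>\<^sub>v (div_col i d V *\<^sub>v w) = V *\<^sub>v vec m (\<lambda>j. if j = i then w $ j else d * w $ j)"
  proof (rule eq_vecI)
    fix l assume "l < dim_vec (V *\<^sub>v vec m (\<lambda>j. if j = i then w $ j else d * w $ j))"
    then have l: "l < n" using V by simp
    have "(d \<cdot>\<^sub>v (div_col i d V *\<^sub>v w)) $ l = d * (\<Sum>j<m. div_col i d V $$ (l, j) * w $ j)"
      using l V' mult_mat_vec_sum[OF V' w l] by simp
    also have "\<dots> = (\<Sum>j<m. ((if j = i then d else 1) * div_col i d V $$ (l, j)) * (if j = i then w $ j else d * w $ j))"
      unfolding sum_distrib_left by (intro sum.cong) auto
    also have "\<dots> = (\<Sum>j<m. V $$ (l, j) * (if j = i then w $ j else d * w $ j))"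
      using div_col_index[OF V l _ d] by (intro sum.cong) auto
    also have "\<dots> = (V *\<^sub>v vec m (\<lambda>j. if j = i then w $ j else d * w $ j)) $ l"
      by (subst mult_mat_vec_sum[OF V _ l]) (auto intro!: sum.cong)
    finally show "(d \<cdot>\<^sub>v (div_col i d V *\<^sub>v w)) $ l =
      (V *\<^sub>v vec m (\<lambda>j. if j = i then w $ j else d * w $ j)) $ l" .
  qed (use V V' in simp)
qed

lemma div_col_right_inverse:
  assumes V: "V \<in> carrier_mat n m" and Y: "Y \<in> carrier_mat m n" "V * Y = 1\<^sub>m n" and d: "d = col_gcd V i"
  shows "\<exists>Y\<in>carrier_mat m n. div_col i d V * Y = 1\<^sub>m n"
proof
  define Y' where "Y' = mat m n (\<lambda>(j, l). if j = i then d * Y $$ (j, l) else Y $$ (j, l))"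
  show "Y' \<in> carrier_mat m n" unfolding Y'_def by simp
  have "col (div_col i d V * Y') l = col (V * Y) l" if l: "l < n" for l
  proof -
    have "col Y' l = vec m (\<lambda>j. if j = i then d * col Y l $ j else col Y l $ j)"
      using l Y unfolding Y'_def by (intro eq_vecI) auto
    moreover have "col (div_col i d V * Y') l = div_col i d V *\<^sub>v col Y' l"
      by (rule col_mult2[OF div_col_carrier[OF V] _ l]) (simp add: Y'_def)
    moreover have "col (V * Y) l = V *\<^sub>v col Y l" using V Y l by (intro col_mult2) auto
    moreover have "col Y l \<in> carrier_vec m" using Y by (intro carrier_vecI) simp
    ultimately show ?thesis using div_col_mult(1)[OF V _ d, of "col Y l"] by simp
  qed
  then have "div_col i d V * Y' = V * Y"
    using V Y by (intro mat_col_eqI) (auto simp: Y'_def div_col_def)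
  then show "div_col i d V * Y' = 1\<^sub>m n" using Y by simp
qed

lemma gale_dual_col_nonzero:
  assumes V: "V \<in> carrier_mat n m" and ker: "row_lattice Q = mat_kernel V"
    and e: "unit_vec m i \<notin> row_lattice Q" and i: "i < m"
  shows "col V i \<noteq> 0\<^sub>v n"
proof
  assume "col V i = 0\<^sub>v n"
  then have "V *\<^sub>v unit_vec m i = 0\<^sub>v n" using mult_mat_unit_vec[of i V] V i by simp
  then show False using e unfolding ker mat_kernel_eq[OF V] by simp
qed

text \<open>A relation between the rows of the smaller matrix is a vector of the row lattice of \<open>Q\<close> supported at
\<open>i\<close>. It is killed by \<open>V\<close>, whose \<open>i\<close>-th column is nonzero, so it vanishes.\<close>

lemma row_independent_delete_col:
  assumes V: "V \<in> carrier_mat n (Suc q)" and Q: "Q \<in> carrier_mat r (Suc q)" "row_independent Q"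
    and ker: "row_lattice Q = mat_kernel V" and i: "i < Suc q" and nz: "col V i \<noteq> 0\<^sub>v n"
  shows "row_independent (delete_col i Q)"
  unfolding row_independent_def
proof (intro ballI impI)
  note Qi = delete_col_carrier[OF Q(1), of i]
  fix c assume c': "c \<in> carrier_vec (dim_row (delete_col i Q))"
    and z': "(delete_col i Q)\<^sup>T *\<^sub>v c = 0\<^sub>v (dim_col (delete_col i Q))"
  have c: "c \<in> carrier_vec r" using c' Qi by simp
  define w where "w = Q\<^sup>T *\<^sub>v c"
  have w: "w \<in> carrier_vec (Suc q)" unfolding w_def using Q c by (intro mult_mat_vec_carrier[of _ _ r]) auto
  have colV: "col V i \<in> carrier_vec n" using V by (intro carrier_vecI) simp
  have "delete_entry i w = 0\<^sub>v q" using z' delete_col_mult[OF Q(1) c, of i] Qi unfolding w_def by simp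
  then have w_eq: "w = insert_entry i (w $ i) (0\<^sub>v q)" using insert_delete_entry[of i w] w i by simp
  have "V *\<^sub>v w = 0\<^sub>v n"
    using row_latticeI[of c Q] c Q ker mat_kernel_eq[OF V] unfolding w_def by auto
  moreover have "V *\<^sub>v w = V *\<^sub>v insert_entry i 0 (0\<^sub>v q) + w $ i \<cdot>\<^sub>v col V i"
    using insert_entry_mult[OF V _ i, of "0\<^sub>v q" "w $ i"] w_eq by simp
  moreover have "insert_entry i 0 (0\<^sub>v q) = (0\<^sub>v (Suc q) :: int vec)"
    using i by (intro eq_vecI) (auto simp: insert_entry_def)
  ultimately have *: "w $ i \<cdot>\<^sub>v col V i = 0\<^sub>v n"
    using mult_mat_zero_vec[of V] V left_zero_vec[of "w $ i \<cdot>\<^sub>v col V i" n] colV by simp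
  have "w $ i = 0"
  proof -
    obtain l where l: "l < n" "col V i $ l \<noteq> 0" using nz V by (metis carrier_matD(1) dim_col eq_vecI index_zero_vec)
    have "w $ i * col V i $ l = 0" using arg_cong[OF *, of "\<lambda>v. v $ l"] l V i by simp
    then show ?thesis using l by simp
  qed
  then have "w = 0\<^sub>v (Suc q)" using w_eq \<open>insert_entry i 0 (0\<^sub>v q) = 0\<^sub>v (Suc q)\<close> by simp
  then show "c = 0\<^sub>v (dim_row (delete_col i Q))"
    using Q c Qi unfolding row_independent_def w_def by auto
qed

text \<open>The cotorsion of \<open>Q\<close> without its \<open>i\<close>-th column is cyclic of order \<open>d\<close>, so its Smith form has the
diagonal \<open>1, \<dots>, 1, d\<close>. In \<open>P = \<alpha> Q\<close>, the last row is therefore divisible by \<open>d\<close> away from the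
\<open>i\<close>-th entry, and multiplying column \<open>i\<close> by \<open>d\<close> makes the division of the last row exact.

The rows of the resulting matrix \<open>Q'\<close> lie in the kernel of \<open>V'\<close> and are independent, since \<open>d\<close> times
a combination of them is a rescaled combination of rows of \<open>P\<close>. They generate the kernel: if
\<open>V' w = 0\<close>, multiplying all entries of \<open>w\<close> except the \<open>i\<close>-th by \<open>d\<close> yields an element of the row
lattice of \<open>P\<close>; its coefficients at the first \<open>r - 1\<close> rows are divisible by \<open>d\<close> because the
corresponding diagonal entries of the Smith form are \<open>1\<close>.\<close>

lemma gale_dual_i_reduction:
  assumes r: "0 < r" and m: "n + r = Suc q"
    and dual: "is_gale_dual r n Q V" "is_gale_dual n r V Q"
    and i: "i < Suc q" and e: "unit_vec (Suc q) i \<notin> row_lattice Q"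
    and sm: "smith_transformation r q (delete_col i Q) \<alpha> \<beta> S"
  defines "d \<equiv> col_gcd V i"
  defines "B \<equiv> multcol i d (\<alpha> * Q)"
  shows "\<forall>j<Suc q. d dvd B $$ (r - 1, j)"
    and "is_gale_dual n r (div_col i d V) (div_row (r - 1) d B)"
proof -
  have V: "V \<in> carrier_mat n (Suc q)" "row_independent V"
    and Q: "Q \<in> carrier_mat r (Suc q)" "row_independent Q" and ker: "row_lattice Q = mat_kernel V"
    using dual(2) unfolding is_gale_dual_iff m by auto
  have "r + n = Suc q" using m by simp
  then obtain Y where Y: "Y \<in> carrier_mat (Suc q) n" "V * Y = 1\<^sub>m n"
    using gale_dual_right_inverse[OF dual(1)] by auto
  have nz: "col V i \<noteq> 0\<^sub>v n" by (rule gale_dual_col_nonzero[OF V(1) ker e i])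
  have d: "0 < d" unfolding d_def using col_gcd_pos[of V i] nz V i by simp
  have Qi: "delete_col i Q \<in> carrier_mat r q" by (rule delete_col_carrier[OF Q(1)])
  have ind: "row_independent (delete_col i Q)"
    by (rule row_independent_delete_col[OF V(1) Q ker i nz])
  obtain c where c: "r \<le> q" "\<forall>k<r. 0 < c k" "\<forall>k. Suc k < r \<longrightarrow> c k dvd c (Suc k)"
    "S = mat r q (\<lambda>(k, j). if k = j then c k else 0)"
    using smith_form_of_row_independent[OF ind sm] by blast
  obtain x where x: "x \<in> carrier_vec q"
    "\<And>a. a \<cdot>\<^sub>v x \<in> row_lattice (delete_col i Q) \<longleftrightarrow> d dvd a"
    "\<And>w. w \<in> saturation q (row_lattice (delete_col i Q)) \<Longrightarrow>
      \<exists>a. w - a \<cdot>\<^sub>v x \<in> row_lattice (delete_col i Q)"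
    using delete_col_torsion_generator[OF V(1) Y Q(1) ker i nz] unfolding d_def by blast
  have cyc: "c (r - 1) = d" "\<And>k. k < r - 1 \<Longrightarrow> c k = 1"
    using smith_form_of_cyclic_torsion[OF sm[unfolded c(4)] c(1) r c(2,3) d x(1,2)] x(3) by blast+
  have u: "unimodular r \<alpha>" "unimodular q \<beta>" and S: "\<alpha> * delete_col i Q * \<beta> = S"
    using sm unfolding smith_transformation_def by auto
  obtain \<alpha>' where al: "\<alpha> \<in> carrier_mat r r" "\<alpha>' \<in> carrier_mat r r" "\<alpha>' * \<alpha> = 1\<^sub>m r"
    using u(1) by (rule unimodularE)
  obtain \<beta>' where be: "\<beta> \<in> carrier_mat q q" "\<beta>' \<in> carrier_mat q q" "\<beta> * \<beta>' = 1\<^sub>m q" "\<beta>' * \<beta> = 1\<^sub>m q"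
    using u(2) by (rule unimodularE)
  have Sc: "S \<in> carrier_mat r q" unfolding c(4) by auto
  define P where "P = \<alpha> * Q"
  have P: "P \<in> carrier_mat r (Suc q)" unfolding P_def using al Q by auto
  have Pi: "delete_col i P = \<alpha> * delete_col i Q"
    using al(1) Q unfolding P_def
    by (intro eq_matI) (auto simp: delete_col_def scalar_prod_def)
  have PS: "delete_col i P = S * \<beta>'"
    unfolding Pi S[symmetric] using al(1) be Qi
    by (simp add: assoc_mult_mat[of _ r r _ q _ q] assoc_mult_mat[of _ r q _ q _ q])
  have PT: "P\<^sup>T *\<^sub>v b = Q\<^sup>T *\<^sub>v (\<alpha>\<^sup>T *\<^sub>v b)" if "b \<in> carrier_vec r" for b
    unfolding P_def by (rule transpose_mult_vec[OF al(1) Q(1) that])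
  have aT: "\<alpha>\<^sup>T *\<^sub>v b \<in> carrier_vec r" if "b \<in> carrier_vec r" for b
    using al that by (intro mult_mat_vec_carrier[of _ _ r]) auto
  have B: "B \<in> carrier_mat r (Suc q)" unfolding B_def using al Q by auto
  have B_index: "B $$ (k, j) = (if j = i then d else 1) * P $$ (k, j)" if "k < r" "j < Suc q" for k j
    unfolding B_def P_def[symmetric] using P that by auto
  show dvdB: "\<forall>j<Suc q. d dvd B $$ (r - 1, j)"
  proof (intro allI impI)
    fix j assume j: "j < Suc q"
    show "d dvd B $$ (r - 1, j)"
    proof (cases "j = i")
      case False
      define j' where "j' = (if j < i then j else j - 1)"
      have j': "j' < q" "(if j' < i then j' else Suc j') = j" using j i False unfolding j'_def by auto
      have "P $$ (r - 1, j) = delete_col i P $$ (r - 1, j')" using P r j' by (simp add: delete_col_def)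
      also have "\<dots> = (\<Sum>l<q. S $$ (r - 1, l) * \<beta>' $$ (l, j'))"
        unfolding PS using Sc be r j' by (simp add: scalar_prod_def atLeast0LessThan)
      also have "\<dots> = (\<Sum>l<q. if l = r - 1 then d * \<beta>' $$ (l, j') else 0)"
        unfolding c(4) using r cyc(1) by (intro sum.cong) auto
      finally have "d dvd P $$ (r - 1, j)" by (simp add: dvd_sum)
      then show ?thesis using B_index[of "r - 1" j] r j by simp
    qed (use B_index[of "r - 1" j] r j in simp)
  qed
  define V' where "V' = div_col i d V"
  define Q' where "Q' = div_row (r - 1) d B"
  have V': "V' \<in> carrier_mat n (Suc q)" unfolding V'_def by (rule div_col_carrier[OF V(1)])
  have Q': "Q' \<in> carrier_mat r (Suc q)" unfolding Q'_def div_row_def using B by auto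
  have Q'_index: "(if k = r - 1 then d else 1) * Q' $$ (k, j) = B $$ (k, j)" if "k < r" "j < Suc q" for k j
    unfolding Q'_def div_row_def using that B dvdB by auto
  define scale where "scale = (\<lambda>z :: int vec. vec (Suc q) (\<lambda>j. if j = i then d * z $ j else z $ j))"
  \<comment> \<open>Row \<open>k\<close> of \<open>d Q'\<close> is the rescaled row of \<open>P\<close>, multiplied by \<open>d\<close> unless it is the last row.\<close>
  define hat where "hat = (\<lambda>b :: int vec. vec r (\<lambda>k. if k = r - 1 then b $ k else d * b $ k))"
  have hat: "hat b \<in> carrier_vec r" for b unfolding hat_def by simp
  have scale: "scale z \<in> carrier_vec (Suc q)" for z unfolding scale_def by simp
  have Q'c: "Q'\<^sup>T *\<^sub>v b \<in> carrier_vec (Suc q)" if "b \<in> carrier_vec r" for b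
    using Q' that by (intro mult_mat_vec_carrier[of _ _ r]) auto
  have key: "d \<cdot>\<^sub>v (Q'\<^sup>T *\<^sub>v b) = scale (P\<^sup>T *\<^sub>v hat b)" if b: "b \<in> carrier_vec r" for b
  proof (rule eq_vecI)
    fix j assume "j < dim_vec (scale (P\<^sup>T *\<^sub>v hat b))"
    then have j: "j < Suc q" unfolding scale_def by simp
    have "(d \<cdot>\<^sub>v (Q'\<^sup>T *\<^sub>v b)) $ j = d * (\<Sum>k<r. Q' $$ (k, j) * b $ k)"
      using transpose_mult_mat_vec_sum[OF Q' b j] Q' j by simp
    also have "\<dots> = (\<Sum>k<r. ((if k = r - 1 then d else 1) * Q' $$ (k, j)) * hat b $ k)"
      unfolding sum_distrib_left hat_def by (intro sum.cong) auto
    also have "\<dots> = (\<Sum>k<r. ((if j = i then d else 1) * P $$ (k, j)) * hat b $ k)"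
      using Q'_index[OF _ j] B_index[OF _ j] by (intro sum.cong) auto
    also have "\<dots> = (if j = i then d else 1) * (\<Sum>k<r. P $$ (k, j) * hat b $ k)"
      unfolding sum_distrib_left by (intro sum.cong) auto
    also have "\<dots> = scale (P\<^sup>T *\<^sub>v hat b) $ j"
      unfolding transpose_mult_mat_vec_sum[OF P hat j, symmetric] scale_def
      using j by (auto simp del: index_mult_mat_vec)
    finally show "(d \<cdot>\<^sub>v (Q'\<^sup>T *\<^sub>v b)) $ j = scale (P\<^sup>T *\<^sub>v hat b) $ j" .
  qed (use Q' in \<open>simp add: scale_def\<close>)
  have V'_scale: "V' *\<^sub>v scale z = V *\<^sub>v z" if "z \<in> carrier_vec (Suc q)" for z
    unfolding V'_def scale_def using div_col_mult(1)[OF V(1) that d_def[THEN meta_eq_to_obj_eq]] .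
  have indV': "row_independent V'" unfolding row_independent_def
  proof (intro ballI impI)
    fix b assume b': "b \<in> carrier_vec (dim_row V')" and z: "V'\<^sup>T *\<^sub>v b = 0\<^sub>v (dim_col V')"
    have b: "b \<in> carrier_vec n" using b' V' by simp
    have "V\<^sup>T *\<^sub>v b = 0\<^sub>v (Suc q)"
    proof (rule eq_vecI)
      fix j assume "j < dim_vec (0\<^sub>v (Suc q) :: int vec)"
      then have j: "j < Suc q" by simp
      have "(V\<^sup>T *\<^sub>v b) $ j = (\<Sum>l<n. ((if j = i then d else 1) * V' $$ (l, j)) * b $ l)"
        unfolding transpose_mult_mat_vec_sum[OF V(1) b j] V'_def
        using div_col_index[OF V(1) _ j d_def[THEN meta_eq_to_obj_eq]] by (intro sum.cong) auto
      also have "\<dots> = (if j = i then d else 1) * (V'\<^sup>T *\<^sub>v b) $ j"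
        unfolding transpose_mult_mat_vec_sum[OF V' b j] sum_distrib_left by (intro sum.cong) auto
      finally show "(V\<^sup>T *\<^sub>v b) $ j = 0\<^sub>v (Suc q) $ j" using z V' j by simp
    qed (use V in simp)
    then show "b = 0\<^sub>v (dim_row V')" using V b V' unfolding row_independent_def by auto
  qed
  have indQ': "row_independent Q'" unfolding row_independent_def
  proof (intro ballI impI)
    fix b assume b': "b \<in> carrier_vec (dim_row Q')" and z: "Q'\<^sup>T *\<^sub>v b = 0\<^sub>v (dim_col Q')"
    have b: "b \<in> carrier_vec r" using b' Q' by simp
    have sc: "scale (P\<^sup>T *\<^sub>v hat b) = 0\<^sub>v (Suc q)" using key[OF b] z Q' by (simp add: smult_vec_zero)
    have "Q\<^sup>T *\<^sub>v (\<alpha>\<^sup>T *\<^sub>v hat b) = 0\<^sub>v (Suc q)"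
    proof (rule eq_vecI)
      fix j assume "j < dim_vec (0\<^sub>v (Suc q) :: int vec)"
      then have j: "j < Suc q" by simp
      have "scale (P\<^sup>T *\<^sub>v hat b) $ j = 0" unfolding sc using j by simp
      then show "(Q\<^sup>T *\<^sub>v (\<alpha>\<^sup>T *\<^sub>v hat b)) $ j = 0\<^sub>v (Suc q) $ j"
        unfolding PT[OF hat, symmetric] scale_def using j d by (simp split: if_splits)
    qed (use Q in simp)
    then have "\<alpha>\<^sup>T *\<^sub>v hat b = 0\<^sub>v r" using Q aT[OF hat, of b] unfolding row_independent_def by auto
    moreover obtain \<alpha>'' where "\<alpha>'' \<in> carrier_mat r r" "\<alpha> * \<alpha>'' = 1\<^sub>m r" using u(1) by (rule unimodularE)
    ultimately have "hat b = 0\<^sub>v r"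
      using transpose_mult_vec[OF al(1) _ hat, of \<alpha>'' r b] mult_mat_zero_vec[of "\<alpha>''\<^sup>T"] hat by simp
    then have h: "hat b $ k = 0" if "k < r" for k using that by simp
    have "b $ k = 0" if "k < r" for k using h[OF that] that d unfolding hat_def by (simp split: if_splits)
    then show "b = 0\<^sub>v (dim_row Q')" using b Q' by auto
  qed
  have "row_lattice Q' = mat_kernel V'"
  proof (intro equalityI subsetI)
    fix w assume "w \<in> row_lattice Q'"
    then obtain b where b: "b \<in> carrier_vec r" "w = Q'\<^sup>T *\<^sub>v b" using Q' by (rule row_latticeE)
    have w: "w \<in> carrier_vec (Suc q)" unfolding b(2) by (rule Q'c[OF b(1)])
    have "Q\<^sup>T *\<^sub>v (\<alpha>\<^sup>T *\<^sub>v hat b) \<in> mat_kernel V"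
      using row_latticeI[of "\<alpha>\<^sup>T *\<^sub>v hat b" Q] aT[OF hat] Q ker by simp
    then have "V' *\<^sub>v (d \<cdot>\<^sub>v w) = 0\<^sub>v n"
      unfolding b(2) key[OF b(1)] PT[OF hat] using V'_scale mat_kernel_eq[OF V(1)] by simp
    then have "d \<cdot>\<^sub>v w \<in> mat_kernel V'" using mat_kernel_eq[OF V'] w by simp
    then have "w \<in> saturation (Suc q) (mat_kernel V')" unfolding saturation_def using w d by blast
    then show "w \<in> mat_kernel V'" using saturation_mat_kernel[OF V'] by blast
  next
    fix w assume "w \<in> mat_kernel V'"
    then have w: "w \<in> carrier_vec (Suc q)" "V' *\<^sub>v w = 0\<^sub>v n" using mat_kernel_eq[OF V'] by auto
    define z where "z = vec (Suc q) (\<lambda>j. if j = i then w $ j else d * w $ j)"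
    have z: "z \<in> carrier_vec (Suc q)" unfolding z_def by simp
    have "V *\<^sub>v z = d \<cdot>\<^sub>v (V' *\<^sub>v w)"
      unfolding z_def V'_def using div_col_mult(2)[OF V(1) w(1) d_def[THEN meta_eq_to_obj_eq]] by simp
    then have "z \<in> row_lattice Q" unfolding ker mat_kernel_eq[OF V(1)] using z w by (simp add: smult_vec_zero)
    then obtain c0 where c0: "c0 \<in> carrier_vec r" "z = Q\<^sup>T *\<^sub>v c0" using Q(1) by (rule row_latticeE)
    define b where "b = \<alpha>'\<^sup>T *\<^sub>v c0"
    have b: "b \<in> carrier_vec r" unfolding b_def using al c0 by (intro mult_mat_vec_carrier[of _ _ r]) auto
    have "\<alpha>\<^sup>T *\<^sub>v b = c0"
      unfolding b_def using transpose_mult_vec[OF al(2,1) c0(1)] c0 unfolding al(3) by simp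
    then have Pb: "P\<^sup>T *\<^sub>v b = z" using PT[OF b] c0 by simp
    have dw: "delete_entry i w \<in> carrier_vec q" by (rule delete_entry_carrier[OF w(1)])
    have "d \<cdot>\<^sub>v delete_entry i w = delete_entry i z"
      using i w(1) unfolding z_def delete_entry_def by (intro eq_vecI) auto
    also have "\<dots> = (delete_col i P)\<^sup>T *\<^sub>v b" using delete_col_mult[OF P b, of i] Pb by simp
    also have "\<dots> = \<beta>'\<^sup>T *\<^sub>v (S\<^sup>T *\<^sub>v b)" unfolding PS by (rule transpose_mult_vec[OF Sc be(2) b])
    finally have "\<beta>\<^sup>T *\<^sub>v (d \<cdot>\<^sub>v delete_entry i w) = \<beta>\<^sup>T *\<^sub>v (\<beta>'\<^sup>T *\<^sub>v (S\<^sup>T *\<^sub>v b))" by simp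
    also have "\<dots> = S\<^sup>T *\<^sub>v b"
    proof -
      have "S\<^sup>T *\<^sub>v b \<in> carrier_vec q" using Sc b by (intro mult_mat_vec_carrier[of _ _ r]) auto
      then show ?thesis using transpose_mult_vec[OF be(2,1), of "S\<^sup>T *\<^sub>v b"] unfolding be(4) by simp
    qed
    finally have Sb: "d \<cdot>\<^sub>v (\<beta>\<^sup>T *\<^sub>v delete_entry i w) = S\<^sup>T *\<^sub>v b"
      using mult_mat_smult_vec[of "delete_entry i w" "\<beta>\<^sup>T" d] dw be(1) by simp
    have dvd_b: "d dvd b $ k" if k: "k < r - 1" for k
    proof -
      have kq: "k < q" "k < r" using k c(1) by auto
      have "(S\<^sup>T *\<^sub>v b) $ k = b $ k"
        unfolding c(4) transpose_diagonal_mult[OF b kq(1)] using kq cyc(2)[OF k] by simp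
      then have "b $ k = d * (\<beta>\<^sup>T *\<^sub>v delete_entry i w) $ k" unfolding Sb[symmetric] using kq be by simp
      then show ?thesis by (rule dvdI)
    qed
    define b0 where "b0 = vec r (\<lambda>k. if k = r - 1 then b $ k else b $ k div d)"
    have b0: "b0 \<in> carrier_vec r" unfolding b0_def by simp
    have "hat b0 = b" using b dvd_b unfolding hat_def b0_def by (intro eq_vecI) auto
    then have "d \<cdot>\<^sub>v (Q'\<^sup>T *\<^sub>v b0) = scale z" using key[OF b0] Pb by simp
    also have "\<dots> = d \<cdot>\<^sub>v w" unfolding scale_def z_def using w by (intro eq_vecI) auto
    finally have "Q'\<^sup>T *\<^sub>v b0 = w"
      by (rule smult_vec_cancel[where n = "Suc q"]) (use d w Q'c[OF b0] in auto)
    then show "w \<in> row_lattice Q'" using row_latticeI[of b0 Q'] b0 Q' by auto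
  qed
  then show "is_gale_dual n r (div_col i d V) (div_row (r - 1) d B)"
    unfolding is_gale_dual_iff m V'_def[symmetric] Q'_def[symmetric] using V' indV' Q' indQ' by blast
qed

section \<open>Positive lattice bases, W-matrices and F-matrices\<close>
lemma unimodular_mult_row_lattice:
  assumes U: "unimodular p U" and A: "A \<in> carrier_mat p q"
  shows "row_lattice (U * A) = row_lattice A"
    and "row_independent A \<Longrightarrow> row_independent (U * A)"
proof -
  obtain U' where u: "U \<in> carrier_mat p p" "U' \<in> carrier_mat p p" "U * U' = 1\<^sub>m p" "U' * U = 1\<^sub>m p"
    using U by (rule unimodularE)
  have UA: "U * A \<in> carrier_mat p q" using u A by auto
  have UT: "(U * A)\<^sup>T *\<^sub>v c = A\<^sup>T *\<^sub>v (U\<^sup>T *\<^sub>v c)" if "c \<in> carrier_vec p" for c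
    by (rule transpose_mult_vec[OF u(1) A that])
  have Uc: "U\<^sup>T *\<^sub>v c \<in> carrier_vec p" "U'\<^sup>T *\<^sub>v c \<in> carrier_vec p" if "c \<in> carrier_vec p" for c
    using u that by (auto intro!: mult_mat_vec_carrier[of _ p p])
  have inv: "U\<^sup>T *\<^sub>v (U'\<^sup>T *\<^sub>v c) = c" "U'\<^sup>T *\<^sub>v (U\<^sup>T *\<^sub>v c) = c" if "c \<in> carrier_vec p" for c
    using transpose_mult_vec[OF u(2,1) that] transpose_mult_vec[OF u(1,2) that] that unfolding u(3,4) by simp_all
  show "row_lattice (U * A) = row_lattice A"
  proof (intro equalityI subsetI)
    fix v assume "v \<in> row_lattice (U * A)"
    then obtain c where c: "c \<in> carrier_vec p" "v = (U * A)\<^sup>T *\<^sub>v c" using UA by (rule row_latticeE)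
    then show "v \<in> row_lattice A" unfolding c(2) UT[OF c(1)] using Uc(1) A by (intro row_latticeI) auto
  next
    fix v assume "v \<in> row_lattice A"
    then obtain c where c: "c \<in> carrier_vec p" "v = A\<^sup>T *\<^sub>v c" using A by (rule row_latticeE)
    then have "v = (U * A)\<^sup>T *\<^sub>v (U'\<^sup>T *\<^sub>v c)" using UT[OF Uc(2)] inv(1) by simp
    moreover have "(U * A)\<^sup>T *\<^sub>v (U'\<^sup>T *\<^sub>v c) \<in> row_lattice (U * A)"
      by (rule row_latticeI) (use Uc(2) c UA in auto)
    ultimately show "v \<in> row_lattice (U * A)" by simp
  qed
  show "row_independent (U * A)" if ind: "row_independent A"
    unfolding row_independent_def
  proof (intro ballI impI)
    fix c assume c': "c \<in> carrier_vec (dim_row (U * A))" and z: "(U * A)\<^sup>T *\<^sub>v c = 0\<^sub>v (dim_col (U * A))"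
    have c: "c \<in> carrier_vec p" using c' u by simp
    have "U\<^sup>T *\<^sub>v c = 0\<^sub>v p" using ind z Uc(1)[OF c] A unfolding row_independent_def UT[OF c] by auto
    then have "c = U'\<^sup>T *\<^sub>v 0\<^sub>v p" using inv(2)[OF c] by simp
    also have "\<dots> = 0\<^sub>v p" using mult_mat_zero_vec[of "U'\<^sup>T"] u by simp
    finally show "c = 0\<^sub>v (dim_row (U * A))" using u by simp
  qed
qed

lemma transpose_mult_unit_vec: "k < dim_row A \<Longrightarrow> A\<^sup>T *\<^sub>v unit_vec (dim_row A) k = row (A :: int mat) k"
  using mult_mat_unit_vec[of k "A\<^sup>T"] by simp

text \<open>A primitive vector is the first row of a unimodular matrix: apply the Smith normal form to the
matrix with the single row \<open>c\<close>. The sign is moved from \<open>g\<close> into \<open>U\<close>.\<close>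

lemma unimodular_first_row:
  assumes c: "c \<in> carrier_vec p" "c \<noteq> 0\<^sub>v p"
  shows "\<exists>U g. unimodular p U \<and> 0 < g \<and> 0 < p \<and> c = g \<cdot>\<^sub>v row U 0"
proof -
  have p: "0 < p" using c by (cases p) auto
  define C where "C = mat 1 p (\<lambda>(_, j). c $ j)"
  have C: "C \<in> carrier_mat 1 p" unfolding C_def by simp
  have Cc: "C $$ (0, j) = c $ j" if "j < p" for j unfolding C_def using that by simp
  obtain \<alpha> \<beta> S where sm: "smith_transformation 1 p C \<alpha> \<beta> S" using smith_transformation_exists[OF C] by blast
  have u: "unimodular 1 \<alpha>" "unimodular p \<beta>" and S: "\<alpha> * C * \<beta> = S" and Sc: "S \<in> carrier_mat 1 p"
    and S0: "\<And>j. j < p \<Longrightarrow> j \<noteq> 0 \<Longrightarrow> S $$ (0, j) = 0"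
    using sm unfolding smith_transformation_def smith_normal_form_def by auto
  obtain \<alpha>' where al: "\<alpha> \<in> carrier_mat 1 1" "\<alpha>' \<in> carrier_mat 1 1" "\<alpha>' * \<alpha> = 1\<^sub>m 1"
    using u(1) by (rule unimodularE)
  obtain \<beta>' where be: "\<beta> \<in> carrier_mat p p" "\<beta>' \<in> carrier_mat p p" "\<beta> * \<beta>' = 1\<^sub>m p" "unimodular p \<beta>'"
    using u(2) by (rule unimodularE)
  have "C = \<alpha>' * (S * \<beta>')"
  proof -
    have "S * \<beta>' = \<alpha> * C"
      unfolding S[symmetric] using C al(1) be
      by (simp add: assoc_mult_mat[of _ 1 1 _ p _ p] assoc_mult_mat[of _ 1 p _ p _ p])
    then have "\<alpha>' * (S * \<beta>') = (\<alpha>' * \<alpha>) * C" using assoc_mult_mat[OF al(2,1) C] by simp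
    then show ?thesis unfolding al(3) using C by simp
  qed
  moreover define t where "t = \<alpha>' $$ (0, 0) * S $$ (0, 0)"
  ultimately have ct: "c $ j = t * \<beta>' $$ (0, j)" if j: "j < p" for j
  proof -
    have "c $ j = C $$ (0, j)" using Cc[OF j] by simp
    also have "\<dots> = \<alpha>' $$ (0, 0) * (S * \<beta>') $$ (0, j)"
      unfolding \<open>C = \<alpha>' * (S * \<beta>')\<close> using al Sc be j by (simp add: scalar_prod_def)
    also have "(S * \<beta>') $$ (0, j) = (\<Sum>l<p. S $$ (0, l) * \<beta>' $$ (l, j))"
      using Sc be j by (simp add: scalar_prod_def atLeast0LessThan)
    also have "\<dots> = (\<Sum>l<p. if l = 0 then S $$ (0, 0) * \<beta>' $$ (0, j) else 0)"
      using S0 by (intro sum.cong) auto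
    also have "\<dots> = S $$ (0, 0) * \<beta>' $$ (0, j)" using p by simp
    finally show ?thesis unfolding t_def by simp
  qed
  have t0: "t \<noteq> 0"
  proof
    assume "t = 0"
    then have "c = 0\<^sub>v p" using ct c by (intro eq_vecI) auto
    then show False using c by simp
  qed
  define U where "U = (sgn t \<cdot>\<^sub>m 1\<^sub>m p) * \<beta>'"
  have ss: "sgn t * sgn t = 1" using t0 by (simp add: sgn_if)
  have "unimodular p (sgn t \<cdot>\<^sub>m 1\<^sub>m p)" by (rule unimodular_sign[OF ss])
  then have "unimodular p U" unfolding U_def using be(4) by (rule unimodular_mult)
  moreover have Ueq: "U = sgn t \<cdot>\<^sub>m \<beta>'" unfolding U_def using be(2) by (simp add: mult_smult_assoc_mat[of _ p p _ p])
  have "c = \<bar>t\<bar> \<cdot>\<^sub>v row U 0"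
  proof (rule eq_vecI)
    fix j assume "j < dim_vec (\<bar>t\<bar> \<cdot>\<^sub>v row U 0)"
    then have j: "j < p" using Ueq be by simp
    have "\<bar>t\<bar> * (sgn t * \<beta>' $$ (0, j)) = t * \<beta>' $$ (0, j)"
      unfolding mult.assoc[symmetric] abs_mult_sgn ..
    then have "c $ j = \<bar>t\<bar> * (sgn t * \<beta>' $$ (0, j))" using ct[OF j] by (rule trans[OF _ sym, rotated])
    then show "c $ j = (\<bar>t\<bar> \<cdot>\<^sub>v row U 0) $ j" using j Ueq be(2) p by simp
  qed (use c Ueq be in simp)
  ultimately show ?thesis using t0 p by (intro exI[of _ U] exI[of _ "\<bar>t\<bar>"]) auto
qed

lemma unimodular_add_first_row: "unimodular p (mat p p (\<lambda>(k, l). (if l = k then 1 else 0) + (if l = 0 \<and> k \<noteq> 0 then N else 0)))"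
proof -
  define M :: "int \<Rightarrow> int mat"
    where "M N = mat p p (\<lambda>(k, l). (if l = k then 1 else 0) + (if l = 0 \<and> k \<noteq> 0 then N else 0))" for N
  have M: "M N \<in> carrier_mat p p" for N unfolding M_def by simp
  have "M N * M (- N) = 1\<^sub>m p" for N
  proof (rule eq_matI)
    fix k j assume "k < dim_row (1\<^sub>m p :: int mat)" "j < dim_col (1\<^sub>m p :: int mat)"
    then have kj: "k < p" "j < p" by auto
    have "(M N * M (- N)) $$ (k, j) = (\<Sum>l<p. ((if l = k then 1 else 0) + (if l = 0 \<and> k \<noteq> 0 then N else 0)) * M (- N) $$ (l, j))"
      using kj M[of "- N"] by (simp add: M_def scalar_prod_def atLeast0LessThan)
    also have "\<dots> = (\<Sum>l<p. (if l = k then M (- N) $$ (k, j) else 0)) +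
        (\<Sum>l<p. (if l = 0 then (if k \<noteq> 0 then N * M (- N) $$ (0, j) else 0) else 0))"
      unfolding sum.distrib[symmetric] by (intro sum.cong) (auto simp: algebra_simps)
    also have "\<dots> = M (- N) $$ (k, j) + (if k \<noteq> 0 then N * M (- N) $$ (0, j) else 0)" using kj by simp
    also have "\<dots> = 1\<^sub>m p $$ (k, j)" using kj by (auto simp: M_def)
    finally show "(M N * M (- N)) $$ (k, j) = 1\<^sub>m p $$ (k, j)" .
  qed (auto simp: M_def)
  from this[of N] this[of "- N"] show ?thesis
    unfolding unimodular_iff M_def[symmetric] using M by (auto intro!: bexI[of _ "M (- N)"])
qed

text \<open>The primitive lattice vector proportional to \<open>v\<close> is part of a lattice basis, and all its entries are positive.
Adding a large multiple of it to the other basis vectors makes them positive too. This criterion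
involves no choice of a basis and is therefore easy to transport to another lattice.\<close>

lemma W_positive_if_strictly_positive:
  assumes A: "A \<in> carrier_mat p q" and ind: "row_independent A" and q: "0 < q"
    and v: "v \<in> row_lattice A" and pos: "\<And>j. j < q \<Longrightarrow> 0 < v $ j"
  shows "W_positive A"
proof -
  obtain c where c: "c \<in> carrier_vec p" "v = A\<^sup>T *\<^sub>v c" using v A by (rule row_latticeE)
  have "c \<noteq> 0\<^sub>v p"
  proof
    assume "c = 0\<^sub>v p"
    then have "v = 0\<^sub>v q" using c mult_mat_zero_vec[of "A\<^sup>T"] A by simp
    then show False using pos[OF q] q by simp
  qed
  then obtain U g where U: "unimodular p U" "0 < g" "0 < p" "c = g \<cdot>\<^sub>v row U 0"
    using unimodular_first_row[OF c(1)] by blast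
  have Uc: "U \<in> carrier_mat p p" by (rule unimodular_carrier[OF U(1)])
  define D where "D = U * A"
  have D: "D \<in> carrier_mat p q" unfolding D_def using Uc A by auto
  have row0: "0 < D $$ (0, j)" if j: "j < q" for j
  proof -
    have "v = A\<^sup>T *\<^sub>v (g \<cdot>\<^sub>v (U\<^sup>T *\<^sub>v unit_vec p 0))"
      using c(2) U(3,4) Uc transpose_mult_unit_vec[of 0 U] by simp
    also have "\<dots> = g \<cdot>\<^sub>v (A\<^sup>T *\<^sub>v (U\<^sup>T *\<^sub>v unit_vec p 0))"
      by (rule mult_mat_smult_vec) (use A Uc in \<open>auto intro!: mult_mat_vec_carrier[of _ p p]\<close>)
    also have "A\<^sup>T *\<^sub>v (U\<^sup>T *\<^sub>v unit_vec p 0) = D\<^sup>T *\<^sub>v unit_vec p 0"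
      unfolding D_def using transpose_mult_vec[OF Uc A, of "unit_vec p 0"] by simp
    also have "\<dots> = row D 0" using transpose_mult_unit_vec[of 0 D] D U(3) by simp
    finally have "v $ j = g * D $$ (0, j)" using D j U(3) by simp
    then show ?thesis using pos[OF j] U(2) by (simp add: zero_less_mult_iff)
  qed
  \<comment> \<open>The first row of \<open>D\<close> has entries at least \<open>1\<close>, so \<open>N\<close> times it outweighs every entry of \<open>D\<close>.\<close>
  define N where "N = (\<Sum>k<p. \<Sum>j<q. \<bar>D $$ (k, j)\<bar>)"
  have N: "\<bar>D $$ (k, j)\<bar> \<le> N" if "k < p" "j < q" for k j
  proof -
    have "\<bar>D $$ (k, j)\<bar> \<le> (\<Sum>j<q. \<bar>D $$ (k, j)\<bar>)" using that by (intro member_le_sum) auto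
    also have "\<dots> \<le> N" unfolding N_def using that
      by (intro member_le_sum[of k "{..<p}" "\<lambda>k. \<Sum>j<q. \<bar>D $$ (k, j)\<bar>"]) (auto intro: sum_nonneg)
    finally show ?thesis .
  qed
  define M where "M = mat p p (\<lambda>(k, l). (if l = k then 1 else 0) + (if l = 0 \<and> k \<noteq> 0 then N else 0))"
  have M: "unimodular p M" "M \<in> carrier_mat p p" unfolding M_def using unimodular_add_first_row by auto
  define E where "E = M * D"
  have E: "E \<in> carrier_mat p q" unfolding E_def using M D by auto
  have E_index: "E $$ (k, j) = D $$ (k, j) + (if k \<noteq> 0 then N * D $$ (0, j) else 0)" if kj: "k < p" "j < q" for k j
  proof -
    have "E $$ (k, j) = (\<Sum>l<p. ((if l = k then 1 else 0) + (if l = 0 \<and> k \<noteq> 0 then N else 0)) * D $$ (l, j))"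
      unfolding E_def M_def using kj D by (simp add: scalar_prod_def atLeast0LessThan)
    also have "\<dots> = (\<Sum>l<p. (if l = k then D $$ (k, j) else 0)) +
        (\<Sum>l<p. (if l = 0 then (if k \<noteq> 0 then N * D $$ (0, j) else 0) else 0))"
      unfolding sum.distrib[symmetric] by (intro sum.cong) (auto simp: algebra_simps)
    finally show ?thesis using kj U(3) by simp
  qed
  have nonneg: "0 \<le> E $$ (k, j)" if kj: "k < p" "j < q" for k j
  proof (cases "k = 0")
    case False
    have "0 \<le> N" using N[OF kj] by simp
    then have "N * 1 \<le> N * D $$ (0, j)" using row0[OF kj(2)] by (intro mult_left_mono) auto
    then show ?thesis using E_index[OF kj] N[OF kj] False by simp
  qed (use E_index[OF kj] row0[OF kj(2)] in simp)
  have "row_independent E" "row_lattice E = row_lattice A"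
    unfolding E_def using unimodular_mult_row_lattice[OF M(1) D] unimodular_mult_row_lattice[OF U(1) A] ind
    unfolding D_def by auto
  then have "lattice_basis q (row_lattice A) (set (rows E))" using lattice_basis_rows_iff[OF E] by blast
  moreover have "\<forall>w\<in>set (rows E). \<forall>j<q. w $ j \<ge> 0"
    using nonneg E unfolding rows_def by auto
  ultimately show ?thesis unfolding W_positive_def using A by auto
qed

text \<open>For each column some vector of the positive basis is nonzero there, as otherwise the whole column
of \<open>A\<close> would vanish. The sum of these vectors is strictly positive.\<close>

lemma strictly_positive_if_W_positive:
  assumes A: "A \<in> carrier_mat p q" and W: "W_positive A" and nz: "\<And>j. j < q \<Longrightarrow> col A j \<noteq> 0\<^sub>v p"
  shows "\<exists>v\<in>row_lattice A. \<forall>j<q. 0 < v $ j"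
proof -
  interpret V: idom_vec q "TYPE(int)" .
  obtain B where B: "B \<subseteq> carrier_vec q" "V.span B = row_lattice A" and pos: "\<And>v j. v \<in> B \<Longrightarrow> j < q \<Longrightarrow> 0 \<le> v $ j"
    using W A unfolding W_positive_def lattice_basis_def by auto
  note L = subgroup_vec_groupD[OF subgroup_row_lattice[OF A]]
  have BL: "B \<subseteq> row_lattice A" using V.in_own_span[OF B(1)] B(2) by simp
  have ex: "\<exists>b\<in>B. 0 < b $ j" if j: "j < q" for j
  proof (rule ccontr)
    assume "\<not> (\<exists>b\<in>B. 0 < b $ j)"
    then have B0: "B \<subseteq> {v \<in> carrier_vec q. v $ j = 0}" using pos B(1) j by fastforce
    have "submodule class_ring {v \<in> carrier_vec q. v $ j = 0} V.V"
      using j V.module_axioms by (auto simp: submodule_def module_vec_simps)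
    then have "V.span B \<subseteq> {v \<in> carrier_vec q. v $ j = 0}" using B0 by (intro V.span_is_subset)
    then have z: "v $ j = 0" if "v \<in> row_lattice A" for v using that B(2) by blast
    have "A $$ (k, j) = 0" if k: "k < p" for k
    proof -
      have "row A k \<in> row_lattice A"
        using row_latticeI[of "unit_vec p k" A] transpose_mult_unit_vec[of k A] A k by simp
      then show ?thesis using z[of "row A k"] A k j by simp
    qed
    then have "col A j = 0\<^sub>v p" using A j by (intro eq_vecI) auto
    then show False using nz[OF j] by simp
  qed
  have "\<exists>v\<in>row_lattice A. (\<forall>j<q. 0 \<le> v $ j) \<and> (\<forall>j<k. 0 < v $ j)" if "k \<le> q" for k
    using that
  proof (induction k)
    case 0
    show ?case using L(2) by (intro bexI[of _ "0\<^sub>v q"]) auto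
  next
    case (Suc k)
    then obtain v where v: "v \<in> row_lattice A" "\<forall>j<q. 0 \<le> v $ j" "\<forall>j<k. 0 < v $ j" by auto
    obtain b where b: "b \<in> B" "0 < b $ k" using ex[of k] Suc.prems by auto
    have vc: "v \<in> carrier_vec q" and bc: "b \<in> carrier_vec q" using L(1) v b BL by auto
    have "0 < (v + b) $ j" if "j < Suc k" for j
    proof -
      have "j < q" using that Suc.prems by simp
      then have "0 \<le> v $ j" "0 \<le> b $ j" using v b pos by auto
      moreover have "0 < v $ j \<or> 0 < b $ j" using that v b by (cases "j = k") auto
      ultimately show ?thesis using \<open>j < q\<close> vc bc by auto
    qed
    moreover have "0 \<le> (v + b) $ j" if "j < q" for j using v b pos that vc bc by auto
    moreover have "v + b \<in> row_lattice A" using L(3) v b BL by blast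
    ultimately show ?case by blast
  qed
  from this[of q] show ?thesis by auto
qed

lemma W_matrix_right_inverse:
  assumes "W_matrix n r Q"
  shows "row_independent Q" "\<exists>X\<in>carrier_mat (n + r) r. Q * X = 1\<^sub>m r"
proof -
  have Q: "Q \<in> carrier_mat r (n + r)" "int_rank Q = r" "no_cotorsion (n + r) (row_lattice Q)"
    using assms unfolding W_matrix_def by auto
  show ind: "row_independent Q" using int_rank_full_iff[OF Q(1)] Q(2) by simp
  show "\<exists>X\<in>carrier_mat (n + r) r. Q * X = 1\<^sub>m r"
    using right_inverse_iff[OF Q(1)] ind no_cotorsion_iff[OF subgroup_row_lattice[OF Q(1)]] Q(3) by simp
qed

lemma W_matrix_gale_dual_symmetric:
  assumes "W_matrix n r Q" "is_gale_dual r n Q V"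
  shows "is_gale_dual n r V Q"
proof -
  obtain X where "X \<in> carrier_mat (n + r) r" "Q * X = 1\<^sub>m r" using W_matrix_right_inverse[OF assms(1)] by blast
  then show ?thesis using gale_dual_symmetric[OF assms(2)] by (simp add: add.commute)
qed

text \<open>A strictly positive \<open>v\<close> with \<open>V v = 0\<close> allows the coefficients of any real combination of the columns
to be shifted into the positive orthant, and the columns span because \<open>V\<close> has a right inverse; so
\<open>V\<close> is F-complete. If one column were a positive multiple of another, the factor would be rational,
and clearing denominators would give a vector of the row lattice of \<open>Q\<close> with exactly two nonzero
entries, of opposite signs.\<close>

lemma F_matrix_if_gale_dual:
  assumes W: "W_matrix n r Q" and dual: "is_gale_dual r n Q V"
  shows "F_matrix n r V"
proof -
  have Q: "Q \<in> carrier_mat r (n + r)" "W_positive Q" "\<And>i. i < n + r \<Longrightarrow> col Q i \<noteq> 0\<^sub>v r"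
    and e: "\<And>i. i < n + r \<Longrightarrow> unit_vec (n + r) i \<notin> row_lattice Q"
    and f: "\<not> (\<exists>v\<in>row_lattice Q. \<exists>i<n + r. \<exists>j<n + r.
          v $ i * v $ j < 0 \<and> (\<forall>k<n + r. k \<noteq> i \<and> k \<noteq> j \<longrightarrow> v $ k = 0))"
    using W unfolding W_matrix_def by auto
  have V: "V \<in> carrier_mat n (n + r)" "row_independent V" and ker: "row_lattice Q = mat_kernel V"
    using W_matrix_gale_dual_symmetric[OF W dual] dual unfolding is_gale_dual_iff by (auto simp: add.commute)
  obtain Y where Y: "Y \<in> carrier_mat (n + r) n" "V * Y = 1\<^sub>m n"
    using gale_dual_right_inverse[OF dual] by (auto simp: add.commute)
  have nz: "col V i \<noteq> 0\<^sub>v n" if "i < n + r" for i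
    by (rule gale_dual_col_nonzero[OF V(1) ker e[OF that] that])
  obtain v where v: "v \<in> row_lattice Q" "\<forall>j<n + r. 0 < v $ j"
    using strictly_positive_if_W_positive[OF Q(1,2)] Q(3) by blast
  have vc: "v \<in> carrier_vec (n + r)" and Vv: "V *\<^sub>v v = 0\<^sub>v n" using v(1) mat_kernel_eq[OF V(1)] unfolding ker by auto
  define R where "R = map_mat real_of_int V"
  have R: "R \<in> carrier_mat n (n + r)" unfolding R_def using V by simp
  have "F_complete V"
  proof -
    have "\<exists>c. y = R *\<^sub>v c \<and> c \<in> carrier_vec (n + r) \<and> (\<forall>i<n + r. 0 \<le> c $ i)"
      if y: "y \<in> carrier_vec n" for y :: "real vec"
    proof -
      define Y' where "Y' = map_mat real_of_int Y"
      have Y': "Y' \<in> carrier_mat (n + r) n" unfolding Y'_def using Y by simp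
      have RY: "R * Y' = 1\<^sub>m n"
        unfolding R_def Y'_def of_int_hom.mat_hom_mult[OF V(1) Y(1), symmetric] Y(2) by (intro eq_matI) auto
      define c0 where "c0 = Y' *\<^sub>v y"
      have c0: "c0 \<in> carrier_vec (n + r)" unfolding c0_def by (rule mult_mat_vec_carrier[OF Y' y])
      have Rc0: "R *\<^sub>v c0 = y" unfolding c0_def using assoc_mult_mat_vec[OF R Y' y] y unfolding RY by simp
      define v' where "v' = map_vec real_of_int v"
      have v': "v' \<in> carrier_vec (n + r)" unfolding v'_def using vc by simp
      have "R *\<^sub>v v' = map_vec real_of_int (V *\<^sub>v v)"
        unfolding R_def v'_def by (rule of_int_hom.mult_mat_vec_hom[OF V(1) vc, symmetric])
      then have Rv: "R *\<^sub>v v' = 0\<^sub>v n" unfolding Vv by (auto intro!: eq_vecI)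
      \<comment> \<open>The entries of \<open>v\<close> are integers, hence at least \<open>1\<close>, so \<open>t v\<close> outweighs \<open>c0\<close>.\<close>
      define t where "t = (\<Sum>j<n + r. \<bar>c0 $ j\<bar>)"
      have tv': "t \<cdot>\<^sub>v v' \<in> carrier_vec (n + r)" using v' by simp
      have "R *\<^sub>v (c0 + t \<cdot>\<^sub>v v') = R *\<^sub>v c0 + R *\<^sub>v (t \<cdot>\<^sub>v v')"
        by (rule mult_add_distrib_mat_vec[OF R c0 tv'])
      also have "\<dots> = y" using Rc0 Rv R v' y by (simp add: mult_mat_smult_vec smult_vec_zero)
      finally have "y = R *\<^sub>v (c0 + t \<cdot>\<^sub>v v')" ..
      moreover have "0 \<le> (c0 + t \<cdot>\<^sub>v v') $ j" if j: "j < n + r" for j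
      proof -
        have t0: "0 \<le> t" unfolding t_def by (intro sum_nonneg) auto
        have "\<bar>c0 $ j\<bar> \<le> t" unfolding t_def
          using member_le_sum[of j "{..<n + r}" "\<lambda>j. \<bar>c0 $ j\<bar>"] j by simp
        moreover have "1 \<le> v' $ j" unfolding v'_def using v(2)[rule_format, OF j] vc j by simp
        then have "t * 1 \<le> t * v' $ j" using t0 by (intro mult_left_mono)
        ultimately have "0 \<le> c0 $ j + t * v' $ j" by linarith
        then show ?thesis using j c0 v' by simp
      qed
      moreover have "c0 + t \<cdot>\<^sub>v v' \<in> carrier_vec (n + r)" using c0 v' by simp
      ultimately show ?thesis by blast
    qed
    moreover have "R *\<^sub>v c \<in> carrier_vec n" if "c \<in> carrier_vec (n + r)" for c
      by (rule mult_mat_vec_carrier[OF R that])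
    ultimately show ?thesis unfolding F_complete_def R_def[symmetric] using V(1) by auto
  qed
  moreover have "\<not> (\<exists>l::real. l > 0 \<and> col R j = l \<cdot>\<^sub>v col R i)"
    if ij: "i < n + r" "j < n + r" "i \<noteq> j" for i j
  proof
    assume "\<exists>l::real. l > 0 \<and> col R j = l \<cdot>\<^sub>v col R i"
    then obtain l where l: "l > 0" "col R j = l \<cdot>\<^sub>v col R i" by blast
    have lk: "real_of_int (V $$ (k, j)) = l * real_of_int (V $$ (k, i))" if "k < n" for k
      using arg_cong[OF l(2), of "\<lambda>v. v $ k"] that ij V unfolding R_def by simp
    obtain k0 where k0: "k0 < n" "V $$ (k0, i) \<noteq> 0"
      using nz[OF ij(1)] V ij(1) by (metis carrier_matD dim_col eq_vecI index_col index_zero_vec)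
    define a b where "a = V $$ (k0, j)" and "b = V $$ (k0, i)"
    have al: "real_of_int a = l * real_of_int b" unfolding a_def b_def by (rule lk[OF k0(1)])
    have "real_of_int b \<noteq> 0" using k0(2) unfolding b_def by simp
    then have "0 < real_of_int b * real_of_int b" by (metis not_real_square_gt_zero)
    then have "0 < l * (real_of_int b * real_of_int b)" by (rule mult_pos_pos[OF l(1)])
    then have "0 < real_of_int (a * b)" using al by simp
    then have ab: "0 < a * b" by linarith
    \<comment> \<open>The factor is \<open>l = a / b\<close>, and \<open>a b = l b\<^sup>2\<close> is positive.\<close>
    define w where "w = b \<cdot>\<^sub>v unit_vec (n + r) j - a \<cdot>\<^sub>v unit_vec (n + r) i"
    have w: "w \<in> carrier_vec (n + r)" unfolding w_def by simp
    have "V *\<^sub>v w = V *\<^sub>v (b \<cdot>\<^sub>v unit_vec (n + r) j) - V *\<^sub>v (a \<cdot>\<^sub>v unit_vec (n + r) i)"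
      unfolding w_def by (rule mult_minus_distrib_mat_vec[OF V(1)]) auto
    also have "\<dots> = b \<cdot>\<^sub>v col V j - a \<cdot>\<^sub>v col V i"
      using V ij mult_mat_unit_vec[of i V] mult_mat_unit_vec[of j V] by (simp add: mult_mat_smult_vec)
    also have "\<dots> = 0\<^sub>v n"
    proof (rule eq_vecI)
      fix k assume "k < dim_vec (0\<^sub>v n :: int vec)"
      then have k: "k < n" by simp
      have "real_of_int (b * V $$ (k, j)) = real_of_int (a * V $$ (k, i))" using lk[OF k] al by simp
      then have "b * V $$ (k, j) = a * V $$ (k, i)" by linarith
      then show "(b \<cdot>\<^sub>v col V j - a \<cdot>\<^sub>v col V i) $ k = 0\<^sub>v n $ k" using k V ij by simp
    qed (use V in simp)
    finally have "w \<in> row_lattice Q" unfolding ker mat_kernel_eq[OF V(1)] using w by simp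
    moreover have "w $ i * w $ j < 0" using ij ab unfolding w_def by (simp add: mult.commute)
    moreover have "\<forall>k<n + r. k \<noteq> i \<and> k \<noteq> j \<longrightarrow> w $ k = 0" using ij unfolding w_def by simp
    ultimately show False using f ij by blast
  qed
  moreover have "int_rank V = n" using int_rank_full_iff[OF V(1)] V(2) by simp
  ultimately show ?thesis unfolding F_matrix_def using V(1) nz unfolding R_def by blast
qed

text \<open>The row lattices of \<open>Q\<close> and \<open>Q'\<close> are the kernels of \<open>V\<close> and of \<open>V\<close> with a divided column. Multiplying
one coordinate by \<open>d\<close> maps the first into the second, and multiplying all the others maps the second
into the first. Both maps keep supports and signs, so strictly positive vectors are carried over to
\<open>Q'\<close>, and forbidden vectors for \<open>Q'\<close> would yield forbidden vectors for \<open>Q\<close>.\<close>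

lemma W_matrix_i_reduction:
  assumes W: "W_matrix n r Q" and dual: "is_gale_dual n r V Q" and i: "i < n + r"
    and dual': "is_gale_dual n r (div_col i (col_gcd V i) V) Q'"
  shows "W_matrix n r Q'"
proof -
  let ?m = "n + r"
  define d where "d = col_gcd V i"
  define V' where "V' = div_col i d V"
  have Q: "Q \<in> carrier_mat r ?m" "W_positive Q" "\<And>j. j < ?m \<Longrightarrow> col Q j \<noteq> 0\<^sub>v r"
    and e: "\<And>j. j < ?m \<Longrightarrow> unit_vec ?m j \<notin> row_lattice Q"
    and f: "\<not> (\<exists>v\<in>row_lattice Q. \<exists>i<?m. \<exists>j<?m.
          v $ i * v $ j < 0 \<and> (\<forall>k<?m. k \<noteq> i \<and> k \<noteq> j \<longrightarrow> v $ k = 0))"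
    using W unfolding W_matrix_def by auto
  have V: "V \<in> carrier_mat n ?m" and ker: "row_lattice Q = mat_kernel V"
    using dual unfolding is_gale_dual_iff by auto
  have V': "V' \<in> carrier_mat n ?m" and Q': "Q' \<in> carrier_mat r ?m" "row_independent Q'"
    and ker': "row_lattice Q' = mat_kernel V'"
    using dual' unfolding is_gale_dual_iff V'_def d_def by auto
  have nz: "col V i \<noteq> 0\<^sub>v n" by (rule gale_dual_col_nonzero[OF V ker e[OF i] i])
  have d: "0 < d" unfolding d_def using col_gcd_pos[of V i] nz V i by simp
  define up where "up = (\<lambda>w :: int vec. vec ?m (\<lambda>j. if j = i then d * w $ j else w $ j))"
  define down where "down = (\<lambda>w :: int vec. vec ?m (\<lambda>j. if j = i then w $ j else d * w $ j))"
  have up: "up w \<in> row_lattice Q'" if "w \<in> row_lattice Q" for w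
  proof -
    have w: "w \<in> carrier_vec ?m" "V *\<^sub>v w = 0\<^sub>v n" using that mat_kernel_eq[OF V] unfolding ker by auto
    then have "V' *\<^sub>v up w = 0\<^sub>v n" unfolding V'_def up_def using div_col_mult(1)[OF V w(1) d_def] by simp
    then show ?thesis unfolding ker' mat_kernel_eq[OF V'] by (simp add: up_def)
  qed
  have down: "down w \<in> row_lattice Q" if "w \<in> row_lattice Q'" for w
  proof -
    have w: "w \<in> carrier_vec ?m" "V' *\<^sub>v w = 0\<^sub>v n" using that mat_kernel_eq[OF V'] unfolding ker' by auto
    then have "V *\<^sub>v down w = 0\<^sub>v n"
      using div_col_mult(2)[OF V w(1) d_def] unfolding V'_def down_def by (simp add: smult_vec_zero)
    then show ?thesis unfolding ker mat_kernel_eq[OF V] by (simp add: down_def)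
  qed
  obtain v where v: "v \<in> row_lattice Q" "\<forall>j<?m. 0 < v $ j"
    using strictly_positive_if_W_positive[OF Q(1,2)] Q(3) by blast
  have pos: "0 < up v $ j" if "j < ?m" for j using v(2) d that unfolding up_def by simp
  have "int_rank Q' = r" using int_rank_full_iff[OF Q'(1)] Q'(2) by simp
  moreover have "no_cotorsion ?m (row_lattice Q')"
    using no_cotorsion_iff[OF subgroup_row_lattice[OF Q'(1)]] saturation_mat_kernel[OF V'] ker' by simp
  moreover have "W_positive Q'"
    by (rule W_positive_if_strictly_positive[OF Q' _ up[OF v(1)] pos]) (use i in linarith)
  moreover have "col Q' j \<noteq> 0\<^sub>v r" if j: "j < ?m" for j
  proof
    assume "col Q' j = 0\<^sub>v r"
    moreover obtain c where c: "c \<in> carrier_vec r" "up v = Q'\<^sup>T *\<^sub>v c"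
      using up[OF v(1)] Q'(1) by (rule row_latticeE)
    ultimately have "up v $ j = 0" using Q' j by simp
    then show False using pos[OF j] by simp
  qed
  moreover have "unit_vec ?m j \<notin> row_lattice Q'" if j: "j < ?m" for j
  proof
    assume "unit_vec ?m j \<in> row_lattice Q'"
    then have down_mem: "down (unit_vec ?m j) \<in> row_lattice Q" by (rule down)
    define k where "k = (if j = i then 1 else d)"
    have "down (unit_vec ?m j) = k \<cdot>\<^sub>v unit_vec ?m j"
      using j unfolding down_def k_def by (intro eq_vecI) auto
    then have k_mem: "k \<cdot>\<^sub>v unit_vec ?m j \<in> row_lattice Q" using down_mem by simp
    have "unit_vec ?m j \<in> saturation ?m (row_lattice Q)"
    proof -
      have "0 < k" using d unfolding k_def by simp
      moreover have "unit_vec ?m j \<in> carrier_vec ?m" by simp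
      ultimately show ?thesis unfolding saturation_def using k_mem by blast
    qed
    then show False using saturation_mat_kernel[OF V] e[OF j] unfolding ker by blast
  qed
  moreover have "\<not> (\<exists>v\<in>row_lattice Q'. \<exists>i<?m. \<exists>j<?m.
          v $ i * v $ j < 0 \<and> (\<forall>k<?m. k \<noteq> i \<and> k \<noteq> j \<longrightarrow> v $ k = 0))"
  proof
    assume "\<exists>v\<in>row_lattice Q'. \<exists>i<?m. \<exists>j<?m.
          v $ i * v $ j < 0 \<and> (\<forall>k<?m. k \<noteq> i \<and> k \<noteq> j \<longrightarrow> v $ k = 0)"
    then obtain w a b where w: "w \<in> row_lattice Q'" "a < ?m" "b < ?m" "w $ a * w $ b < 0"
      "\<forall>k<?m. k \<noteq> a \<and> k \<noteq> b \<longrightarrow> w $ k = 0" by blast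
    have "down w $ a * down w $ b < 0"
    proof -
      have "down w $ a * down w $ b = ((if a = i then 1 else d) * (if b = i then 1 else d)) * (w $ a * w $ b)"
        using w(2,3) unfolding down_def by (simp add: algebra_simps)
      moreover have "0 < (if a = i then 1 else d) * (if b = i then 1 else d)" using d by simp
      ultimately show ?thesis using w(4) by (simp only: mult_pos_neg)
    qed
    moreover have "\<forall>k<?m. k \<noteq> a \<and> k \<noteq> b \<longrightarrow> down w $ k = 0" using w(5) unfolding down_def by simp
    ultimately show False using f down[OF w(1)] w(2,3) by blast
  qed
  ultimately show ?thesis unfolding W_matrix_def using Q'(1) by blast
qed

section \<open>The torsion group of a W-matrix and iterated reductions\<close>

lemma delete_col_torsion_group:
  assumes W: "W_matrix n r Q" and dual: "is_gale_dual r n Q V" and i: "i < n + r"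
  defines "T \<equiv> torsion_group (lattice_quotient (n + r - 1) (row_lattice (delete_col i Q)))"
  shows "cyclic_group T" "finite (carrier T)" "int (card (carrier T)) = col_gcd V i"
proof -
  define q where "q = n + r - 1"
  have m: "n + r = Suc q" using i unfolding q_def by simp
  then have m': "r + n = Suc q" by simp
  have Q: "Q \<in> carrier_mat r (Suc q)" and e: "unit_vec (Suc q) i \<notin> row_lattice Q"
    using W i unfolding W_matrix_def m by auto
  have V: "V \<in> carrier_mat n (Suc q)" and ker: "row_lattice Q = mat_kernel V"
    using W_matrix_gale_dual_symmetric[OF W dual] unfolding is_gale_dual_iff m by auto
  obtain Y where Y: "Y \<in> carrier_mat (Suc q) n" "V * Y = 1\<^sub>m n"
    using gale_dual_right_inverse[OF dual] unfolding m' by auto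
  have i': "i < Suc q" using i m by simp
  have nz: "col V i \<noteq> 0\<^sub>v n" by (rule gale_dual_col_nonzero[OF V ker e i'])
  have d: "0 < col_gcd V i" using col_gcd_pos[of V i] nz V i' by simp
  obtain x where x: "x \<in> carrier_vec q"
    "\<And>a. a \<cdot>\<^sub>v x \<in> row_lattice (delete_col i Q) \<longleftrightarrow> col_gcd V i dvd a"
    "\<And>w. w \<in> saturation q (row_lattice (delete_col i Q)) \<Longrightarrow>
      \<exists>a. w - a \<cdot>\<^sub>v x \<in> row_lattice (delete_col i Q)"
    using delete_col_torsion_generator[OF V Y Q ker i' nz] by blast
  have sub: "subgroup (row_lattice (delete_col i Q)) (vec_group q)"
    by (rule subgroup_row_lattice[OF delete_col_carrier[OF Q]])
  show "cyclic_group T" "finite (carrier T)" "int (card (carrier T)) = col_gcd V i"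
    unfolding T_def q_def[symmetric] using cyclic_torsion_group[OF sub d x(1,2)] x(3) by blast+
qed

lemma no_cotorsion_delete_col_iff:
  assumes W: "W_matrix n r Q" and dual: "is_gale_dual r n Q V" and i: "i < n + r"
  shows "no_cotorsion (n + r - 1) (row_lattice (delete_col i Q)) \<longleftrightarrow> col_gcd V i = 1"
proof -
  define G where "G = lattice_quotient (n + r - 1) (row_lattice (delete_col i Q))"
  define T where "T = torsion_group G"
  have T: "cyclic_group T" "finite (carrier T)" "int (card (carrier T)) = col_gcd V i"
    unfolding T_def G_def using delete_col_torsion_group[OF W dual i] by auto
  have "Q \<in> carrier_mat r (Suc (n + r - 1))" using W i unfolding W_matrix_def by auto
  then have sub: "subgroup (row_lattice (delete_col i Q)) (vec_group (n + r - 1))"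
    by (rule subgroup_row_lattice[OF delete_col_carrier])
  have "\<one>\<^bsub>G\<^esub> \<in> carrier T"
  proof -
    interpret A: comm_group "vec_group (n + r - 1)" by (rule comm_group_vec)
    interpret N: normal "row_lattice (delete_col i Q)" "vec_group (n + r - 1)"
      using sub by (rule A.subgroup_imp_normal)
    interpret G: group G unfolding G_def by (rule N.factorgroup_is_group)
    show ?thesis unfolding T_def torsion_group_def by (auto intro: exI[of _ 1])
  qed
  then have "carrier T = {\<one>\<^bsub>G\<^esub>} \<longleftrightarrow> card (carrier T) = 1" using T(2) by (auto simp: card_1_singleton_iff)
  then show ?thesis unfolding no_cotorsion_def G_def[symmetric] T_def[symmetric] T(3)[symmetric] by simp
qed

text \<open>The reduction may be formed with any Gale dual of \<open>Q\<close>, but the gcd of its \<open>i\<close>-th column is the order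
of a group that depends on \<open>Q\<close> only.\<close>

lemma i_reduction_step:
  assumes r: "0 < r" and W: "W_matrix n r Q" and dual: "is_gale_dual r n Q V" and i: "i < n + r"
    and red: "is_i_reduction n r i Q Q'"
  shows "W_matrix n r Q'" "is_gale_dual r n Q' (div_col i (col_gcd V i) V)"
    "is_gale_dual n r (div_col i (col_gcd V i) V) Q'"
proof -
  define q where "q = n + r - 1"
  have m: "n + r = Suc q" using i unfolding q_def by simp
  then have m': "r + n = Suc q" by simp
  obtain V1 \<alpha> \<beta> S where V1: "is_gale_dual r n Q V1"
    and sm: "smith_transformation r q (delete_col i Q) \<alpha> \<beta> S"
    and Q': "Q' = div_row (r - 1) (col_gcd V1 i) (multcol i (col_gcd V1 i) (\<alpha> * Q))"
    using red unfolding is_i_reduction_def q_def by blast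
  have gcd: "col_gcd V1 i = col_gcd V i"
    using delete_col_torsion_group(3)[OF W V1 i] delete_col_torsion_group(3)[OF W dual i] by simp
  have i': "i < Suc q" using i m by simp
  have e: "unit_vec (Suc q) i \<notin> row_lattice Q" using W i unfolding W_matrix_def m by auto
  note sym = W_matrix_gale_dual_symmetric[OF W dual]
  show dual': "is_gale_dual n r (div_col i (col_gcd V i) V) Q'"
    unfolding Q' gcd by (rule gale_dual_i_reduction(2)[OF r m dual sym i' e sm])
  show "W_matrix n r Q'" by (rule W_matrix_i_reduction[OF W sym i dual'])
  have V: "V \<in> carrier_mat n (n + r)" using sym unfolding is_gale_dual_iff by simp
  obtain Y where Y: "Y \<in> carrier_mat (n + r) n" "V * Y = 1\<^sub>m n"
    using gale_dual_right_inverse[OF dual] by (auto simp: add.commute)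
  obtain Y' where Y': "Y' \<in> carrier_mat (n + r) n" "div_col i (col_gcd V i) V * Y' = 1\<^sub>m n"
    using div_col_right_inverse[OF V Y refl] by blast
  show "is_gale_dual r n Q' (div_col i (col_gcd V i) V)"
    by (rule gale_dual_symmetric[OF dual' Y'])
qed

lemma i_reduction_exists:
  assumes W: "W_matrix n r Q" and i: "i < n + r"
  shows "\<exists>Q'. is_i_reduction n r i Q Q'"
proof -
  have Q: "Q \<in> carrier_mat r (Suc (n + r - 1))" "Q \<in> carrier_mat r (r + n)"
    using W i unfolding W_matrix_def by (auto simp: add.commute)
  obtain V where "is_gale_dual r n Q V" using gale_dual_exists[OF Q(2)] W_matrix_right_inverse(1)[OF W] by blast
  moreover obtain \<alpha> \<beta> S where "smith_transformation r (n + r - 1) (delete_col i Q) \<alpha> \<beta> S"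
    using smith_transformation_exists[OF delete_col_carrier[OF Q(1)]] by blast
  ultimately show ?thesis unfolding is_i_reduction_def by blast
qed

text \<open>What the Gale dual \<open>V\<close> has become when the first \<open>k\<close> reductions have been performed on the other side.\<close>

definition partial_F_reduction :: "nat \<Rightarrow> int mat \<Rightarrow> int mat" where
  "partial_F_reduction k V = mat (dim_row V) (dim_col V)
     (\<lambda>(l, j). if j < k then V $$ (l, j) div col_gcd V j else V $$ (l, j))"

lemma partial_F_reduction_0: "partial_F_reduction 0 V = V"
  unfolding partial_F_reduction_def by (intro eq_matI) auto

lemma partial_F_reduction_full: "partial_F_reduction (dim_col V) V = F_reduction V"
  unfolding partial_F_reduction_def F_reduction_def by (intro eq_matI) auto

lemma partial_F_reduction_Suc:
  assumes "k < dim_col V"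
  shows "partial_F_reduction (Suc k) V =
    div_col k (col_gcd (partial_F_reduction k V) k) (partial_F_reduction k V)"
proof -
  have "col (partial_F_reduction k V) k = col V k"
    using assms unfolding partial_F_reduction_def by (intro eq_vecI) auto
  then have "col_gcd (partial_F_reduction k V) k = col_gcd V k" unfolding col_gcd_def by simp
  then show ?thesis unfolding partial_F_reduction_def div_col_def
    using assms by (intro eq_matI) (auto simp: less_Suc_eq)
qed

lemma iterated_reduction_invariant:
  assumes r: "0 < r" and W: "W_matrix n r Q" and dual: "is_gale_dual r n Q V"
    and R: "iterated_reduction n r Q R" and k: "k \<le> n + r"
  shows "W_matrix n r (R k) \<and> is_gale_dual r n (R k) (partial_F_reduction k V) \<and>
    is_gale_dual n r (partial_F_reduction k V) (R k)"
  using k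
proof (induction k)
  case 0
  then show ?case
    using R W dual W_matrix_gale_dual_symmetric[OF W dual]
    unfolding iterated_reduction_def by (simp add: partial_F_reduction_0)
next
  case (Suc k)
  have "V \<in> carrier_mat n (r + n)" using dual unfolding is_gale_dual_iff by simp
  then have Vk: "partial_F_reduction (Suc k) V =
    div_col k (col_gcd (partial_F_reduction k V) k) (partial_F_reduction k V)"
    using Suc.prems by (intro partial_F_reduction_Suc) auto
  have "is_i_reduction n r k (R k) (R (Suc k))" using R Suc.prems unfolding iterated_reduction_def by auto
  moreover have "W_matrix n r (R k)" "is_gale_dual r n (R k) (partial_F_reduction k V)" "k < n + r"
    using Suc by auto
  ultimately show ?case unfolding Vk using i_reduction_step[OF r] by blast
qed

text \<open>Dependent choice: a next reduction exists as long as the current matrix is a W-matrix, so this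
property has to be carried along.\<close>

lemma iterated_reduction_exists:
  assumes r: "0 < r" and W: "W_matrix n r Q"
  shows "\<exists>R. iterated_reduction n r Q R"
proof -
  have "\<exists>R. \<forall>k. ((k = 0 \<longrightarrow> R k = Q) \<and> (k \<le> n + r \<longrightarrow> W_matrix n r (R k))) \<and>
    (k < n + r \<longrightarrow> is_i_reduction n r k (R k) (R (Suc k)))"
  proof (rule dependent_nat_choice)
    show "\<exists>x. ((0::nat) = 0 \<longrightarrow> x = Q) \<and> (0 \<le> n + r \<longrightarrow> W_matrix n r x)" using W by blast
  next
    fix P k assume P: "(k = 0 \<longrightarrow> P = Q) \<and> (k \<le> n + r \<longrightarrow> W_matrix n r P)"
    show "\<exists>P'. ((Suc k = 0 \<longrightarrow> P' = Q) \<and> (Suc k \<le> n + r \<longrightarrow> W_matrix n r P')) \<and>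
      (k < n + r \<longrightarrow> is_i_reduction n r k P P')"
    proof (cases "k < n + r")
      case True
      then have WP: "W_matrix n r P" using P by simp
      have Pc: "P \<in> carrier_mat r (r + n)" using WP unfolding W_matrix_def by (simp add: add.commute)
      obtain V where "is_gale_dual r n P V"
        using gale_dual_exists[OF Pc W_matrix_right_inverse(1)[OF WP]] by blast
      moreover obtain P' where "is_i_reduction n r k P P'" using i_reduction_exists[OF WP True] by blast
      ultimately have "W_matrix n r P'" using i_reduction_step(1)[OF r WP _ True] by blast
      then show ?thesis using \<open>is_i_reduction n r k P P'\<close> by blast
    qed simp
  qed
  then show ?thesis unfolding iterated_reduction_def by blast
qed

theorem theorem3p15:
  fixes n r :: nat and Q V :: "int mat"
  assumes "0 < n" and "0 < r"
    and "W_matrix n r Q"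
    and "is_gale_dual r n Q V"
  shows
    "(W_reduced n r Q \<longleftrightarrow>
        (\<forall>i<n + r. no_cotorsion (n + r - 1) (row_lattice (delete_col i Q)))) \<and>
     (\<forall>i<n + r.
        let T = torsion_group (lattice_quotient (n + r - 1) (row_lattice (delete_col i Q)))
        in cyclic_group T \<and> finite (carrier T) \<and> int (card (carrier T)) = col_gcd V i) \<and>
     (\<forall>i<n + r. \<forall>\<alpha> \<beta> S.
        smith_transformation r (n + r - 1) (delete_col i Q) \<alpha> \<beta> S \<longrightarrow>
        (let d = col_gcd V i; B = multcol i d (\<alpha> * Q)
         in (\<forall>j<n + r. d dvd B $$ (r - 1, j)) \<and>
            is_gale_dual n r (div_col i d V) (div_row (r - 1) d B))) \<and>
     ((\<exists>R. iterated_reduction n r Q R) \<and>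
      (\<forall>R. iterated_reduction n r Q R \<longrightarrow>
         (\<forall>k\<le>n + r. W_matrix n r (R k)) \<and> is_W_reduction n r Q (R (n + r))))"
proof (intro conjI allI impI)
  note W = assms(3) and dual = assms(4)
  have m: "n + r = Suc (n + r - 1)" using assms(1) by simp
  show "W_reduced n r Q \<longleftrightarrow>
    (\<forall>i<n + r. no_cotorsion (n + r - 1) (row_lattice (delete_col i Q)))"
    unfolding W_reduced_def F_reduced_def
    using W dual no_cotorsion_delete_col_iff[OF W] F_matrix_if_gale_dual[OF W] by blast
  show "let T = torsion_group (lattice_quotient (n + r - 1) (row_lattice (delete_col i Q)))
    in cyclic_group T \<and> finite (carrier T) \<and> int (card (carrier T)) = col_gcd V i" if "i < n + r" for i
    unfolding Let_def using delete_col_torsion_group[OF W dual that] by blast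
  show "let d = col_gcd V i; B = multcol i d (\<alpha> * Q)
    in (\<forall>j<n + r. d dvd B $$ (r - 1, j)) \<and>
      is_gale_dual n r (div_col i d V) (div_row (r - 1) d B)"
    if i: "i < n + r" and sm: "smith_transformation r (n + r - 1) (delete_col i Q) \<alpha> \<beta> S" for i \<alpha> \<beta> S
  proof -
    have e: "unit_vec (Suc (n + r - 1)) i \<notin> row_lattice Q"
      using W i unfolding m[symmetric] W_matrix_def by blast
    show ?thesis unfolding Let_def
      using gale_dual_i_reduction[OF assms(2) m dual W_matrix_gale_dual_symmetric[OF W dual] _ e sm] i m
      by simp
  qed
  show "\<exists>R. iterated_reduction n r Q R" by (rule iterated_reduction_exists[OF assms(2) W])
  fix R assume R: "iterated_reduction n r Q R"
  note inv = iterated_reduction_invariant[OF assms(2) W dual R]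
  show "W_matrix n r (R k)" if "k \<le> n + r" for k using inv[OF that] by blast
  have "V \<in> carrier_mat n (r + n)" using dual unfolding is_gale_dual_iff by simp
  then have "partial_F_reduction (n + r) V = F_reduction V"
    using partial_F_reduction_full[of V] by (simp add: add.commute)
  then show "is_W_reduction n r Q (R (n + r))"
    unfolding is_W_reduction_def using inv[of "n + r"] dual by auto
qed

end
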